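(* Let $M$ be a compact connected manifold and ${\mathscr F}$ a coherent ${\mathscr A}$-module on $M$. If ${\mathscr F}$ is a locally free ${\mathscr A}$-module, then the map $$E\in\Gamma\big(M,{\mathscr A}^1\otimes_{\mathscr A}{\mathscr Hom}_{\mathscr A}({\mathscr F},{\mathscr F})\big)\mapsto{\mathcal E}\in{\rm Hom}_{\mathscr A}\big({\mathscr F},{\mathscr A}^1\otimes_{\mathscr A}{\mathscr F}\big)$$ is an isomorphism of vector spaces.
   Context: ${\mathscr A}$ is the sheaf of differentiable functions and ${\mathscr A}^1$ the sheaf of differential $1$-forms on $M$; ${\mathscr Hom}_{\mathscr A}$ is the sheaf of germs of ${\mathscr A}$-morphisms. The map $E\mapsto{\mathcal E}$ is the one induced on global sections by the presheaf morphism sending $\alpha\otimes f\in{\mathscr A}^1(U)\otimes_{{\mathscr A}(U)}{\rm Hom}_{{\mathscr A}|_U}({\mathscr F}|_U,{\mathscr F}|_U)$ to the morphism ${\mathscr F}|_U\to({\mathscr A}^1\otimes_{\mathscr A}{\mathscr F})|_U$ given by $\sigma\mapsto\alpha|_V\otimes f|_V(\sigma)$ for $\sigma\in{\mathscr F}(V)$, $V\subset U$ open; i.e. if $E|_V=\sum_a\eta_a\otimes e_a$, then ${\mathcal E}(\sigma)=\sum_a\eta_a\otimes e_a(\sigma)$. *)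

theory Defs
  imports "HOL-Algebra.Module" "HOL-Algebra.Free_Abelian_Groups" "HOL-Algebra.Generated_Groups"
    "HOL-Algebra.Algebraic_Closure_Type" "HOL-Analysis.Analysis"
begin

section \<open>Smooth manifolds\<close>

text \<open>
  The model spaces are the topological spaces \<^term>\<open>Euclidean_space n\<close>, whose points are the
  functions \<^typ>\<open>nat \<Rightarrow> real\<close> vanishing from \<open>n\<close> on; in this way the dimension is an ordinary
  natural number and may be \<open>0\<close>.
\<close>

definition partial_deriv :: "nat \<Rightarrow> ((nat \<Rightarrow> real) \<Rightarrow> real) \<Rightarrow> (nat \<Rightarrow> real) \<Rightarrow> real" where
  "partial_deriv i f x = deriv (\<lambda>t. f (x(i := t))) (x i)"

text \<open>
  The class \<open>C\<^sup>k\<close> is used for sets \<open>S\<close> that are open in \<^term>\<open>Euclidean_space n\<close>: all partial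
  derivatives of order at most \<open>k\<close> exist and are continuous on \<open>S\<close>. The values of \<open>f\<close> outside
  \<open>S\<close> are irrelevant.
\<close>

primrec Ck_on :: "nat \<Rightarrow> nat \<Rightarrow> (nat \<Rightarrow> real) set \<Rightarrow> ((nat \<Rightarrow> real) \<Rightarrow> real) \<Rightarrow> bool" where
  "Ck_on n 0 S f \<longleftrightarrow> continuous_map (subtopology (Euclidean_space n) S) euclideanreal f"
| "Ck_on n (Suc k) S f \<longleftrightarrow>
     continuous_map (subtopology (Euclidean_space n) S) euclideanreal f \<and>
     (\<forall>i<n. (\<forall>x\<in>S. (\<lambda>t. f (x(i := t))) differentiable (at (x i))) \<and>
            Ck_on n k S (partial_deriv i f))"

definition smooth_on :: "nat \<Rightarrow> (nat \<Rightarrow> real) set \<Rightarrow> ((nat \<Rightarrow> real) \<Rightarrow> real) \<Rightarrow> bool" where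
  "smooth_on n S f \<longleftrightarrow> (\<forall>k. Ck_on n k S f)"

text \<open>A chart is a pair of an open domain and a coordinate map, relevant on the domain only.\<close>

type_synonym 'm chart = "'m set \<times> ('m \<Rightarrow> nat \<Rightarrow> real)"

definition chart_on :: "nat \<Rightarrow> 'm topology \<Rightarrow> 'm chart \<Rightarrow> bool" where
  "chart_on n T = (\<lambda>(D, \<phi>). openin T D \<and> openin (Euclidean_space n) (\<phi> ` D) \<and>
     homeomorphic_map (subtopology T D) (subtopology (Euclidean_space n) (\<phi> ` D)) \<phi>)"

definition smooth_manifold :: "nat \<Rightarrow> 'm topology \<Rightarrow> 'm chart set \<Rightarrow> bool" where
  "smooth_manifold n T Atl \<longleftrightarrow>
     Hausdorff_space T \<and> second_countable T \<and>
     (\<forall>c\<in>Atl. chart_on n T c) \<and> (\<Union>(D, \<phi>)\<in>Atl. D) = topspace T \<and>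
     (\<forall>(D, \<phi>)\<in>Atl. \<forall>(D', \<psi>)\<in>Atl. \<forall>i<n.
        smooth_on n (\<phi> ` (D \<inter> D')) (\<lambda>y. \<psi> (inv_into D \<phi> y) i))"


section \<open>Sheaves of modules\<close>

text \<open>
  Presheaves are given by sections and restriction maps; only their values on open sets matter.
  \<open>rres A U V\<close> and \<open>mres F U V\<close> are the restrictions from \<open>U\<close> to a smaller open set \<open>V\<close>.
\<close>

record ('x, 'a) ring_presheaf =
  rsec :: "'x set \<Rightarrow> 'a ring"
  rres :: "'x set \<Rightarrow> 'x set \<Rightarrow> 'a \<Rightarrow> 'a"

record ('x, 'a, 's) module_presheaf =
  msec :: "'x set \<Rightarrow> ('a, 's) module"
  mres :: "'x set \<Rightarrow> 'x set \<Rightarrow> 's \<Rightarrow> 's"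

definition opens_in :: "'x topology \<Rightarrow> 'x set \<Rightarrow> 'x set set" where
  "opens_in T U = {V. openin T V \<and> V \<subseteq> U}"

definition presheaf_of_modules ::
  "'x topology \<Rightarrow> ('x, 'a) ring_presheaf \<Rightarrow> ('x, 'a, 's) module_presheaf \<Rightarrow> bool" where
  "presheaf_of_modules T A F \<longleftrightarrow>
     (\<forall>U. openin T U \<longrightarrow> module (rsec A U) (msec F U)) \<and>
     (\<forall>U V. openin T U \<and> V \<in> opens_in T U \<longrightarrow>
        (\<forall>s\<in>carrier (msec F U). mres F U V s \<in> carrier (msec F V)) \<and>
        (\<forall>s\<in>carrier (msec F U). \<forall>t\<in>carrier (msec F U).
           mres F U V (s \<oplus>\<^bsub>msec F U\<^esub> t) = mres F U V s \<oplus>\<^bsub>msec F V\<^esub> mres F U V t) \<and>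
        (\<forall>r\<in>carrier (rsec A U). \<forall>s\<in>carrier (msec F U).
           mres F U V (r \<odot>\<^bsub>msec F U\<^esub> s) = rres A U V r \<odot>\<^bsub>msec F V\<^esub> mres F U V s)) \<and>
     (\<forall>U. openin T U \<longrightarrow> (\<forall>s\<in>carrier (msec F U). mres F U U s = s)) \<and>
     (\<forall>U V W. openin T U \<and> V \<in> opens_in T U \<and> W \<in> opens_in T V \<longrightarrow>
        (\<forall>s\<in>carrier (msec F U). mres F V W (mres F U V s) = mres F U W s))"

definition sheaf_of_modules ::
  "'x topology \<Rightarrow> ('x, 'a) ring_presheaf \<Rightarrow> ('x, 'a, 's) module_presheaf \<Rightarrow> bool" where
  "sheaf_of_modules T A F \<longleftrightarrow> presheaf_of_modules T A F \<and>
     (\<forall>\<U> s. (\<forall>U\<in>\<U>. openin T U \<and> s U \<in> carrier (msec F U)) \<and>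
        (\<forall>U\<in>\<U>. \<forall>V\<in>\<U>. mres F U (U \<inter> V) (s U) = mres F V (U \<inter> V) (s V)) \<longrightarrow>
        (\<exists>!t. t \<in> carrier (msec F (\<Union>\<U>)) \<and> (\<forall>U\<in>\<U>. mres F (\<Union>\<U>) U t = s U)))"

subsection \<open>Morphisms and the sheaf of morphisms\<close>

definition module_hom :: "'a ring \<Rightarrow> ('a, 's) module \<Rightarrow> ('a, 't) module \<Rightarrow> ('s \<Rightarrow> 't) set" where
  "module_hom R M N = {h \<in> carrier M \<rightarrow>\<^sub>E carrier N.
     (\<forall>x\<in>carrier M. \<forall>y\<in>carrier M. h (x \<oplus>\<^bsub>M\<^esub> y) = h x \<oplus>\<^bsub>N\<^esub> h y) \<and>
     (\<forall>r\<in>carrier R. \<forall>x\<in>carrier M. h (r \<odot>\<^bsub>M\<^esub> x) = r \<odot>\<^bsub>N\<^esub> h x)}"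

text \<open>
  \<open>sheaf_hom T A F G U\<close> is the set of morphisms from the restriction of \<open>F\<close> to the open set \<open>U\<close>
  to that of \<open>G\<close>. Extensionality makes these families determined by their relevant values.
\<close>

definition sheaf_hom ::
  "'x topology \<Rightarrow> ('x, 'a) ring_presheaf \<Rightarrow> ('x, 'a, 's) module_presheaf \<Rightarrow>
   ('x, 'a, 't) module_presheaf \<Rightarrow> 'x set \<Rightarrow> ('x set \<Rightarrow> 's \<Rightarrow> 't) set" where
  "sheaf_hom T A F G U =
     {f \<in> (\<Pi>\<^sub>E V\<in>opens_in T U. module_hom (rsec A V) (msec F V) (msec G V)).
        \<forall>V\<in>opens_in T U. \<forall>W\<in>opens_in T V. \<forall>s\<in>carrier (msec F V).
          mres G V W (f V s) = f W (mres F V W s)}"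

definition Hom_sheaf ::
  "'x topology \<Rightarrow> ('x, 'a) ring_presheaf \<Rightarrow> ('x, 'a, 's) module_presheaf \<Rightarrow>
   ('x, 'a, 't) module_presheaf \<Rightarrow> ('x, 'a, 'x set \<Rightarrow> 's \<Rightarrow> 't) module_presheaf" where
  "Hom_sheaf T A F G =
     \<lparr>msec = (\<lambda>U.
        \<lparr>carrier = sheaf_hom T A F G U, monoid.mult = undefined, one = undefined,
         zero = (\<lambda>V\<in>opens_in T U. \<lambda>s\<in>carrier (msec F V). \<zero>\<^bsub>msec G V\<^esub>),
         add = (\<lambda>f g. \<lambda>V\<in>opens_in T U. \<lambda>s\<in>carrier (msec F V). f V s \<oplus>\<^bsub>msec G V\<^esub> g V s),
         module.smult = (\<lambda>r f. \<lambda>V\<in>opens_in T U. \<lambda>s\<in>carrier (msec F V).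
                    rres A U V r \<odot>\<^bsub>msec G V\<^esub> f V s)\<rparr>),
      mres = (\<lambda>U V f. restrict f (opens_in T V))\<rparr>"

subsection \<open>Free, locally free and coherent modules\<close>

definition free_sheaf ::
  "('x, 'a) ring_presheaf \<Rightarrow> nat \<Rightarrow> ('x, 'a, nat \<Rightarrow> 'a) module_presheaf" where
  "free_sheaf A r =
     \<lparr>msec = (\<lambda>U.
        \<lparr>carrier = {..<r} \<rightarrow>\<^sub>E carrier (rsec A U), monoid.mult = undefined, one = undefined,
         zero = (\<lambda>i\<in>{..<r}. \<zero>\<^bsub>rsec A U\<^esub>),
         add = (\<lambda>s t. \<lambda>i\<in>{..<r}. s i \<oplus>\<^bsub>rsec A U\<^esub> t i),
         module.smult = (\<lambda>a s. \<lambda>i\<in>{..<r}. a \<otimes>\<^bsub>rsec A U\<^esub> s i)\<rparr>),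
      mres = (\<lambda>U V s. \<lambda>i\<in>{..<r}. rres A U V (s i))\<rparr>"

definition locally_free ::
  "'x topology \<Rightarrow> ('x, 'a) ring_presheaf \<Rightarrow> ('x, 'a, 's) module_presheaf \<Rightarrow> bool" where
  "locally_free T A F \<longleftrightarrow>
     (\<forall>x\<in>topspace T. \<exists>U. openin T U \<and> x \<in> U \<and>
        (\<exists>r. \<exists>f \<in> sheaf_hom T A (free_sheaf A r) F U.
           \<forall>V\<in>opens_in T U. bij_betw (f V) (carrier (msec (free_sheaf A r) V)) (carrier (msec F V))))"

definition exact_on ::
  "'x topology \<Rightarrow> ('x, 'a, 's) module_presheaf \<Rightarrow> ('x, 'a, 't) module_presheaf \<Rightarrow>
   ('x, 'a, 'u) module_presheaf \<Rightarrow> 'x set \<Rightarrow> ('x set \<Rightarrow> 's \<Rightarrow> 't) \<Rightarrow> ('x set \<Rightarrow> 't \<Rightarrow> 'u) \<Rightarrow> bool"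
  where
  "exact_on T F G H U f g \<longleftrightarrow>
     (\<forall>V\<in>opens_in T U. \<forall>t\<in>carrier (msec G V).
        g V t = \<zero>\<^bsub>msec H V\<^esub> \<longleftrightarrow>
        (\<forall>x\<in>V. \<exists>W\<in>opens_in T V. x \<in> W \<and> mres G V W t \<in> f W ` carrier (msec F W)))"

definition epi_on ::
  "'x topology \<Rightarrow> ('x, 'a, 's) module_presheaf \<Rightarrow> ('x, 'a, 't) module_presheaf \<Rightarrow>
   'x set \<Rightarrow> ('x set \<Rightarrow> 's \<Rightarrow> 't) \<Rightarrow> bool" where
  "epi_on T F G U f \<longleftrightarrow>
     (\<forall>V\<in>opens_in T U. \<forall>t\<in>carrier (msec G V). \<forall>x\<in>V.
        \<exists>W\<in>opens_in T V. x \<in> W \<and> mres G V W t \<in> f W ` carrier (msec F W))"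

text \<open>
  Coherence is local finite presentation: locally there is an exact sequence
  \<open>A\<^sup>p \<rightarrow> A\<^sup>q \<rightarrow> F \<rightarrow> 0\<close>. Coherence in the sense of Serre (finite type, and all relation
  sheaves of finite type) implies this condition, but is unsuitable for smooth functions: it fails
  for the structure sheaf itself in positive dimension.
\<close>

definition coherent ::
  "'x topology \<Rightarrow> ('x, 'a) ring_presheaf \<Rightarrow> ('x, 'a, 's) module_presheaf \<Rightarrow> bool" where
  "coherent T A F \<longleftrightarrow>
     (\<forall>x\<in>topspace T. \<exists>U. openin T U \<and> x \<in> U \<and>
        (\<exists>p q. \<exists>f \<in> sheaf_hom T A (free_sheaf A p) (free_sheaf A q) U.
           \<exists>g \<in> sheaf_hom T A (free_sheaf A q) F U.
             exact_on T (free_sheaf A p) (free_sheaf A q) F U f g \<and>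
             epi_on T (free_sheaf A q) F U g))"

subsection \<open>Sheafification\<close>

text \<open>
  The germ at \<open>x\<close> of a section \<open>s\<close> over \<open>U\<close>, as the class of all sections on neighbourhoods of
  \<open>x\<close> that agree with \<open>s\<close> near \<open>x\<close>.
\<close>

definition germ ::
  "'x topology \<Rightarrow> ('x, 'a, 's) module_presheaf \<Rightarrow> 'x \<Rightarrow> 'x set \<Rightarrow> 's \<Rightarrow> ('x set \<times> 's) set" where
  "germ T P x U s = {(V, t). openin T V \<and> x \<in> V \<and> t \<in> carrier (msec P V) \<and>
     (\<exists>W. openin T W \<and> x \<in> W \<and> W \<subseteq> U \<inter> V \<and> mres P U W s = mres P V W t)}"

text \<open>
  Sections of the sheafification are the families of germs that are locally given by sections. In
  the operations, the unions range over representatives of the germs involved; all members of such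
  a union are the same germ.
\<close>

definition sheafify ::
  "'x topology \<Rightarrow> ('x, 'a) ring_presheaf \<Rightarrow> ('x, 'a, 's) module_presheaf \<Rightarrow>
   ('x, 'a, 'x \<Rightarrow> ('x set \<times> 's) set) module_presheaf" where
  "sheafify T A P =
     \<lparr>msec = (\<lambda>U.
        \<lparr>carrier = {g \<in> extensional U. \<forall>x\<in>U. \<exists>V\<in>opens_in T U. x \<in> V \<and>
                      (\<exists>s\<in>carrier (msec P V). \<forall>y\<in>V. g y = germ T P y V s)},
         monoid.mult = undefined, one = undefined,
         zero = (\<lambda>x\<in>U. germ T P x U \<zero>\<^bsub>msec P U\<^esub>),
         add = (\<lambda>g h. \<lambda>x\<in>U. \<Union>(V, s)\<in>g x. \<Union>(W, t)\<in>h x.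
                  germ T P x (V \<inter> W) (mres P V (V \<inter> W) s \<oplus>\<^bsub>msec P (V \<inter> W)\<^esub> mres P W (V \<inter> W) t)),
         module.smult = (\<lambda>r g. \<lambda>x\<in>U. \<Union>(V, s)\<in>g x.
                  germ T P x (U \<inter> V) (rres A U (U \<inter> V) r \<odot>\<^bsub>msec P (U \<inter> V)\<^esub> mres P V (U \<inter> V) s))\<rparr>),
      mres = (\<lambda>U V g. restrict g V)\<rparr>"

definition to_sheafify ::
  "'x topology \<Rightarrow> ('x, 'a, 's) module_presheaf \<Rightarrow> 'x set \<Rightarrow> 's \<Rightarrow> 'x \<Rightarrow> ('x set \<times> 's) set" where
  "to_sheafify T P U s = (\<lambda>x\<in>U. germ T P x U s)"

text \<open>
  The morphism from the sheafification of \<open>P\<close> to a sheaf \<open>G\<close> induced by a presheaf morphism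
  \<open>f\<close> from \<open>P\<close> to \<open>G\<close>, as determined by the universal property
  (for a sheaf \<open>G\<close>, exactly one section satisfies the condition).
\<close>

definition sheafify_lift ::
  "'x topology \<Rightarrow> ('x, 'a, 's) module_presheaf \<Rightarrow> ('x, 'a, 't) module_presheaf \<Rightarrow>
   ('x set \<Rightarrow> 's \<Rightarrow> 't) \<Rightarrow> 'x set \<Rightarrow> ('x \<Rightarrow> ('x set \<times> 's) set) \<Rightarrow> 't" where
  "sheafify_lift T P G f U g =
     (THE t. t \<in> carrier (msec G U) \<and>
        (\<forall>V\<in>opens_in T U. \<forall>s\<in>carrier (msec P V).
           restrict g V = to_sheafify T P V s \<longrightarrow> mres G U V t = f V s))"

subsection \<open>Tensor products\<close>

text \<open>
  The tensor product of two modules is the free abelian group on the pairs modulo the usual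
  relations; its elements are cosets.
\<close>

definition tensor_relations ::
  "'a ring \<Rightarrow> ('a, 's) module \<Rightarrow> ('a, 't) module \<Rightarrow> ('s \<times> 't \<Rightarrow>\<^sub>0 int) set" where
  "tensor_relations R M N =
     {frag_of (x \<oplus>\<^bsub>M\<^esub> x', y) - frag_of (x, y) - frag_of (x', y) | x x' y.
        x \<in> carrier M \<and> x' \<in> carrier M \<and> y \<in> carrier N} \<union>
     {frag_of (x, y \<oplus>\<^bsub>N\<^esub> y') - frag_of (x, y) - frag_of (x, y') | x y y'.
        x \<in> carrier M \<and> y \<in> carrier N \<and> y' \<in> carrier N} \<union>
     {frag_of (r \<odot>\<^bsub>M\<^esub> x, y) - frag_of (x, r \<odot>\<^bsub>N\<^esub> y) | r x y.
        r \<in> carrier R \<and> x \<in> carrier M \<and> y \<in> carrier N}"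

definition tensor_class ::
  "'a ring \<Rightarrow> ('a, 's) module \<Rightarrow> ('a, 't) module \<Rightarrow> ('s \<times> 't \<Rightarrow>\<^sub>0 int) \<Rightarrow> ('s \<times> 't \<Rightarrow>\<^sub>0 int) set" where
  "tensor_class R M N c =
     (let G = free_Abelian_group (carrier M \<times> carrier N)
      in generate G (tensor_relations R M N) #>\<^bsub>G\<^esub> c)"

definition pure_tensor ::
  "'a ring \<Rightarrow> ('a, 's) module \<Rightarrow> ('a, 't) module \<Rightarrow> 's \<Rightarrow> 't \<Rightarrow> ('s \<times> 't \<Rightarrow>\<^sub>0 int) set" where
  "pure_tensor R M N x y = tensor_class R M N (frag_of (x, y))"

text \<open>
  In the scalar multiplication, the union ranges over all representatives of the given coset; they
  all yield the same coset.
\<close>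

definition tensor_module ::
  "'a ring \<Rightarrow> ('a, 's) module \<Rightarrow> ('a, 't) module \<Rightarrow> ('a, ('s \<times> 't \<Rightarrow>\<^sub>0 int) set) module" where
  "tensor_module R M N =
     (let G = free_Abelian_group (carrier M \<times> carrier N);
          Q = G Mod generate G (tensor_relations R M N)
      in \<lparr>carrier = carrier Q, monoid.mult = undefined, one = undefined,
          zero = \<one>\<^bsub>Q\<^esub>, add = (\<lambda>S T. S \<otimes>\<^bsub>Q\<^esub> T),
          module.smult = (\<lambda>r T. \<Union>c\<in>T. tensor_class R M N
                      (frag_extend (\<lambda>(x, y). frag_of (r \<odot>\<^bsub>M\<^esub> x, y)) c))\<rparr>)"

text \<open>The additive map out of a tensor product induced by a balanced map \<open>b\<close> into \<open>P\<close>.\<close>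

definition tensor_lift ::
  "('a, 'u) module \<Rightarrow> ('s \<times> 't \<Rightarrow> 'u) \<Rightarrow> ('s \<times> 't \<Rightarrow>\<^sub>0 int) set \<Rightarrow> 'u" where
  "tensor_lift P b T =
     the_elem ((\<lambda>c. \<Oplus>\<^bsub>P\<^esub>z\<in>Poly_Mapping.keys c. [Poly_Mapping.lookup c z] \<cdot>\<^bsub>P\<^esub> b z) ` T)"

definition tensor_presheaf ::
  "('x, 'a) ring_presheaf \<Rightarrow> ('x, 'a, 's) module_presheaf \<Rightarrow> ('x, 'a, 't) module_presheaf \<Rightarrow>
   ('x, 'a, ('s \<times> 't \<Rightarrow>\<^sub>0 int) set) module_presheaf" where
  "tensor_presheaf A F G =
     \<lparr>msec = (\<lambda>U. tensor_module (rsec A U) (msec F U) (msec G U)),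
      mres = (\<lambda>U V. tensor_lift (tensor_module (rsec A V) (msec F V) (msec G V))
        (\<lambda>(x, y). pure_tensor (rsec A V) (msec F V) (msec G V) (mres F U V x) (mres G U V y)))\<rparr>"

definition tensor_sheaf ::
  "'x topology \<Rightarrow> ('x, 'a) ring_presheaf \<Rightarrow> ('x, 'a, 's) module_presheaf \<Rightarrow>
   ('x, 'a, 't) module_presheaf \<Rightarrow>
   ('x, 'a, 'x \<Rightarrow> ('x set \<times> ('s \<times> 't \<Rightarrow>\<^sub>0 int) set) set) module_presheaf" where
  "tensor_sheaf T A F G = sheafify T A (tensor_presheaf A F G)"


section \<open>Smooth functions and differential forms on a manifold\<close>

text \<open>
  Functions and forms over \<open>U\<close> are represented by functions on the whole type that are
  \<^const>\<open>undefined\<close> outside \<open>U\<close>.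
\<close>

definition smooth_functions ::
  "nat \<Rightarrow> 'm chart set \<Rightarrow> ('m, 'm \<Rightarrow> real) ring_presheaf" where
  "smooth_functions n Atl =
     \<lparr>rsec = (\<lambda>U.
        \<lparr>carrier = {f \<in> extensional U. \<forall>(D, \<phi>)\<in>Atl.
                      smooth_on n (\<phi> ` (D \<inter> U)) (\<lambda>y. f (inv_into D \<phi> y))},
         monoid.mult = (\<lambda>f g. \<lambda>x\<in>U. f x * g x), one = (\<lambda>x\<in>U. 1),
         zero = (\<lambda>x\<in>U. 0), add = (\<lambda>f g. \<lambda>x\<in>U. f x + g x)\<rparr>),
      rres = (\<lambda>U V f. restrict f V)\<rparr>"

text \<open>Tangent vectors at \<open>p\<close> are the derivations at \<open>p\<close> of the algebra of smooth functions.\<close>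

definition tangent_space ::
  "nat \<Rightarrow> 'm topology \<Rightarrow> 'm chart set \<Rightarrow> 'm \<Rightarrow> (('m \<Rightarrow> real) \<Rightarrow> real) set" where
  "tangent_space n T Atl p =
     (let C = rsec (smooth_functions n Atl) (topspace T) in
      {v \<in> extensional (carrier C).
        (\<forall>f\<in>carrier C. \<forall>g\<in>carrier C. v (f \<oplus>\<^bsub>C\<^esub> g) = v f + v g) \<and>
        (\<forall>c. \<forall>f\<in>carrier C. v ((\<lambda>x\<in>topspace T. c) \<otimes>\<^bsub>C\<^esub> f) = c * v f) \<and>
        (\<forall>f\<in>carrier C. \<forall>g\<in>carrier C. v (f \<otimes>\<^bsub>C\<^esub> g) = f p * v g + g p * v f)})"

definition cotangent_space ::
  "nat \<Rightarrow> 'm topology \<Rightarrow> 'm chart set \<Rightarrow> 'm \<Rightarrow> ((('m \<Rightarrow> real) \<Rightarrow> real) \<Rightarrow> real) set" where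
  "cotangent_space n T Atl p =
     (let C = carrier (rsec (smooth_functions n Atl) (topspace T)); V = tangent_space n T Atl p in
      {\<alpha> \<in> extensional V.
        (\<forall>v\<in>V. \<forall>w\<in>V. \<alpha> (\<lambda>f\<in>C. v f + w f) = \<alpha> v + \<alpha> w) \<and>
        (\<forall>c. \<forall>v\<in>V. \<alpha> (\<lambda>f\<in>C. c * v f) = c * \<alpha> v)})"

definition coord_vector ::
  "nat \<Rightarrow> 'm topology \<Rightarrow> 'm chart set \<Rightarrow> 'm chart \<Rightarrow> nat \<Rightarrow> 'm \<Rightarrow> ('m \<Rightarrow> real) \<Rightarrow> real" where
  "coord_vector n T Atl = (\<lambda>(D, \<phi>) i p.
     \<lambda>f\<in>carrier (rsec (smooth_functions n Atl) (topspace T)).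
       partial_deriv i (\<lambda>y. f (inv_into D \<phi> y)) (\<phi> p))"

text \<open>A form is a section of the cotangent bundle with smooth coefficients in every chart.\<close>

definition one_forms ::
  "nat \<Rightarrow> 'm topology \<Rightarrow> 'm chart set \<Rightarrow>
   ('m, 'm \<Rightarrow> real, 'm \<Rightarrow> (('m \<Rightarrow> real) \<Rightarrow> real) \<Rightarrow> real) module_presheaf" where
  "one_forms n T Atl =
     \<lparr>msec = (\<lambda>U.
        \<lparr>carrier = {\<omega> \<in> (\<Pi>\<^sub>E p\<in>U. cotangent_space n T Atl p). \<forall>(D, \<phi>)\<in>Atl. \<forall>i<n.
                      smooth_on n (\<phi> ` (D \<inter> U))
                        (\<lambda>y. \<omega> (inv_into D \<phi> y) (coord_vector n T Atl (D, \<phi>) i (inv_into D \<phi> y)))},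
         monoid.mult = undefined, one = undefined,
         zero = (\<lambda>p\<in>U. \<lambda>v\<in>tangent_space n T Atl p. 0),
         add = (\<lambda>\<omega> \<eta>. \<lambda>p\<in>U. \<lambda>v\<in>tangent_space n T Atl p. \<omega> p v + \<eta> p v),
         module.smult = (\<lambda>f \<omega>. \<lambda>p\<in>U. \<lambda>v\<in>tangent_space n T Atl p. f p * \<omega> p v)\<rparr>),
      mres = (\<lambda>U V \<omega>. restrict \<omega> V)\<rparr>"


section \<open>The contraction map\<close>

text \<open>
  The presheaf morphism sending \<open>\<alpha> \<otimes> f\<close> over \<open>U\<close> to the morphism
  \<open>\<sigma> \<mapsto> \<alpha>|\<^sub>V \<otimes> f\<^sub>V(\<sigma>)\<close>, for \<open>\<sigma>\<close> a section of \<open>F\<close> over \<open>V \<subseteq> U\<close>.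
\<close>

definition contraction_presheaf ::
  "'x topology \<Rightarrow> ('x, 'a) ring_presheaf \<Rightarrow> ('x, 'a, 'w) module_presheaf \<Rightarrow>
   ('x, 'a, 's) module_presheaf \<Rightarrow> 'x set \<Rightarrow> ('w \<times> ('x set \<Rightarrow> 's \<Rightarrow> 's) \<Rightarrow>\<^sub>0 int) set \<Rightarrow>
   'x set \<Rightarrow> 's \<Rightarrow> 'x \<Rightarrow> ('x set \<times> ('w \<times> 's \<Rightarrow>\<^sub>0 int) set) set" where
  "contraction_presheaf T A \<Omega> F U =
     tensor_lift (msec (Hom_sheaf T A F (tensor_sheaf T A \<Omega> F)) U)
       (\<lambda>(\<alpha>, f). \<lambda>V\<in>opens_in T U. \<lambda>\<sigma>\<in>carrier (msec F V).
          to_sheafify T (tensor_presheaf A \<Omega> F) V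
            (pure_tensor (rsec A V) (msec \<Omega> V) (msec F V) (mres \<Omega> U V \<alpha>) (f V \<sigma>)))"

definition contraction ::
  "'x topology \<Rightarrow> ('x, 'a) ring_presheaf \<Rightarrow> ('x, 'a, 'w) module_presheaf \<Rightarrow>
   ('x, 'a, 's) module_presheaf \<Rightarrow>
   ('x \<Rightarrow> ('x set \<times> ('w \<times> ('x set \<Rightarrow> 's \<Rightarrow> 's) \<Rightarrow>\<^sub>0 int) set) set) \<Rightarrow>
   'x set \<Rightarrow> 's \<Rightarrow> 'x \<Rightarrow> ('x set \<times> ('w \<times> 's \<Rightarrow>\<^sub>0 int) set) set" where
  "contraction T A \<Omega> F =
     sheafify_lift T (tensor_presheaf A \<Omega> (Hom_sheaf T A F F)) (Hom_sheaf T A F (tensor_sheaf T A \<Omega> F))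
       (contraction_presheaf T A \<Omega> F) (topspace T)"


section \<open>Real vector spaces of global sections\<close>

text \<open>Real numbers act on global sections as constant functions.\<close>

definition global_sections ::
  "'m topology \<Rightarrow> ('m, 'm \<Rightarrow> real, 's) module_presheaf \<Rightarrow> (real, 's) module" where
  "global_sections T F =
     (let M = msec F (topspace T) in
      \<lparr>carrier = carrier M, monoid.mult = monoid.mult M, one = \<one>\<^bsub>M\<^esub>, zero = \<zero>\<^bsub>M\<^esub>, add = ring.add M,
       module.smult = (\<lambda>c s. (\<lambda>x\<in>topspace T. c) \<odot>\<^bsub>M\<^esub> s)\<rparr>)"

definition vector_space_iso :: "'k ring \<Rightarrow> ('k, 's) module \<Rightarrow> ('k, 't) module \<Rightarrow> ('s \<Rightarrow> 't) \<Rightarrow> bool" where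
  "vector_space_iso K V W h \<longleftrightarrow>
     field K \<and> module K V \<and> module K W \<and>
     restrict h (carrier V) \<in> module_hom K V W \<and> bij_betw h (carrier V) (carrier W)"

end

theory Submission
  imports Defs
begin

text \<open>
  The statement is local and holds over any ringed space, for any presheaf of modules \<open>\<Omega>\<close> in place of
  the one-forms. Where \<open>F\<close> is free there are sections \<open>e\<^sub>i\<close> and linear forms \<open>\<epsilon>\<^sub>i\<close> with
  \<open>\<sigma> = \<Sum>\<^sub>i \<epsilon>\<^sub>i(\<sigma>) e\<^sub>i\<close>. Let \<open>\<kappa>\<^sub>i\<close> send \<open>\<alpha> \<otimes> f\<close> to \<open>\<alpha> \<otimes> f(e\<^sub>i)\<close>, and let \<open>\<lambda>\<^sub>i\<close> send \<open>\<alpha> \<otimes> y\<close> to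
  \<open>\<alpha> \<otimes> \<epsilon>\<^sub>i(-)y\<close>. Then \<open>s = \<Sum>\<^sub>i \<lambda>\<^sub>i(\<kappa>\<^sub>i(s))\<close>, so a local section \<open>s\<close> is determined by its contractions with
  the \<open>e\<^sub>i\<close>; and a morphism \<open>t\<close> whose values \<open>t(e\<^sub>i)\<close> come from tensors \<open>q\<^sub>i\<close> is the contraction of
  \<open>\<Sum>\<^sub>i \<lambda>\<^sub>i(q\<^sub>i)\<close>. The first identity makes these local preimages agree on germs, hence they glue.
\<close>

text \<open>Below the level of germs everything is a computation with additive maps: a map out of a
  tensor module is determined by its values on pure tensors, so each identity between composites of
  contractions, restrictions and rank one maps is checked on generators. The obstacle is that a
  global section of a sheafified tensor product is a tensor only locally, while
  \<open>contraction\<close> is given by a definite description. Therefore an explicit morphism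
  \<open>glued_hom\<close> is built from local representatives and shown to be the described object;
  afterwards only its local representatives matter. The dual basis is finite, so one neighbourhood
  of a point serves all indices at once, both where germs of contractions agree and where the values
  of a morphism at the basis come from tensors. For surjectivity no preimages are chosen: all pairs
  (W, s) such that s contracts to the given morphism over W are taken together, and the comparison
  of germs makes them a compatible family.\<close>

text \<open>Only values on the carrier are constrained, unlike in \<open>module_hom\<close>, so
  composites and pointwise sums stay in the set without \<open>restrict\<close>. The two record
  schemes are independent: restrictions between modules over different rings and coordinate forms
  from a module to a ring are both covered.\<close>

definition additive_maps :: "('a, 'm) ring_scheme \<Rightarrow> ('b, 'n) ring_scheme \<Rightarrow> ('a \<Rightarrow> 'b) set" where
  "additive_maps M P = {h \<in> carrier M \<rightarrow> carrier P.
     \<forall>x\<in>carrier M. \<forall>y\<in>carrier M. h (x \<oplus>\<^bsub>M\<^esub> y) = h x \<oplus>\<^bsub>P\<^esub> h y}"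

lemma additive_mapsI:
  assumes "\<And>x. x \<in> carrier M \<Longrightarrow> h x \<in> carrier P"
    and "\<And>x y. x \<in> carrier M \<Longrightarrow> y \<in> carrier M \<Longrightarrow> h (x \<oplus>\<^bsub>M\<^esub> y) = h x \<oplus>\<^bsub>P\<^esub> h y"
  shows "h \<in> additive_maps M P"
  using assms by (auto simp: additive_maps_def)

lemma additive_maps_closed: "h \<in> additive_maps M P \<Longrightarrow> x \<in> carrier M \<Longrightarrow> h x \<in> carrier P"
  by (auto simp: additive_maps_def)

lemma additive_maps_add:
  "h \<in> additive_maps M P \<Longrightarrow> x \<in> carrier M \<Longrightarrow> y \<in> carrier M \<Longrightarrow> h (x \<oplus>\<^bsub>M\<^esub> y) = h x \<oplus>\<^bsub>P\<^esub> h y"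
  by (auto simp: additive_maps_def)

lemma additive_maps_comp:
  "h \<in> additive_maps M N \<Longrightarrow> k \<in> additive_maps N P \<Longrightarrow> (\<lambda>x. k (h x)) \<in> additive_maps M P"
  by (auto simp: additive_maps_def Pi_iff)

lemma additive_maps_plus:
  assumes "abelian_group P" "h \<in> additive_maps M P" "k \<in> additive_maps M P"
  shows "(\<lambda>x. h x \<oplus>\<^bsub>P\<^esub> k x) \<in> additive_maps M P"
proof -
  interpret P: abelian_group P by fact
  show ?thesis using assms(2,3)
    by (auto simp: additive_maps_def Pi_iff P.a_ac)
qed

lemma (in abelian_group) idem_add_zero: "x \<in> carrier G \<Longrightarrow> x \<oplus> x = x \<Longrightarrow> x = \<zero>"
  by (metis add.r_cancel_one')

lemma additive_maps_zero:
  assumes "abelian_group M" "abelian_group P" "h \<in> additive_maps M P"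
  shows "h \<zero>\<^bsub>M\<^esub> = \<zero>\<^bsub>P\<^esub>"
proof -
  interpret M: abelian_group M by fact
  interpret P: abelian_group P by fact
  have "h \<zero>\<^bsub>M\<^esub> \<oplus>\<^bsub>P\<^esub> h \<zero>\<^bsub>M\<^esub> = h \<zero>\<^bsub>M\<^esub>"
    by (metis M.l_zero M.zero_closed additive_maps_add assms(3))
  then show ?thesis
    using P.idem_add_zero additive_maps_closed[OF assms(3) M.zero_closed] by blast
qed

lemma additive_maps_finsum:
  assumes "abelian_group M" "abelian_group P" "h \<in> additive_maps M P" "finite I"
    "\<And>i. i \<in> I \<Longrightarrow> f i \<in> carrier M"
  shows "h (finsum M f I) = finsum P (\<lambda>i. h (f i)) I"
proof -
  interpret M: abelian_group M by fact
  interpret P: abelian_group P by fact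
  show ?thesis using assms(4,5)
  proof (induction I rule: finite_induct)
    case empty
    then show ?case by (simp add: additive_maps_zero[OF assms(1-3)])
  next
    case (insert i I)
    have "f \<in> I \<rightarrow> carrier M" using insert.prems by auto
    moreover have "(\<lambda>i. h (f i)) \<in> I \<rightarrow> carrier P"
      using insert.prems additive_maps_closed[OF assms(3)] by auto
    ultimately show ?case
      using insert additive_maps_closed[OF assms(3)] additive_maps_add[OF assms(3)]
      by (simp add: M.finsum_insert P.finsum_insert M.finsum_closed)
  qed
qed

lemma additive_maps_finsum_fun:
  assumes "abelian_group P" "finite I" "\<And>i. i \<in> I \<Longrightarrow> h i \<in> additive_maps M P"
  shows "(\<lambda>x. finsum P (\<lambda>i. h i x) I) \<in> additive_maps M P"
proof -
  interpret P: abelian_group P by fact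
  have cl: "h i x \<in> carrier P" if "i \<in> I" "x \<in> carrier M" for i x
    using additive_maps_closed[OF assms(3)] that by auto
  show ?thesis
  proof (rule additive_mapsI)
    fix x y assume xy: "x \<in> carrier M" "y \<in> carrier M"
    have "finsum P (\<lambda>i. h i (x \<oplus>\<^bsub>M\<^esub> y)) I = finsum P (\<lambda>i. h i x \<oplus>\<^bsub>P\<^esub> h i y) I"
      using xy cl additive_maps_add[OF assms(3)] by (intro P.finsum_cong') auto
    also have "\<dots> = finsum P (\<lambda>i. h i x) I \<oplus>\<^bsub>P\<^esub> finsum P (\<lambda>i. h i y) I"
      using xy cl by (intro P.finsum_addf) auto
    finally show "finsum P (\<lambda>i. h i (x \<oplus>\<^bsub>M\<^esub> y)) I
        = finsum P (\<lambda>i. h i x) I \<oplus>\<^bsub>P\<^esub> finsum P (\<lambda>i. h i y) I" .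
  qed (use cl in \<open>auto intro!: P.finsum_closed\<close>)
qed

section \<open>Abelian groups, and homomorphisms out of free abelian groups\<close>

text \<open>Inverses are supplied by a function \<open>n\<close>, so that each use names its own: a
  group inverse, multiplication by -1, or pointwise negation.\<close>

lemma abelian_groupI':
  assumes "\<And>x y. x \<in> carrier R \<Longrightarrow> y \<in> carrier R \<Longrightarrow> x \<oplus>\<^bsub>R\<^esub> y \<in> carrier R"
    and "\<zero>\<^bsub>R\<^esub> \<in> carrier R"
    and "\<And>x y z. x \<in> carrier R \<Longrightarrow> y \<in> carrier R \<Longrightarrow> z \<in> carrier R \<Longrightarrow>
           (x \<oplus>\<^bsub>R\<^esub> y) \<oplus>\<^bsub>R\<^esub> z = x \<oplus>\<^bsub>R\<^esub> (y \<oplus>\<^bsub>R\<^esub> z)"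
    and "\<And>x y. x \<in> carrier R \<Longrightarrow> y \<in> carrier R \<Longrightarrow> x \<oplus>\<^bsub>R\<^esub> y = y \<oplus>\<^bsub>R\<^esub> x"
    and "\<And>x. x \<in> carrier R \<Longrightarrow> \<zero>\<^bsub>R\<^esub> \<oplus>\<^bsub>R\<^esub> x = x"
    and "\<And>x. x \<in> carrier R \<Longrightarrow> n x \<in> carrier R"
    and "\<And>x. x \<in> carrier R \<Longrightarrow> n x \<oplus>\<^bsub>R\<^esub> x = \<zero>\<^bsub>R\<^esub>"
  shows "abelian_group R"
proof (rule abelian_groupI)
  show "\<exists>y\<in>carrier R. y \<oplus>\<^bsub>R\<^esub> x = \<zero>\<^bsub>R\<^esub>" if "x \<in> carrier R" for x
    using assms(6,7)[OF that] by blast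
qed (fact assms)+

lemma abelian_group_of_comm_group:
  assumes "comm_group G" "carrier R = carrier G" "\<And>x y. x \<oplus>\<^bsub>R\<^esub> y = x \<otimes>\<^bsub>G\<^esub> y" "\<zero>\<^bsub>R\<^esub> = \<one>\<^bsub>G\<^esub>"
  shows "abelian_group R"
proof -
  interpret G: comm_group G by fact
  show ?thesis
    by (intro abelian_groupI'[where n = "m_inv G"])
       (auto simp: assms(2-4) G.m_assoc intro: G.m_comm)
qed

text \<open>The additional factors have exponent 0. This permits products belonging to different
  elements to be compared over one index set.\<close>

lemma frag_finprod_superset:
  fixes c :: "'b \<Rightarrow>\<^sub>0 int"
  assumes "comm_group G" "finite K" "Poly_Mapping.keys c \<subseteq> K" "b \<in> K \<rightarrow> carrier G"
  shows "finprod G (\<lambda>z. b z [^]\<^bsub>G\<^esub> Poly_Mapping.lookup c z) (Poly_Mapping.keys c)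
       = finprod G (\<lambda>z. b z [^]\<^bsub>G\<^esub> Poly_Mapping.lookup c z) K"
proof -
  interpret G: comm_group G by fact
  show ?thesis
    by (rule G.finprod_mono_neutral_cong_left)
      (use assms in \<open>auto simp: Pi_iff Poly_Mapping.in_keys_iff\<close>)
qed

text \<open>The universal property of the free abelian group, in multiplicative notation:
  \<open>finsum\<close> and integer multiples in an additive group unfold to products and powers in
  its \<open>add_monoid\<close>, which is the form in which it serves
  \<open>tensor_lift\<close>.\<close>

lemma frag_finprod_hom:
  assumes "comm_group G" "b \<in> S \<rightarrow> carrier G"
  shows "(\<lambda>c. finprod G (\<lambda>z. b z [^]\<^bsub>G\<^esub> Poly_Mapping.lookup c z) (Poly_Mapping.keys c))
           \<in> hom (free_Abelian_group S) G"
proof -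
  interpret G: comm_group G by fact
  let ?h = "\<lambda>c. finprod G (\<lambda>z. b z [^]\<^bsub>G\<^esub> Poly_Mapping.lookup c z) (Poly_Mapping.keys c)"
  show ?thesis
  proof (rule homI)
    fix c assume "c \<in> carrier (free_Abelian_group S)"
    then show "?h c \<in> carrier G"
      using assms(2) by (intro G.finprod_closed) auto
  next
    fix c d assume "c \<in> carrier (free_Abelian_group S)" "d \<in> carrier (free_Abelian_group S)"
    then have cd: "Poly_Mapping.keys c \<subseteq> S" "Poly_Mapping.keys d \<subseteq> S" by auto
    \<comment> \<open>Cancellation may shrink the support of c + d, so all three products are taken
      over the union of the supports of c and d.\<close>
    define K where "K = Poly_Mapping.keys c \<union> Poly_Mapping.keys d"
    have K: "finite K" "Poly_Mapping.keys c \<subseteq> K" "Poly_Mapping.keys d \<subseteq> K"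
      "Poly_Mapping.keys (c + d) \<subseteq> K" "b \<in> K \<rightarrow> carrier G"
      using cd assms(2) by (auto simp: K_def dest: subsetD[OF keys_add])
    have "?h (c + d) = finprod G (\<lambda>z. b z [^]\<^bsub>G\<^esub> Poly_Mapping.lookup (c + d) z) K"
      by (rule frag_finprod_superset) (use K assms in auto)
    also have "\<dots> = finprod G (\<lambda>z. b z [^]\<^bsub>G\<^esub> Poly_Mapping.lookup c z \<otimes>\<^bsub>G\<^esub> b z [^]\<^bsub>G\<^esub> Poly_Mapping.lookup d z) K"
      using K(5) by (intro G.finprod_cong') (auto simp: lookup_add G.int_pow_mult Pi_iff)
    also have "\<dots> = finprod G (\<lambda>z. b z [^]\<^bsub>G\<^esub> Poly_Mapping.lookup c z) K
        \<otimes>\<^bsub>G\<^esub> finprod G (\<lambda>z. b z [^]\<^bsub>G\<^esub> Poly_Mapping.lookup d z) K"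
      using K(5) by (intro G.finprod_multf) auto
    also have "\<dots> = ?h c \<otimes>\<^bsub>G\<^esub> ?h d"
      using frag_finprod_superset[OF assms(1) K(1,2,5)] frag_finprod_superset[OF assms(1) K(1,3,5)]
      by simp
    finally show "?h (c \<otimes>\<^bsub>free_Abelian_group S\<^esub> d) = ?h c \<otimes>\<^bsub>G\<^esub> ?h d" by simp
  qed
qed

lemma frag_finprod_frag_of:
  assumes "comm_group G" "b z \<in> carrier G"
  shows "finprod G (\<lambda>w. b w [^]\<^bsub>G\<^esub> Poly_Mapping.lookup (frag_of z) w) (Poly_Mapping.keys (frag_of z)) = b z"
proof -
  interpret G: comm_group G by fact
  show ?thesis using assms(2) by simp
qed

section \<open>Tensor products\<close>

lemma tensor_relations_cases:
  assumes "c \<in> tensor_relations R M N"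
  obtains (left) x x' y where "x \<in> carrier M" "x' \<in> carrier M" "y \<in> carrier N"
        "c = frag_of (x \<oplus>\<^bsub>M\<^esub> x', y) - frag_of (x, y) - frag_of (x', y)"
    | (right) x y y' where "x \<in> carrier M" "y \<in> carrier N" "y' \<in> carrier N"
        "c = frag_of (x, y \<oplus>\<^bsub>N\<^esub> y') - frag_of (x, y) - frag_of (x, y')"
    | (balanced) r x y where "r \<in> carrier R" "x \<in> carrier M" "y \<in> carrier N"
        "c = frag_of (r \<odot>\<^bsub>M\<^esub> x, y) - frag_of (x, r \<odot>\<^bsub>N\<^esub> y)"
  using assms unfolding tensor_relations_def Un_iff mem_Collect_eq
  apply (elim disjE exE conjE)
  subgoal by (rule left)
  subgoal by (rule right)
  subgoal by (rule balanced)
  done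

locale tensor_pair = M: module R M + N: module R N
  for R :: "'a ring" and M :: "('a, 's) module" and N :: "('a, 't) module"
begin

abbreviation "FG \<equiv> free_Abelian_group (carrier M \<times> carrier N)"
abbreviation "KG \<equiv> generate FG (tensor_relations R M N)"
abbreviation "TM \<equiv> tensor_module R M N"
abbreviation "cls \<equiv> tensor_class R M N"
abbreviation "pure \<equiv> pure_tensor R M N"

sublocale FG: comm_group FG
  by (rule abelian_free_Abelian_group)

lemma relations_carrier: "tensor_relations R M N \<subseteq> carrier FG"
  unfolding tensor_relations_def
  by (auto dest!: subsetD[OF keys_diff])

sublocale KG: subgroup KG FG
  by (rule FG.generate_is_subgroup[OF relations_carrier])

sublocale KG: normal KG FG
  by (rule FG.subgroup_imp_normal[OF KG.subgroup_axioms])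

sublocale Q: comm_group "FG Mod KG"
  by (rule FG.abelian_FactGroup[OF KG.subgroup_axioms])

lemma tensor_class_eq: "cls c = KG #>\<^bsub>FG\<^esub> c"
  by (simp add: tensor_class_def Let_def)

lemma carrier_tensor: "carrier TM = cls ` carrier FG"
  by (auto simp: tensor_module_def Let_def FactGroup_def RCOSETS_def tensor_class_eq)

lemma add_tensor:
  assumes "c \<in> carrier FG" "d \<in> carrier FG"
  shows "cls c \<oplus>\<^bsub>TM\<^esub> cls d = cls (c + d)"
  using KG.rcos_sum[OF assms] by (simp add: tensor_module_def Let_def FactGroup_def tensor_class_eq)

lemma zero_tensor: "\<zero>\<^bsub>TM\<^esub> = cls 0"
  using FG.coset_mult_one[OF KG.subset]
  by (simp add: tensor_module_def Let_def FactGroup_def tensor_class_eq)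

lemma tensor_abelian_group: "abelian_group TM"
proof -
  have eqs: "carrier TM = carrier (FG Mod KG)" "(\<lambda>x y. x \<oplus>\<^bsub>TM\<^esub> y) = (\<lambda>x y. x \<otimes>\<^bsub>FG Mod KG\<^esub> y)"
    "\<zero>\<^bsub>TM\<^esub> = \<one>\<^bsub>FG Mod KG\<^esub>"
    by (simp_all add: tensor_module_def Let_def)
  show ?thesis
    by (rule abelian_group_of_comm_group[OF Q.comm_group_axioms eqs(1) fun_cong[OF fun_cong[OF eqs(2)]] eqs(3)])
qed

sublocale TM: abelian_group TM
  by (rule tensor_abelian_group)

lemma mem_tensor_class:
  assumes "c \<in> carrier FG" "d \<in> cls c"
  shows "d \<in> carrier FG" "d - c \<in> KG"
proof -
  obtain k where k: "k \<in> KG" "d = k + c"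
    using assms(2) by (auto simp: tensor_class_eq r_coset_def)
  have "k \<in> carrier FG" by (rule KG.mem_carrier[OF k(1)])
  then have "k \<otimes>\<^bsub>FG\<^esub> c \<in> carrier FG" using assms(1) by (rule FG.m_closed)
  then show "d \<in> carrier FG" using k(2) by simp
  show "d - c \<in> KG" using k by simp
qed

lemma self_mem_tensor_class: "c \<in> carrier FG \<Longrightarrow> c \<in> cls c"
  unfolding tensor_class_eq by (rule FG.rcos_self[OF _ KG.subgroup_axioms])

text \<open>The kernel is a subgroup that contains the relations, hence all of \<open>KG\<close>, so
  \<open>h\<close> is constant on cosets. This makes \<open>the_elem\<close> in
  \<open>tensor_lift\<close> meaningful.\<close>

lemma hom_vanishing_on_relations:
  assumes "comm_group G" "h \<in> hom FG G" "\<And>c. c \<in> tensor_relations R M N \<Longrightarrow> h c = \<one>\<^bsub>G\<^esub>"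
    and "c \<in> carrier FG" "d \<in> cls c"
  shows "h d = h c"
proof -
  interpret G: comm_group G by fact
  interpret h: group_hom FG G h
    by unfold_locales (rule assms(2))
  have "KG \<subseteq> kernel FG G h"
  proof (rule FG.generate_subgroup_incl)
    show "tensor_relations R M N \<subseteq> kernel FG G h"
      using relations_carrier assms(3) by (auto simp: kernel_def simp del: carrier_free_Abelian_group_iff)
  qed (rule h.subgroup_kernel)
  then have 1: "h (d - c) = \<one>\<^bsub>G\<^esub>" "d - c \<in> carrier FG"
    using mem_tensor_class(2)[OF assms(4,5)] by (auto simp: kernel_def)
  have "h ((d - c) \<otimes>\<^bsub>FG\<^esub> c) = h (d - c) \<otimes>\<^bsub>G\<^esub> h c"
    using 1 assms(4) by (rule_tac h.hom_mult) auto
  then show ?thesis using 1 h.hom_closed[OF assms(4)] by simp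
qed

lemma pure_closed [simp]: "x \<in> carrier M \<Longrightarrow> y \<in> carrier N \<Longrightarrow> pure x y \<in> carrier TM"
  by (simp add: pure_tensor_def carrier_tensor del: carrier_free_Abelian_group_iff)

lemma tensor_class_cong:
  assumes "c \<in> carrier FG" "d \<in> carrier FG" "d - c \<in> KG"
  shows "cls d = cls c"
proof -
  have "d = (d - c) \<otimes>\<^bsub>FG\<^esub> c" by simp
  then have "d \<in> KG #>\<^bsub>FG\<^esub> c"
    using assms(3) unfolding r_coset_def by blast
  then show ?thesis
    using FG.repr_independence[OF _ assms(1) KG.subgroup_axioms] by (simp add: tensor_class_eq)
qed

lemma diff_carrier: "c \<in> carrier FG \<Longrightarrow> d \<in> carrier FG \<Longrightarrow> c - d \<in> carrier FG"
  by (auto dest!: subsetD[OF keys_diff])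

lemma frag_of_carrier: "x \<in> carrier M \<Longrightarrow> y \<in> carrier N \<Longrightarrow> frag_of (x, y) \<in> carrier FG"
  by simp

text \<open>Both families of additivity relations have the shape x - y - z; this treats them
  together.\<close>

lemma tensor_class_relation_sum:
  assumes "x \<in> carrier FG" "y \<in> carrier FG" "z \<in> carrier FG" "x - y - z \<in> tensor_relations R M N"
  shows "cls x = cls y \<oplus>\<^bsub>TM\<^esub> cls z"
proof -
  have "x - (y + z) \<in> KG" using generate.incl[OF assms(4)] by (simp add: diff_diff_add)
  moreover have "y + z \<in> carrier FG"
    using FG.m_closed[OF assms(2,3)] by simp
  ultimately show ?thesis
    using tensor_class_cong[of "y + z" x] add_tensor assms by simp
qed

lemma pure_add_left:
  assumes "x \<in> carrier M" "x' \<in> carrier M" "y \<in> carrier N"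
  shows "pure (x \<oplus>\<^bsub>M\<^esub> x') y = pure x y \<oplus>\<^bsub>TM\<^esub> pure x' y"
  unfolding pure_tensor_def using assms
  by (intro tensor_class_relation_sum frag_of_carrier) (auto simp: tensor_relations_def)

lemma pure_add_right:
  assumes "x \<in> carrier M" "y \<in> carrier N" "y' \<in> carrier N"
  shows "pure x (y \<oplus>\<^bsub>N\<^esub> y') = pure x y \<oplus>\<^bsub>TM\<^esub> pure x y'"
  unfolding pure_tensor_def using assms
  by (intro tensor_class_relation_sum frag_of_carrier) (auto simp: tensor_relations_def)

lemma pure_smult_swap:
  assumes "r \<in> carrier R" "x \<in> carrier M" "y \<in> carrier N"
  shows "pure (r \<odot>\<^bsub>M\<^esub> x) y = pure x (r \<odot>\<^bsub>N\<^esub> y)"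
proof -
  have "frag_of (r \<odot>\<^bsub>M\<^esub> x, y) - frag_of (x, r \<odot>\<^bsub>N\<^esub> y) \<in> KG"
    using assms by (intro generate.incl) (auto simp: tensor_relations_def)
  then show ?thesis
    unfolding pure_tensor_def using assms
    by (intro tensor_class_cong frag_of_carrier) auto
qed

text \<open>Pure tensors generate the tensor module as an abelian group, so additivity alone
  determines a map from them. Nearly every identity about tensors below is an instance.\<close>

lemma additive_maps_tensor_eqI:
  assumes "abelian_group P" "h \<in> additive_maps TM P" "k \<in> additive_maps TM P"
    and "\<And>x y. x \<in> carrier M \<Longrightarrow> y \<in> carrier N \<Longrightarrow> h (pure x y) = k (pure x y)"
    and "t \<in> carrier TM"
  shows "h t = k t"
proof -
  interpret P: abelian_group P by fact
  obtain c where c: "Poly_Mapping.keys c \<subseteq> carrier M \<times> carrier N" "t = cls c"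
    using assms(5) by (auto simp: carrier_tensor)
  have "h (cls c) = k (cls c)" using c(1)
  proof (induction rule: free_Abelian_group_induct[consumes 1, case_names zero diff of])
    case zero
    then show ?case
      using additive_maps_zero[OF tensor_abelian_group assms(1) assms(2)]
        additive_maps_zero[OF tensor_abelian_group assms(1) assms(3)]
      by (simp add: zero_tensor[symmetric])
  next
    case (diff c d)
    have cd: "c \<in> carrier FG" "d \<in> carrier FG" "c - d \<in> carrier FG"
      using diff diff_carrier by auto
    then have cl: "cls c \<in> carrier TM" "cls d \<in> carrier TM" "cls (c - d) \<in> carrier TM"
      unfolding carrier_tensor by blast+
    \<comment> \<open>Additive maps are known to respect sums, not differences. Hence c is written
      as (c - d) + d and the common value at d is cancelled.\<close>
    have eq: "cls c = cls (c - d) \<oplus>\<^bsub>TM\<^esub> cls d" using add_tensor[OF cd(3,2)] by simp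
    have "h (cls (c - d)) \<oplus>\<^bsub>P\<^esub> h (cls d) = k (cls (c - d)) \<oplus>\<^bsub>P\<^esub> h (cls d)"
      using additive_maps_add[OF assms(2) cl(3,2)] additive_maps_add[OF assms(3) cl(3,2)] diff(3,4) eq
      by simp
    then show ?case
      using additive_maps_closed[OF assms(2)] additive_maps_closed[OF assms(3)] cl
      by (metis P.add.r_cancel)
  next
    case (of a)
    then show ?case using assms(4) by (cases a) (auto simp: pure_tensor_def)
  qed
  then show ?thesis by (simp add: c)
qed

context
  fixes P :: "('q, 'p) module" and b
  assumes P: "abelian_group P"
    and b_closed: "\<And>x y. x \<in> carrier M \<Longrightarrow> y \<in> carrier N \<Longrightarrow> b (x, y) \<in> carrier P"
    and b_left: "\<And>x x' y. x \<in> carrier M \<Longrightarrow> x' \<in> carrier M \<Longrightarrow> y \<in> carrier N \<Longrightarrow>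
           b (x \<oplus>\<^bsub>M\<^esub> x', y) = b (x, y) \<oplus>\<^bsub>P\<^esub> b (x', y)"
    and b_right: "\<And>x y y'. x \<in> carrier M \<Longrightarrow> y \<in> carrier N \<Longrightarrow> y' \<in> carrier N \<Longrightarrow>
           b (x, y \<oplus>\<^bsub>N\<^esub> y') = b (x, y) \<oplus>\<^bsub>P\<^esub> b (x, y')"
    and b_balanced: "\<And>r x y. r \<in> carrier R \<Longrightarrow> x \<in> carrier M \<Longrightarrow> y \<in> carrier N \<Longrightarrow>
           b (r \<odot>\<^bsub>M\<^esub> x, y) = b (x, r \<odot>\<^bsub>N\<^esub> y)"
begin

interpretation P: abelian_group P by (rule P)

private abbreviation "lin \<equiv> (\<lambda>c. \<Oplus>\<^bsub>P\<^esub>z\<in>Poly_Mapping.keys c. [Poly_Mapping.lookup c z] \<cdot>\<^bsub>P\<^esub> b z)"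

private lemma b_closed': "b \<in> carrier M \<times> carrier N \<rightarrow> carrier P"
  using b_closed by auto

private lemma lin_hom: "lin \<in> hom FG (add_monoid P)"
  using frag_finprod_hom[OF P.a_comm_group, of b "carrier M \<times> carrier N"] b_closed'
  by (simp only: finsum_def add_pow_def partial_object.simps)

interpretation lin: group_hom FG "add_monoid P" lin
  by unfold_locales (rule lin_hom)

private lemma lin_frag_of: "x \<in> carrier M \<Longrightarrow> y \<in> carrier N \<Longrightarrow> lin (frag_of (x, y)) = b (x, y)"
  using frag_finprod_frag_of[OF P.a_comm_group, of b "(x, y)"] b_closed[of x y]
  by (simp only: finsum_def add_pow_def partial_object.simps)

private lemma lin_diff:
  assumes "c \<in> carrier FG" "d \<in> carrier FG" "lin c = lin d" shows "lin (c - d) = \<zero>\<^bsub>P\<^esub>"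
proof -
  have "lin ((c - d) \<otimes>\<^bsub>FG\<^esub> d) = lin (c - d) \<oplus>\<^bsub>P\<^esub> lin d"
    using lin.hom_mult[OF diff_carrier[OF assms(1,2)] assms(2)] by simp
  then show ?thesis
    using lin.hom_closed[OF diff_carrier[OF assms(1,2)]] lin.hom_closed[OF assms(1)] assms(3)
    by (simp add: P.add.r_cancel_one')
qed

text \<open>Each relation is a difference of two elements with the same image under
  \<open>lin\<close>, by additivity of \<open>b\<close> in each variable or by balance.\<close>

private lemma lin_relations:
  assumes "c \<in> tensor_relations R M N" shows "lin c = \<zero>\<^bsub>P\<^esub>"
proof -
  have plus: "lin (frag_of (x, y) + frag_of (x', y')) = b (x, y) \<oplus>\<^bsub>P\<^esub> b (x', y')"
    if "x \<in> carrier M" "y \<in> carrier N" "x' \<in> carrier M" "y' \<in> carrier N" for x y x' y'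
    using lin.hom_mult[OF frag_of_carrier[OF that(1,2)] frag_of_carrier[OF that(3,4)]]
    by (simp only: mult_free_Abelian_group lin_frag_of that monoid.simps)
  \<comment> \<open>Regrouping as c - (d + e) turns a relation with two subtracted terms into a
    single difference.\<close>
  have *: "lin (c - d - e) = \<zero>\<^bsub>P\<^esub>" if "c \<in> carrier FG" "d \<in> carrier FG" "e \<in> carrier FG" "lin c = lin (d + e)" for c d e
    using lin_diff[OF that(1) _ that(4)] FG.m_closed[OF that(2,3)] by (simp add: diff_diff_add)
  from assms show ?thesis
  proof (cases rule: tensor_relations_cases)
    case (left x x' y)
    show ?thesis unfolding left(4)
    proof (rule *)
      show "lin (frag_of (x \<oplus>\<^bsub>M\<^esub> x', y)) = lin (frag_of (x, y) + frag_of (x', y))"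
        using left(1-3) b_left by (simp only: plus lin_frag_of M.add.m_closed)
    qed (intro frag_of_carrier M.add.m_closed left)+
  next
    case (right x y y')
    show ?thesis unfolding right(4)
    proof (rule *)
      show "lin (frag_of (x, y \<oplus>\<^bsub>N\<^esub> y')) = lin (frag_of (x, y) + frag_of (x, y'))"
        using right(1-3) b_right by (simp only: plus lin_frag_of N.add.m_closed)
    qed (intro frag_of_carrier N.add.m_closed right)+
  next
    case (balanced r x y)
    show ?thesis unfolding balanced(4)
    proof (rule lin_diff)
      show "lin (frag_of (r \<odot>\<^bsub>M\<^esub> x, y)) = lin (frag_of (x, r \<odot>\<^bsub>N\<^esub> y))"
        using balanced(1-3) b_balanced by (simp only: lin_frag_of M.smult_closed N.smult_closed)
    qed (intro frag_of_carrier M.smult_closed N.smult_closed balanced)+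
  qed
qed

text \<open>Since \<open>lin\<close> is constant on the coset, its image there is a singleton,
  nonempty because the coset contains c; \<open>the_elem\<close> returns that value.\<close>

private lemma tensor_lift_class:
  assumes "c \<in> carrier FG" shows "tensor_lift P b (cls c) = lin c"
proof -
  have rel: "lin d = \<one>\<^bsub>add_monoid P\<^esub>" if "d \<in> tensor_relations R M N" for d
    unfolding monoid.simps by (rule lin_relations[OF that])
  have "lin d = lin c" if "d \<in> cls c" for d
    by (rule hom_vanishing_on_relations[OF P.a_comm_group lin_hom rel assms that])
  then have "lin ` cls c = (\<lambda>_. lin c) ` cls c" by (rule image_cong[OF refl])
  also have "\<dots> = {lin c}" using self_mem_tensor_class[OF assms] by blast
  finally show ?thesis unfolding tensor_lift_def by (simp only: the_elem_eq)
qed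

lemma tensor_lift_pure:
  "x \<in> carrier M \<Longrightarrow> y \<in> carrier N \<Longrightarrow> tensor_lift P b (pure x y) = b (x, y)"
  unfolding pure_tensor_def
  by (simp only: tensor_lift_class[OF frag_of_carrier] lin_frag_of)

lemma tensor_lift_additive: "tensor_lift P b \<in> additive_maps TM P"
proof (rule additive_mapsI)
  fix t u assume "t \<in> carrier TM" "u \<in> carrier TM"
  then obtain c d where cd: "c \<in> carrier FG" "d \<in> carrier FG" "t = cls c" "u = cls d"
    unfolding carrier_tensor by blast
  have cd': "c + d \<in> carrier FG" using FG.m_closed[OF cd(1,2)] by simp
  have "tensor_lift P b (t \<oplus>\<^bsub>TM\<^esub> u) = tensor_lift P b (cls (c + d))"
    unfolding cd(3,4) add_tensor[OF cd(1,2)] ..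
  also have "\<dots> = lin (c \<otimes>\<^bsub>FG\<^esub> d)"
    unfolding tensor_lift_class[OF cd'] by simp
  also have "\<dots> = lin c \<oplus>\<^bsub>P\<^esub> lin d"
    using lin.hom_mult[OF cd(1,2)] by simp
  finally show "tensor_lift P b (t \<oplus>\<^bsub>TM\<^esub> u) = tensor_lift P b t \<oplus>\<^bsub>P\<^esub> tensor_lift P b u"
    unfolding cd(3,4) tensor_lift_class[OF cd(1)] tensor_lift_class[OF cd(2)] .
next
  fix t assume "t \<in> carrier TM"
  then obtain c where c: "c \<in> carrier FG" "t = cls c"
    unfolding carrier_tensor by blast
  then show "tensor_lift P b t \<in> carrier P"
    using lin.hom_closed[OF c(1)] tensor_lift_class by simp
qed

end

text \<open>If \<open>b\<close> is read off from an additive map \<open>h\<close> on the tensor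
  module, then additivity and balance of \<open>b\<close> are inherited from the relations between
  pure tensors. A lift can so be identified without checking balance of its formula by hand.\<close>

lemma tensor_lift_eq:
  assumes P: "abelian_group P" and h: "h \<in> additive_maps TM P"
    and b: "\<And>x y. x \<in> carrier M \<Longrightarrow> y \<in> carrier N \<Longrightarrow> b (x, y) = h (pure x y)" and t: "t \<in> carrier TM"
  shows "tensor_lift P b t = h t"
proof (rule additive_maps_tensor_eqI[OF P _ h _ t])
  note simps = P b pure_add_left pure_add_right pure_smult_swap additive_maps_closed[OF h] additive_maps_add[OF h]
  show "tensor_lift P b \<in> additive_maps TM P"
    by (rule tensor_lift_additive) (simp_all add: simps)
  show "tensor_lift P b (pure x y) = h (pure x y)" if "x \<in> carrier M" "y \<in> carrier N" for x y
    by (subst tensor_lift_pure) (simp_all add: simps that)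
qed

text \<open>Multiplication by \<open>r\<close> through the universal property. Balance rests on
  commutativity of the ring: r(sx) = s(rx).\<close>

lemma smult_lift:
  assumes r: "r \<in> carrier R"
  defines "L \<equiv> tensor_lift TM (\<lambda>(x, y). pure (r \<odot>\<^bsub>M\<^esub> x) y)"
  shows smult_lift_additive: "L \<in> additive_maps TM TM"
    and smult_lift_pure: "\<And>x y. x \<in> carrier M \<Longrightarrow> y \<in> carrier N \<Longrightarrow> L (pure x y) = pure (r \<odot>\<^bsub>M\<^esub> x) y"
proof -
  have bal: "pure (r \<odot>\<^bsub>M\<^esub> (s \<odot>\<^bsub>M\<^esub> x)) y = pure (r \<odot>\<^bsub>M\<^esub> x) (s \<odot>\<^bsub>N\<^esub> y)"
    if "s \<in> carrier R" "x \<in> carrier M" "y \<in> carrier N" for s x y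
  proof -
    have "r \<odot>\<^bsub>M\<^esub> (s \<odot>\<^bsub>M\<^esub> x) = s \<odot>\<^bsub>M\<^esub> (r \<odot>\<^bsub>M\<^esub> x)"
      using r that by (metis M.R.m_comm M.smult_assoc1)
    then show ?thesis using pure_smult_swap r that by simp
  qed
  show "L \<in> additive_maps TM TM"
    unfolding L_def by (rule tensor_lift_additive)
      (simp_all add: r TM.abelian_group_axioms pure_add_left pure_add_right M.smult_r_distr bal)
  show "L (pure x y) = pure (r \<odot>\<^bsub>M\<^esub> x) y" if "x \<in> carrier M" "y \<in> carrier N" for x y
    unfolding L_def using that by (subst tensor_lift_pure)
      (simp_all add: r TM.abelian_group_axioms pure_add_left pure_add_right M.smult_r_distr bal)
qed

text \<open>In \<open>tensor_module\<close> the product is a union of cosets over all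
  representatives. On the free group, multiplication of the first component by \<open>r\<close> is
  the endomorphism \<open>\<phi>\<close>; it induces the lift on classes, so the union consists of
  copies of one coset.\<close>

lemma smult_tensor_eq_lift:
  assumes r: "r \<in> carrier R" and t: "t \<in> carrier TM"
  shows "r \<odot>\<^bsub>TM\<^esub> t = tensor_lift TM (\<lambda>(x, y). pure (r \<odot>\<^bsub>M\<^esub> x) y) t" (is "_ = ?L t")
proof -
  define \<phi> where "\<phi> = frag_extend (\<lambda>(x, y). frag_of (r \<odot>\<^bsub>M\<^esub> x, y :: 't))"
  note bal = smult_lift_additive[OF r] smult_lift_pure[OF r]
  have key: "\<phi> c \<in> carrier FG \<and> cls (\<phi> c) = ?L (cls c)" if "c \<in> carrier FG" for c
  proof -
    have "Poly_Mapping.keys c \<subseteq> carrier M \<times> carrier N" using that by simp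
    then show ?thesis
    proof (induction rule: free_Abelian_group_induct[consumes 1, case_names zero diff of])
      case zero
      then show ?case
        using additive_maps_zero[OF TM.abelian_group_axioms TM.abelian_group_axioms bal(1)]
        by (simp add: \<phi>_def zero_tensor)
    next
      case (diff c d)
      have \<phi>: "\<phi> c = \<phi> (c - d) + \<phi> d" by (simp add: \<phi>_def frag_extend_diff)
      have cd: "c \<in> carrier FG" "d \<in> carrier FG" "c - d \<in> carrier FG"
        using diff(1,2) diff_carrier[of c d] by simp_all
      have cd': "\<phi> (c - d) \<in> carrier FG"
        using diff(3,4) diff_carrier[of "\<phi> c" "\<phi> d"] by (simp only: \<phi>_def frag_extend_diff)
      have cl: "cls c \<in> carrier TM" "cls d \<in> carrier TM" "cls (c - d) \<in> carrier TM" "cls (\<phi> (c - d)) \<in> carrier TM"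
        unfolding carrier_tensor by (intro imageI cd cd')+
      have "cls (\<phi> (c - d)) \<oplus>\<^bsub>TM\<^esub> ?L (cls d) = cls (\<phi> (c - d)) \<oplus>\<^bsub>TM\<^esub> cls (\<phi> d)"
        by (simp only: diff(4))
      also have "\<dots> = cls (\<phi> c)"
        by (simp only: add_tensor[OF cd' conjunct1[OF diff(4)]] \<phi>[symmetric])
      also have "\<dots> = ?L (cls (c - d) \<oplus>\<^bsub>TM\<^esub> cls d)"
        by (simp only: diff(3) add_tensor[OF cd(3,2)] diff_add_cancel)
      also have "\<dots> = ?L (cls (c - d)) \<oplus>\<^bsub>TM\<^esub> ?L (cls d)"
        by (rule additive_maps_add[OF bal(1) cl(3,2)])
      finally have "cls (\<phi> (c - d)) = ?L (cls (c - d))"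
        by (rule iffD1[OF TM.add.right_cancel, rotated -1])
          (intro cl additive_maps_closed[OF bal(1)])+
      then show ?case using cd' by simp
    next
      case (of a)
      then obtain x y where a: "a = (x, y)" "x \<in> carrier M" "y \<in> carrier N" by blast
      show ?case using bal(2)[OF a(2,3)] frag_of_carrier[OF M.smult_closed[OF r a(2)] a(3)]
        by (simp add: a(1) \<phi>_def pure_tensor_def)
    qed
  qed
  obtain c where c: "c \<in> carrier FG" "t = cls c"
    using t unfolding carrier_tensor by blast
  \<comment> \<open>Every representative d has the same class as c, so the terms of the union do not
    depend on d.\<close>
  have "cls (\<phi> d) = ?L (cls c)" if "d \<in> cls c" for d
  proof -
    note d = mem_tensor_class[OF c(1) that]
    have "cls d = cls c" by (rule tensor_class_cong[OF c(1) d])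
    then show ?thesis using conjunct2[OF key[OF d(1)]] by simp
  qed
  then have "(\<Union>d\<in>cls c. cls (\<phi> d)) = (\<Union>d\<in>cls c. ?L (cls c))" by (intro SUP_cong refl)
  also have "\<dots> = ?L (cls c)" using self_mem_tensor_class[OF c(1)] by blast
  finally show ?thesis by (simp add: c tensor_module_def Let_def \<phi>_def)
qed

lemma smult_tensor_additive:
  assumes "r \<in> carrier R" shows "(\<lambda>t. r \<odot>\<^bsub>TM\<^esub> t) \<in> additive_maps TM TM"
  using smult_lift_additive[OF assms] TM.add.m_closed
  by (auto simp: additive_maps_def smult_tensor_eq_lift[OF assms] Pi_iff)

lemma smult_pure:
  assumes "r \<in> carrier R" "x \<in> carrier M" "y \<in> carrier N"
  shows "r \<odot>\<^bsub>TM\<^esub> pure x y = pure (r \<odot>\<^bsub>M\<^esub> x) y"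
  using assms by (simp add: smult_tensor_eq_lift smult_lift_pure)

lemma smult_pure_right:
  assumes "r \<in> carrier R" "x \<in> carrier M" "y \<in> carrier N"
  shows "r \<odot>\<^bsub>TM\<^esub> pure x y = pure x (r \<odot>\<^bsub>N\<^esub> y)"
  using assms by (simp add: smult_pure pure_smult_swap)

lemma tensor_is_module: "module R TM"
proof (rule moduleI)
  fix a b t assume ab: "a \<in> carrier R" "b \<in> carrier R" and t: "t \<in> carrier TM"
  show "(a \<oplus>\<^bsub>R\<^esub> b) \<odot>\<^bsub>TM\<^esub> t = a \<odot>\<^bsub>TM\<^esub> t \<oplus>\<^bsub>TM\<^esub> b \<odot>\<^bsub>TM\<^esub> t"
    by (rule additive_maps_tensor_eqI[OF TM.abelian_group_axioms _ _ _ t])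
       (use ab in \<open>auto intro!: smult_tensor_additive additive_maps_plus TM.abelian_group_axioms
          simp: smult_pure M.smult_l_distr pure_add_left\<close>)
  show "(a \<otimes>\<^bsub>R\<^esub> b) \<odot>\<^bsub>TM\<^esub> t = a \<odot>\<^bsub>TM\<^esub> (b \<odot>\<^bsub>TM\<^esub> t)"
    by (rule additive_maps_tensor_eqI[OF TM.abelian_group_axioms _ _ _ t])
       (use ab in \<open>auto intro!: smult_tensor_additive
           additive_maps_comp[OF smult_tensor_additive smult_tensor_additive]
          simp: smult_pure M.smult_assoc1\<close>)
next
  fix t assume t: "t \<in> carrier TM"
  have "(\<lambda>t. t) \<in> additive_maps TM TM" by (auto simp: additive_maps_def)
  then show "\<one>\<^bsub>R\<^esub> \<odot>\<^bsub>TM\<^esub> t = t"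
    using additive_maps_tensor_eqI[OF TM.abelian_group_axioms smult_tensor_additive _ _ t, of "\<one>\<^bsub>R\<^esub>" "\<lambda>t. t"]
    by (auto simp: smult_pure)
qed (use additive_maps_closed[OF smult_tensor_additive] additive_maps_add[OF smult_tensor_additive]
      M.is_cring TM.abelian_group_axioms in auto)

end

text \<open>The map f \<otimes> g for two maps semilinear over the same \<open>\<rho>\<close>. With
  \<open>\<rho>\<close> a restriction of rings it yields the restrictions of the tensor presheaf and
  \<open>contract\<close>; with \<open>\<rho>\<close> the identity it yields
  \<open>tensor_rank_one\<close>.\<close>

lemma tensor_map:
  fixes R :: "'a ring" and R' :: "'b ring" and M :: "('a, 's) module" and N :: "('a, 't) module"
    and M' :: "('b, 'u) module" and N' :: "('b, 'v) module"
  assumes "module R M" "module R N" "module R' M'" "module R' N'"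
    and f: "f \<in> additive_maps M M'" and g: "g \<in> additive_maps N N'"
    and \<rho>: "\<And>r. r \<in> carrier R \<Longrightarrow> \<rho> r \<in> carrier R'"
    and fs: "\<And>r x. r \<in> carrier R \<Longrightarrow> x \<in> carrier M \<Longrightarrow> f (r \<odot>\<^bsub>M\<^esub> x) = \<rho> r \<odot>\<^bsub>M'\<^esub> f x"
    and gs: "\<And>r y. r \<in> carrier R \<Longrightarrow> y \<in> carrier N \<Longrightarrow> g (r \<odot>\<^bsub>N\<^esub> y) = \<rho> r \<odot>\<^bsub>N'\<^esub> g y"
  defines "h \<equiv> tensor_lift (tensor_module R' M' N') (\<lambda>(x, y). pure_tensor R' M' N' (f x) (g y))"
  shows tensor_map_additive: "h \<in> additive_maps (tensor_module R M N) (tensor_module R' M' N')"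
    and tensor_map_pure: "\<And>x y. x \<in> carrier M \<Longrightarrow> y \<in> carrier N \<Longrightarrow>
          h (pure_tensor R M N x y) = pure_tensor R' M' N' (f x) (g y)"
    and tensor_map_smult: "\<And>r t. r \<in> carrier R \<Longrightarrow> t \<in> carrier (tensor_module R M N) \<Longrightarrow>
          h (r \<odot>\<^bsub>tensor_module R M N\<^esub> t) = \<rho> r \<odot>\<^bsub>tensor_module R' M' N'\<^esub> h t"
proof -
  interpret S: tensor_pair R M N using assms(1,2) by (simp add: tensor_pair_def)
  interpret S': tensor_pair R' M' N' using assms(3,4) by (simp add: tensor_pair_def)
  note cl = additive_maps_closed[OF f] additive_maps_closed[OF g]
  note simps = S'.TM.abelian_group_axioms cl additive_maps_add[OF f] additive_maps_add[OF g]
     S'.pure_add_left S'.pure_add_right fs gs S'.pure_smult_swap \<rho>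
  show add: "h \<in> additive_maps S.TM S'.TM"
    unfolding h_def by (rule S.tensor_lift_additive) (auto simp: simps)
  show pure: "h (S.pure x y) = S'.pure (f x) (g y)" if "x \<in> carrier M" "y \<in> carrier N" for x y
    unfolding h_def using that by (subst S.tensor_lift_pure) (auto simp: simps)
  show "h (r \<odot>\<^bsub>S.TM\<^esub> t) = \<rho> r \<odot>\<^bsub>S'.TM\<^esub> h t" if "r \<in> carrier R" "t \<in> carrier S.TM" for r t
    by (rule S.additive_maps_tensor_eqI[OF S'.TM.abelian_group_axioms _ _ _ that(2)])
       (use that(1) \<rho> in \<open>auto intro!: additive_maps_comp[OF add S'.smult_tensor_additive]
          additive_maps_comp[OF S.smult_tensor_additive add]
          simp: S.smult_pure S'.smult_pure pure fs cl\<close>)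
qed

text \<open>
  The module axioms of \<open>N\<close> reduce to those of the local modules \<open>L j\<close>: germs are represented by
  local sections, and morphisms by their values.
\<close>

lemma module_of_local_representatives:
  fixes R :: "'a ring" and N :: "('a, 'g) module" and S :: "'j \<Rightarrow> 'a ring" and L :: "'j \<Rightarrow> ('a, 's) module"
  assumes R: "cring R"
    and closed: "\<zero>\<^bsub>N\<^esub> \<in> carrier N"
      "\<And>g h. g \<in> carrier N \<Longrightarrow> h \<in> carrier N \<Longrightarrow> g \<oplus>\<^bsub>N\<^esub> h \<in> carrier N"
      "\<And>a g. a \<in> carrier R \<Longrightarrow> g \<in> carrier N \<Longrightarrow> a \<odot>\<^bsub>N\<^esub> g \<in> carrier N"
    and J: "\<And>j. j \<in> J \<Longrightarrow> module (S j) (L j)" "\<And>j. j \<in> J \<Longrightarrow> \<rho> j \<in> ring_hom R (S j)"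
    and rep: "\<And>j g s. rep j g s \<Longrightarrow> s \<in> carrier (L j)"
      "\<And>j. j \<in> J \<Longrightarrow> rep j \<zero>\<^bsub>N\<^esub> \<zero>\<^bsub>L j\<^esub>"
      "\<And>j g h s t. j \<in> J \<Longrightarrow> rep j g s \<Longrightarrow> rep j h t \<Longrightarrow> rep j (g \<oplus>\<^bsub>N\<^esub> h) (s \<oplus>\<^bsub>L j\<^esub> t)"
      "\<And>j a g s. j \<in> J \<Longrightarrow> a \<in> carrier R \<Longrightarrow> rep j g s \<Longrightarrow> rep j (a \<odot>\<^bsub>N\<^esub> g) (\<rho> j a \<odot>\<^bsub>L j\<^esub> s)"
    and cover: "\<And>x g h k. x \<in> I \<Longrightarrow> g \<in> carrier N \<Longrightarrow> h \<in> carrier N \<Longrightarrow> k \<in> carrier N \<Longrightarrow>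
      \<exists>j\<in>J. near x j \<and> (\<exists>s t u. rep j g s \<and> rep j h t \<and> rep j k u)"
    and separated: "\<And>g h. g \<in> carrier N \<Longrightarrow> h \<in> carrier N \<Longrightarrow>
      (\<And>x. x \<in> I \<Longrightarrow> \<exists>j s. near x j \<and> rep j g s \<and> rep j h s) \<Longrightarrow> g = h"
  shows "module R N"
proof -
  interpret R: cring R by (rule R)
  \<comment> \<open>Multiplication by -1 provides the negatives: \<open>rep\<close> is compatible
    with zero, addition and scalars, and negation has to be expressed through these.\<close>
  let ?m = "\<ominus>\<^bsub>R\<^esub> \<one>\<^bsub>R\<^esub>"
  have m: "?m \<in> carrier R" by simp
  have neg: "\<rho> j ?m \<odot>\<^bsub>L j\<^esub> s \<oplus>\<^bsub>L j\<^esub> s = \<zero>\<^bsub>L j\<^esub>" if j: "j \<in> J" and s: "s \<in> carrier (L j)" for j s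
  proof -
    interpret L: module "S j" "L j" by (rule J(1)[OF j])
    note h = J(2)[OF j]
    have "\<rho> j ?m \<odot>\<^bsub>L j\<^esub> s \<oplus>\<^bsub>L j\<^esub> s = (\<rho> j ?m \<oplus>\<^bsub>S j\<^esub> \<rho> j \<one>\<^bsub>R\<^esub>) \<odot>\<^bsub>L j\<^esub> s"
      using L.smult_l_distr[OF ring_hom_closed[OF h m] L.R.one_closed s] s ring_hom_one[OF h] by simp
    also have "\<rho> j ?m \<oplus>\<^bsub>S j\<^esub> \<rho> j \<one>\<^bsub>R\<^esub> = \<zero>\<^bsub>S j\<^esub>"
      using ring_hom_add[OF h m R.one_closed] ring_hom_zero[OF h R.ring_axioms L.R.ring_axioms] R.l_neg[OF R.one_closed]
      by metis
    also have "\<zero>\<^bsub>S j\<^esub> \<odot>\<^bsub>L j\<^esub> s = \<zero>\<^bsub>L j\<^esub>" using s by simp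
    finally show ?thesis .
  qed
  show ?thesis
  proof (rule moduleI[OF R abelian_groupI'[where n = "\<lambda>g. ?m \<odot>\<^bsub>N\<^esub> g"]])
    fix g h k assume N: "g \<in> carrier N" "h \<in> carrier N" "k \<in> carrier N"
    have "(g \<oplus>\<^bsub>N\<^esub> h) \<oplus>\<^bsub>N\<^esub> k = g \<oplus>\<^bsub>N\<^esub> (h \<oplus>\<^bsub>N\<^esub> k) \<and> g \<oplus>\<^bsub>N\<^esub> h = h \<oplus>\<^bsub>N\<^esub> g \<and> \<zero>\<^bsub>N\<^esub> \<oplus>\<^bsub>N\<^esub> g = g \<and>
        ?m \<odot>\<^bsub>N\<^esub> g \<oplus>\<^bsub>N\<^esub> g = \<zero>\<^bsub>N\<^esub>"
    proof (intro conjI separated closed m N)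
      fix x assume "x \<in> I"
      then obtain j s t u where j: "j \<in> J" "near x j" and r: "rep j g s" "rep j h t" "rep j k u"
        using cover[OF _ N] by metis
      interpret L: module "S j" "L j" by (rule J(1)[OF j(1)])
      note c = r[THEN rep(1)] and add = rep(3)[OF j(1)]
      show "\<exists>j s. near x j \<and> rep j ((g \<oplus>\<^bsub>N\<^esub> h) \<oplus>\<^bsub>N\<^esub> k) s \<and> rep j (g \<oplus>\<^bsub>N\<^esub> (h \<oplus>\<^bsub>N\<^esub> k)) s"
        using add[OF add[OF r(1,2)] r(3)] add[OF r(1) add[OF r(2,3)]] L.a_assoc[OF c] j(2) by metis
      show "\<exists>j s. near x j \<and> rep j (g \<oplus>\<^bsub>N\<^esub> h) s \<and> rep j (h \<oplus>\<^bsub>N\<^esub> g) s"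
        using add[OF r(1,2)] add[OF r(2,1)] L.a_comm[OF c(1,2)] j(2) by metis
      show "\<exists>j s. near x j \<and> rep j (\<zero>\<^bsub>N\<^esub> \<oplus>\<^bsub>N\<^esub> g) s \<and> rep j g s"
        using add[OF rep(2)[OF j(1)] r(1)] L.l_zero[OF c(1)] r(1) j(2) by metis
      show "\<exists>j s. near x j \<and> rep j (?m \<odot>\<^bsub>N\<^esub> g \<oplus>\<^bsub>N\<^esub> g) s \<and> rep j \<zero>\<^bsub>N\<^esub> s"
        using add[OF rep(4)[OF j(1) m r(1)] r(1)] neg[OF j(1) c(1)] rep(2)[OF j(1)] j(2) by metis
    qed
    then show "(g \<oplus>\<^bsub>N\<^esub> h) \<oplus>\<^bsub>N\<^esub> k = g \<oplus>\<^bsub>N\<^esub> (h \<oplus>\<^bsub>N\<^esub> k)" "g \<oplus>\<^bsub>N\<^esub> h = h \<oplus>\<^bsub>N\<^esub> g"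
      "\<zero>\<^bsub>N\<^esub> \<oplus>\<^bsub>N\<^esub> g = g" "?m \<odot>\<^bsub>N\<^esub> g \<oplus>\<^bsub>N\<^esub> g = \<zero>\<^bsub>N\<^esub>" by auto
  next
    have "(a \<oplus>\<^bsub>R\<^esub> b) \<odot>\<^bsub>N\<^esub> g = a \<odot>\<^bsub>N\<^esub> g \<oplus>\<^bsub>N\<^esub> b \<odot>\<^bsub>N\<^esub> g \<and> (a \<otimes>\<^bsub>R\<^esub> b) \<odot>\<^bsub>N\<^esub> g = a \<odot>\<^bsub>N\<^esub> (b \<odot>\<^bsub>N\<^esub> g) \<and>
        a \<odot>\<^bsub>N\<^esub> (g \<oplus>\<^bsub>N\<^esub> h) = a \<odot>\<^bsub>N\<^esub> g \<oplus>\<^bsub>N\<^esub> a \<odot>\<^bsub>N\<^esub> h \<and> \<one>\<^bsub>R\<^esub> \<odot>\<^bsub>N\<^esub> g = g"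
      if N: "g \<in> carrier N" "h \<in> carrier N" and a: "a \<in> carrier R" and b: "b \<in> carrier R" for a b g h
    proof (intro conjI separated closed N a b R.a_closed R.m_closed R.one_closed)
      fix x assume "x \<in> I"
      then obtain j s t where j: "j \<in> J" "near x j" and r: "rep j g s" "rep j h t"
        using cover[OF _ N N(1)] by metis
      interpret L: module "S j" "L j" by (rule J(1)[OF j(1)])
      note c = r[THEN rep(1)] and add = rep(3)[OF j(1)] and sm = rep(4)[OF j(1)]
      note h = J(2)[OF j(1)]
      note \<rho> = ring_hom_closed[OF h a] ring_hom_closed[OF h b]
      show "\<exists>j s. near x j \<and> rep j ((a \<oplus>\<^bsub>R\<^esub> b) \<odot>\<^bsub>N\<^esub> g) s \<and> rep j (a \<odot>\<^bsub>N\<^esub> g \<oplus>\<^bsub>N\<^esub> b \<odot>\<^bsub>N\<^esub> g) s"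
        using sm[OF R.a_closed[OF a b] r(1)] add[OF sm[OF a r(1)] sm[OF b r(1)]]
          L.smult_l_distr[OF \<rho> c(1)] ring_hom_add[OF h a b] j(2) by metis
      show "\<exists>j s. near x j \<and> rep j ((a \<otimes>\<^bsub>R\<^esub> b) \<odot>\<^bsub>N\<^esub> g) s \<and> rep j (a \<odot>\<^bsub>N\<^esub> (b \<odot>\<^bsub>N\<^esub> g)) s"
        using sm[OF R.m_closed[OF a b] r(1)] sm[OF a sm[OF b r(1)]]
          L.smult_assoc1[OF \<rho> c(1)] ring_hom_mult[OF h a b] j(2) by metis
      show "\<exists>j s. near x j \<and> rep j (a \<odot>\<^bsub>N\<^esub> (g \<oplus>\<^bsub>N\<^esub> h)) s \<and> rep j (a \<odot>\<^bsub>N\<^esub> g \<oplus>\<^bsub>N\<^esub> a \<odot>\<^bsub>N\<^esub> h) s"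
        using sm[OF a add[OF r]] add[OF sm[OF a r(1)] sm[OF a r(2)]] L.smult_r_distr[OF \<rho>(1) c] j(2) by metis
      show "\<exists>j s. near x j \<and> rep j (\<one>\<^bsub>R\<^esub> \<odot>\<^bsub>N\<^esub> g) s \<and> rep j g s"
        using sm[OF R.one_closed r(1)] L.smult_one[OF c(1)] ring_hom_one[OF h] r(1) j(2) by metis
    qed
    then show "\<And>a b g. a \<in> carrier R \<Longrightarrow> b \<in> carrier R \<Longrightarrow> g \<in> carrier N \<Longrightarrow> (a \<oplus>\<^bsub>R\<^esub> b) \<odot>\<^bsub>N\<^esub> g = a \<odot>\<^bsub>N\<^esub> g \<oplus>\<^bsub>N\<^esub> b \<odot>\<^bsub>N\<^esub> g"
      "\<And>a b g. a \<in> carrier R \<Longrightarrow> b \<in> carrier R \<Longrightarrow> g \<in> carrier N \<Longrightarrow> (a \<otimes>\<^bsub>R\<^esub> b) \<odot>\<^bsub>N\<^esub> g = a \<odot>\<^bsub>N\<^esub> (b \<odot>\<^bsub>N\<^esub> g)"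
      "\<And>a g h. a \<in> carrier R \<Longrightarrow> g \<in> carrier N \<Longrightarrow> h \<in> carrier N \<Longrightarrow> a \<odot>\<^bsub>N\<^esub> (g \<oplus>\<^bsub>N\<^esub> h) = a \<odot>\<^bsub>N\<^esub> g \<oplus>\<^bsub>N\<^esub> a \<odot>\<^bsub>N\<^esub> h"
      "\<And>g. g \<in> carrier N \<Longrightarrow> \<one>\<^bsub>R\<^esub> \<odot>\<^bsub>N\<^esub> g = g"
      using R.one_closed by metis+
  qed (use closed m in auto)
qed

section \<open>Presheaves of modules over a ringed space\<close>

lemma mem_opens_in: "V \<in> opens_in T U \<longleftrightarrow> openin T V \<and> V \<subseteq> U"
  by (simp add: opens_in_def)

locale ringed_topology =
  fixes T :: "'x topology" and A :: "('x, 'a) ring_presheaf"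
  assumes A_cring: "\<And>U. openin T U \<Longrightarrow> cring (rsec A U)"
    and A_hom: "\<And>U V. openin T U \<Longrightarrow> openin T V \<Longrightarrow> V \<subseteq> U \<Longrightarrow> rres A U V \<in> ring_hom (rsec A U) (rsec A V)"
    and A_id: "\<And>U r. openin T U \<Longrightarrow> r \<in> carrier (rsec A U) \<Longrightarrow> rres A U U r = r"
    and A_comp: "\<And>U V W r. openin T U \<Longrightarrow> openin T V \<Longrightarrow> openin T W \<Longrightarrow> V \<subseteq> U \<Longrightarrow> W \<subseteq> V \<Longrightarrow>
        r \<in> carrier (rsec A U) \<Longrightarrow> rres A V W (rres A U V r) = rres A U W r"
begin

lemma A_res_closed:
  "openin T U \<Longrightarrow> openin T V \<Longrightarrow> V \<subseteq> U \<Longrightarrow> r \<in> carrier (rsec A U) \<Longrightarrow> rres A U V r \<in> carrier (rsec A V)"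
  using A_hom ring_hom_closed by metis

lemma A_res_one:
  "openin T U \<Longrightarrow> openin T V \<Longrightarrow> V \<subseteq> U \<Longrightarrow> rres A U V \<one>\<^bsub>rsec A U\<^esub> = \<one>\<^bsub>rsec A V\<^esub>"
  using ring_hom_one[OF A_hom] by metis

lemma A_res_zero:
  assumes "openin T U" "openin T V" "V \<subseteq> U"
  shows "rres A U V \<zero>\<^bsub>rsec A U\<^esub> = \<zero>\<^bsub>rsec A V\<^esub>"
  by (rule ring_hom_zero[OF A_hom[OF assms]]) (auto intro: cring.axioms A_cring assms)

end

locale module_presheaf_on = ringed_topology T A
  for T :: "'x topology" and A :: "('x, 'a) ring_presheaf" +
  fixes P :: "('x, 'a, 's) module_presheaf"
  assumes presheaf: "presheaf_of_modules T A P"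
begin

abbreviation "sec U \<equiv> carrier (msec P U)"

lemma sec_module: "openin T U \<Longrightarrow> module (rsec A U) (msec P U)"
  using presheaf by (auto simp: presheaf_of_modules_def)

lemma sec_abelian_group: "openin T U \<Longrightarrow> abelian_group (msec P U)"
  using sec_module module.axioms(2) by blast

lemma res_closed:
  "openin T U \<Longrightarrow> openin T V \<Longrightarrow> V \<subseteq> U \<Longrightarrow> s \<in> sec U \<Longrightarrow> mres P U V s \<in> sec V"
  using presheaf by (auto simp: presheaf_of_modules_def opens_in_def)

lemma res_add:
  "openin T U \<Longrightarrow> openin T V \<Longrightarrow> V \<subseteq> U \<Longrightarrow> s \<in> sec U \<Longrightarrow> t \<in> sec U \<Longrightarrow>
    mres P U V (s \<oplus>\<^bsub>msec P U\<^esub> t) = mres P U V s \<oplus>\<^bsub>msec P V\<^esub> mres P U V t"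
  using presheaf by (auto simp: presheaf_of_modules_def opens_in_def)

lemma res_smult:
  "openin T U \<Longrightarrow> openin T V \<Longrightarrow> V \<subseteq> U \<Longrightarrow> r \<in> carrier (rsec A U) \<Longrightarrow> s \<in> sec U \<Longrightarrow>
    mres P U V (r \<odot>\<^bsub>msec P U\<^esub> s) = rres A U V r \<odot>\<^bsub>msec P V\<^esub> mres P U V s"
  using presheaf by (auto simp: presheaf_of_modules_def opens_in_def)

lemma res_id: "openin T U \<Longrightarrow> s \<in> sec U \<Longrightarrow> mres P U U s = s"
  using presheaf by (auto simp: presheaf_of_modules_def)

lemma res_res:
  "openin T U \<Longrightarrow> openin T V \<Longrightarrow> openin T W \<Longrightarrow> V \<subseteq> U \<Longrightarrow> W \<subseteq> V \<Longrightarrow> s \<in> sec U \<Longrightarrow>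
    mres P V W (mres P U V s) = mres P U W s"
  using presheaf by (auto simp: presheaf_of_modules_def opens_in_def)

lemma res_additive:
  "openin T U \<Longrightarrow> openin T V \<Longrightarrow> V \<subseteq> U \<Longrightarrow> mres P U V \<in> additive_maps (msec P U) (msec P V)"
  by (rule additive_mapsI) (auto simp: res_closed res_add)

lemma sec_closed [simp]:
  assumes "openin T U"
  shows "\<zero>\<^bsub>msec P U\<^esub> \<in> sec U"
    and "\<And>s t. s \<in> sec U \<Longrightarrow> t \<in> sec U \<Longrightarrow> s \<oplus>\<^bsub>msec P U\<^esub> t \<in> sec U"
    and "\<And>r s. r \<in> carrier (rsec A U) \<Longrightarrow> s \<in> sec U \<Longrightarrow> r \<odot>\<^bsub>msec P U\<^esub> s \<in> sec U"
proof -
  interpret module "rsec A U" "msec P U" by (rule sec_module[OF assms])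
  show "\<zero>\<^bsub>msec P U\<^esub> \<in> sec U"
    "\<And>s t. s \<in> sec U \<Longrightarrow> t \<in> sec U \<Longrightarrow> s \<oplus>\<^bsub>msec P U\<^esub> t \<in> sec U"
    "\<And>r s. r \<in> carrier (rsec A U) \<Longrightarrow> s \<in> sec U \<Longrightarrow> r \<odot>\<^bsub>msec P U\<^esub> s \<in> sec U"
    by auto
qed

lemma res_zero:
  "openin T U \<Longrightarrow> openin T V \<Longrightarrow> V \<subseteq> U \<Longrightarrow> mres P U V \<zero>\<^bsub>msec P U\<^esub> = \<zero>\<^bsub>msec P V\<^esub>"
  by (rule additive_maps_zero[OF sec_abelian_group sec_abelian_group res_additive])

section \<open>Germs and sheafification\<close>

text \<open>Transitivity of agreement near x: the two agreements are compared on the intersection of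
  the neighbourhoods. The hypotheses are symmetric in the two sections, so using it twice gives
  equality of germs.\<close>

lemma germ_subsetI:
  assumes "openin T U" "openin T V" "s \<in> sec U" "t \<in> sec V"
    and "openin T W" "x \<in> W" "W \<subseteq> U" "W \<subseteq> V" "mres P U W s = mres P V W t"
  shows "germ T P x U s \<subseteq> germ T P x V t"
proof
  fix p assume p: "p \<in> germ T P x U s"
  obtain Z u where p_eq: "p = (Z, u)" by (cases p)
  obtain O1 where Z: "openin T Z" "x \<in> Z" "u \<in> sec Z"
    and O1: "openin T O1" "x \<in> O1" "O1 \<subseteq> U \<inter> Z" "mres P U O1 s = mres P Z O1 u"
    using p unfolding p_eq germ_def by blast
  have op: "openin T (O1 \<inter> W)" using O1(1) assms(5) by (rule openin_Int)
  have "mres P V (O1 \<inter> W) t = mres P W (O1 \<inter> W) (mres P U W s)"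
    using res_res[OF assms(2,5) op assms(8) _ assms(4)] assms(9) by simp
  also have "\<dots> = mres P U (O1 \<inter> W) s"
    using res_res[OF assms(1,5) op assms(7) _ assms(3)] by simp
  also have "\<dots> = mres P O1 (O1 \<inter> W) (mres P Z O1 u)"
    using res_res[OF assms(1) O1(1) op _ _ assms(3)] O1(3,4) by simp
  also have "\<dots> = mres P Z (O1 \<inter> W) u"
    using res_res[OF Z(1) O1(1) op _ _ Z(3)] O1(3) by simp
  finally show "p \<in> germ T P x V t"
    unfolding p_eq germ_def using Z op O1 assms(6,8) by blast
qed

lemma germ_eqI:
  assumes "openin T U" "openin T V" "s \<in> sec U" "t \<in> sec V"
    and "openin T W" "x \<in> W" "W \<subseteq> U" "W \<subseteq> V" "mres P U W s = mres P V W t"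
  shows "germ T P x U s = germ T P x V t"
  using germ_subsetI[OF assms] germ_subsetI[OF assms(2,1,4,3,5,6,8,7) assms(9)[symmetric]] by blast

lemma germ_res:
  "openin T U \<Longrightarrow> openin T V \<Longrightarrow> V \<subseteq> U \<Longrightarrow> x \<in> V \<Longrightarrow> s \<in> sec U \<Longrightarrow>
    germ T P x V (mres P U V s) = germ T P x U s"
  by (rule germ_eqI[where W = V]) (auto simp: res_closed res_id)

lemma self_mem_germ: "openin T U \<Longrightarrow> x \<in> U \<Longrightarrow> s \<in> sec U \<Longrightarrow> (U, s) \<in> germ T P x U s"
  unfolding germ_def by blast

lemma mem_germE:
  assumes "(V, t) \<in> germ T P x U s"
  obtains W where "openin T V" "x \<in> V" "t \<in> sec V"
    "openin T W" "x \<in> W" "W \<subseteq> U" "W \<subseteq> V" "mres P U W s = mres P V W t"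
  using assms unfolding germ_def by blast

lemma germ_eqE:
  assumes "germ T P x U s = germ T P x V t" "openin T U" "x \<in> U" "s \<in> sec U"
  obtains W where "openin T W" "x \<in> W" "W \<subseteq> U" "W \<subseteq> V" "mres P U W s = mres P V W t"
  using self_mem_germ[OF assms(2-4)] unfolding assms(1) by (elim mem_germE) (use that in metis)

abbreviation "SP \<equiv> sheafify T A P"

text \<open>The working relation between families of germs and presheaf sections: over
  \<open>V\<close> the family \<open>g\<close> is the image of \<open>s\<close>. Being pointwise on
  \<open>V\<close>, it ignores all other values of \<open>g\<close>, so one family can be
  represented over many sets without restricting it.\<close>

definition represents :: "'x set \<Rightarrow> ('x \<Rightarrow> ('x set \<times> 's) set) \<Rightarrow> 's \<Rightarrow> bool" where
  "represents V g s \<longleftrightarrow> openin T V \<and> s \<in> sec V \<and> (\<forall>y\<in>V. g y = germ T P y V s)"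

lemma representsD:
  assumes "represents V g s"
  shows "openin T V" "s \<in> sec V" "\<And>y. y \<in> V \<Longrightarrow> g y = germ T P y V s"
  using assms by (auto simp: represents_def)

lemma represents_res:
  assumes "represents V g s" "openin T W" "W \<subseteq> V"
  shows "represents W g (mres P V W s)"
  unfolding represents_def
  using representsD[OF assms(1)] assms(2,3) germ_res[of V W] res_closed by auto

lemma represents_unique: "represents V g s \<Longrightarrow> represents V h s \<Longrightarrow> x \<in> V \<Longrightarrow> g x = h x"
  by (simp add: represents_def)

lemma represents_restrict: "represents V g s \<Longrightarrow> V \<subseteq> W \<Longrightarrow> represents V (restrict g W) s"
  by (auto simp: represents_def)

lemma represents_restrict_iff: "V \<subseteq> W \<Longrightarrow> represents V (restrict g W) s \<longleftrightarrow> represents V g s"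
  by (auto simp: represents_def)

lemma carrier_sheafify_iff:
  "g \<in> carrier (msec SP U) \<longleftrightarrow> g \<in> extensional U \<and> (\<forall>x\<in>U. \<exists>V s. x \<in> V \<and> V \<subseteq> U \<and> represents V g s)"
proof -
  have "(\<exists>V\<in>opens_in T U. x \<in> V \<and> (\<exists>s\<in>sec V. \<forall>y\<in>V. g y = germ T P y V s))
      \<longleftrightarrow> (\<exists>V s. x \<in> V \<and> V \<subseteq> U \<and> represents V g s)" for x
    unfolding mem_opens_in represents_def Bex_def by blast
  then show ?thesis by (simp add: sheafify_def)
qed

lemma represented:
  assumes "g \<in> carrier (msec SP U)" "x \<in> U"
  obtains V s where "openin T V" "x \<in> V" "V \<subseteq> U" "represents V g s"
  using assms unfolding carrier_sheafify_iff represents_def by blast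

lemma represented2:
  assumes "openin T U" "openin T U'" "g \<in> carrier (msec SP U)" "h \<in> carrier (msec SP U')" "x \<in> U" "x \<in> U'"
  obtains V s t where "openin T V" "x \<in> V" "V \<subseteq> U" "V \<subseteq> U'" "represents V g s" "represents V h t"
proof -
  obtain V s where V: "openin T V" "x \<in> V" "V \<subseteq> U" "represents V g s"
    using represented[OF assms(3,5)] .
  obtain W t where W: "openin T W" "x \<in> W" "W \<subseteq> U'" "represents W h t"
    using represented[OF assms(4,6)] .
  have op: "openin T (V \<inter> W)" using V W by blast
  show thesis
    by (rule that[OF op _ _ _ represents_res[OF V(4) op] represents_res[OF W(4) op]]) (use V W in auto)
qed

text \<open>A shared local representative forces equal germs. Identities in the sheafification
  thereby reduce to identities between presheaf sections over small sets.\<close>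

lemma sheafify_eqI:
  assumes "g \<in> extensional U" "h \<in> extensional U"
    and "\<And>x. x \<in> U \<Longrightarrow> \<exists>V s. x \<in> V \<and> represents V g s \<and> represents V h s"
  shows "g = h"
  by (rule extensionalityI[OF assms(1,2)]) (use assms(3) represents_unique in blast)

lemma sheafify_extensional: "g \<in> carrier (msec SP U) \<Longrightarrow> g \<in> extensional U"
  by (simp add: carrier_sheafify_iff)

lemma zero_sheafify: "\<zero>\<^bsub>msec SP U\<^esub> = (\<lambda>x\<in>U. germ T P x U \<zero>\<^bsub>msec P U\<^esub>)"
  by (simp add: sheafify_def)

lemma add_sheafify: "g \<oplus>\<^bsub>msec SP U\<^esub> h = (\<lambda>x\<in>U. \<Union>(V, s)\<in>g x. \<Union>(W, t)\<in>h x.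
    germ T P x (V \<inter> W) (mres P V (V \<inter> W) s \<oplus>\<^bsub>msec P (V \<inter> W)\<^esub> mres P W (V \<inter> W) t))"
  by (simp add: sheafify_def)

lemma smult_sheafify: "r \<odot>\<^bsub>msec SP U\<^esub> g = (\<lambda>x\<in>U. \<Union>(V, s)\<in>g x.
    germ T P x (U \<inter> V) (rres A U (U \<inter> V) r \<odot>\<^bsub>msec P (U \<inter> V)\<^esub> mres P V (U \<inter> V) s))"
  by (simp add: sheafify_def)

lemma mres_sheafify: "mres SP U V g = restrict g V"
  by (simp add: sheafify_def)

lemma represents_zero:
  assumes "openin T U" "openin T V" "V \<subseteq> U"
  shows "represents V \<zero>\<^bsub>msec SP U\<^esub> \<zero>\<^bsub>msec P V\<^esub>"
  unfolding represents_def zero_sheafify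
proof (intro conjI ballI)
  fix y assume "y \<in> V"
  then show "(\<lambda>x\<in>U. germ T P x U \<zero>\<^bsub>msec P U\<^esub>) y = germ T P y V \<zero>\<^bsub>msec P V\<^esub>"
    using germ_res[OF assms, of y "\<zero>\<^bsub>msec P U\<^esub>"] res_zero[OF assms] assms by auto
qed (use assms in auto)

text \<open>The definition of addition forms the sum on the intersection of the two domains. This
  moves it to an arbitrary smaller neighbourhood, where different representatives of the same germs
  become equal.\<close>

lemma germ_add_res:
  assumes "openin T V" "openin T W" "s \<in> sec V" "t \<in> sec W" "openin T Z" "x \<in> Z" "Z \<subseteq> V" "Z \<subseteq> W"
  shows "germ T P x (V \<inter> W) (mres P V (V \<inter> W) s \<oplus>\<^bsub>msec P (V \<inter> W)\<^esub> mres P W (V \<inter> W) t)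
    = germ T P x Z (mres P V Z s \<oplus>\<^bsub>msec P Z\<^esub> mres P W Z t)"
proof -
  have VW: "openin T (V \<inter> W)" and Z: "Z \<subseteq> V \<inter> W" using assms by auto
  note s = res_closed[OF assms(1) VW Int_lower1 assms(3)] and t = res_closed[OF assms(2) VW Int_lower2 assms(4)]
  show ?thesis
    using germ_res[OF VW assms(5) Z assms(6) sec_closed(2)[OF VW s t]]
    by (simp only: res_add[OF VW assms(5) Z s t] res_res[OF assms(1) VW assms(5) Int_lower1 Z assms(3)]
        res_res[OF assms(2) VW assms(5) Int_lower2 Z assms(4)])
qed

lemma germ_smult_res:
  assumes "openin T U" "openin T V" "r \<in> carrier (rsec A U)" "s \<in> sec V" "openin T Z" "x \<in> Z" "Z \<subseteq> U" "Z \<subseteq> V"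
  shows "germ T P x (U \<inter> V) (rres A U (U \<inter> V) r \<odot>\<^bsub>msec P (U \<inter> V)\<^esub> mres P V (U \<inter> V) s)
    = germ T P x Z (rres A U Z r \<odot>\<^bsub>msec P Z\<^esub> mres P V Z s)"
proof -
  have UV: "openin T (U \<inter> V)" and Z: "Z \<subseteq> U \<inter> V" using assms by auto
  note r = A_res_closed[OF assms(1) UV Int_lower1 assms(3)] and s = res_closed[OF assms(2) UV Int_lower2 assms(4)]
  show ?thesis
    using germ_res[OF UV assms(5) Z assms(6) sec_closed(3)[OF UV r s]]
    by (simp only: res_smult[OF UV assms(5) Z r s] A_comp[OF assms(1) UV assms(5) Int_lower1 Z assms(3)]
        res_res[OF assms(2) UV assms(5) Int_lower2 Z assms(4)])
qed

text \<open>Any representatives of the two germs at y agree with s and t near y, so every term of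
  the double union defining the sum is the germ of s + t.\<close>

lemma represents_add:
  assumes "openin T V" "V \<subseteq> U" "represents V g s" "represents V h t"
  shows "represents V (g \<oplus>\<^bsub>msec SP U\<^esub> h) (s \<oplus>\<^bsub>msec P V\<^esub> t)"
  unfolding represents_def
proof (intro conjI ballI)
  note s = representsD[OF assms(3)] and t = representsD[OF assms(4)]
  show "s \<oplus>\<^bsub>msec P V\<^esub> t \<in> sec V" using s t by simp
  fix y assume y: "y \<in> V"
  have eq: "germ T P y (V1 \<inter> W1) (mres P V1 (V1 \<inter> W1) s1 \<oplus>\<^bsub>msec P (V1 \<inter> W1)\<^esub> mres P W1 (V1 \<inter> W1) t1)
       = germ T P y V (s \<oplus>\<^bsub>msec P V\<^esub> t)"
    if V1: "(V1, s1) \<in> germ T P y V s" and W1: "(W1, t1) \<in> germ T P y V t" for V1 s1 W1 t1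
  proof -
    obtain O1 where a: "openin T V1" "y \<in> V1" "s1 \<in> sec V1"
      "openin T O1" "y \<in> O1" "O1 \<subseteq> V" "O1 \<subseteq> V1" "mres P V O1 s = mres P V1 O1 s1"
      using V1 by (rule mem_germE)
    obtain O2 where b: "openin T W1" "y \<in> W1" "t1 \<in> sec W1"
      "openin T O2" "y \<in> O2" "O2 \<subseteq> V" "O2 \<subseteq> W1" "mres P V O2 t = mres P W1 O2 t1"
      using W1 by (rule mem_germE)
    define Z where "Z = O1 \<inter> O2"
    have Z: "openin T Z" "y \<in> Z" "Z \<subseteq> V1" "Z \<subseteq> W1" "Z \<subseteq> V" "Z \<subseteq> O1" "Z \<subseteq> O2" using a b by (auto simp: Z_def)
    have "mres P V1 Z s1 = mres P V Z s" "mres P W1 Z t1 = mres P V Z t"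
      using res_res[OF a(1,4) Z(1) a(7) Z(6) a(3)] res_res[OF assms(1) a(4) Z(1) a(6) Z(6) s(2)] a(8)
        res_res[OF b(1,4) Z(1) b(7) Z(7) b(3)] res_res[OF assms(1) b(4) Z(1) b(6) Z(7) t(2)] b(8) by simp_all
    then show ?thesis
      using germ_add_res[OF a(1) b(1) a(3) b(3) Z(1-4)] germ_res[OF assms(1) Z(1,5,2) sec_closed(2)[OF assms(1) s(2) t(2)]]
      by (simp only: res_add[OF assms(1) Z(1,5) s(2) t(2)])
  qed
  have "(g \<oplus>\<^bsub>msec SP U\<^esub> h) y = (\<Union>(V1, s1)\<in>germ T P y V s. \<Union>(W1, t1)\<in>germ T P y V t.
     germ T P y (V1 \<inter> W1) (mres P V1 (V1 \<inter> W1) s1 \<oplus>\<^bsub>msec P (V1 \<inter> W1)\<^esub> mres P W1 (V1 \<inter> W1) t1))"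
    using y assms(2) s(3) t(3) by (auto simp: add_sheafify)
  also have "\<dots> = (\<Union>p\<in>germ T P y V s. \<Union>q\<in>germ T P y V t. germ T P y V (s \<oplus>\<^bsub>msec P V\<^esub> t))"
    by (intro SUP_cong refl) (auto simp: eq)
  \<comment> \<open>A union of copies of one set is that set only over a nonempty index set; (V, s)
    and (V, t) themselves are members of the germs.\<close>
  also have "\<dots> = germ T P y V (s \<oplus>\<^bsub>msec P V\<^esub> t)"
    using self_mem_germ[OF assms(1) y s(2)] self_mem_germ[OF assms(1) y t(2)] by blast
  finally show "(g \<oplus>\<^bsub>msec SP U\<^esub> h) y = germ T P y V (s \<oplus>\<^bsub>msec P V\<^esub> t)" .
qed (rule assms(1))

lemma represents_smult:
  assumes "openin T U" "openin T V" "V \<subseteq> U" "represents V g s" "r \<in> carrier (rsec A U)"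
  shows "represents V (r \<odot>\<^bsub>msec SP U\<^esub> g) (rres A U V r \<odot>\<^bsub>msec P V\<^esub> s)"
  unfolding represents_def
proof (intro conjI ballI)
  note s = representsD[OF assms(4)] and rV = A_res_closed[OF assms(1-3,5)]
  show "rres A U V r \<odot>\<^bsub>msec P V\<^esub> s \<in> sec V" using s rV by simp
  fix y assume y: "y \<in> V"
  have eq: "germ T P y (U \<inter> V1) (rres A U (U \<inter> V1) r \<odot>\<^bsub>msec P (U \<inter> V1)\<^esub> mres P V1 (U \<inter> V1) s1)
       = germ T P y V (rres A U V r \<odot>\<^bsub>msec P V\<^esub> s)"
    if V1: "(V1, s1) \<in> germ T P y V s" for V1 s1
  proof -
    obtain Z where a: "openin T V1" "y \<in> V1" "s1 \<in> sec V1"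
      "openin T Z" "y \<in> Z" "Z \<subseteq> V" "Z \<subseteq> V1" "mres P V Z s = mres P V1 Z s1"
      using V1 by (rule mem_germE)
    have "Z \<subseteq> U" using a(6) assms(3) by auto
    then show ?thesis
      using germ_smult_res[OF assms(1) a(1) assms(5) a(3-5) _ a(7)]
        germ_res[OF assms(2) a(4,6,5) sec_closed(3)[OF assms(2) rV s(2)]]
      by (simp only: res_smult[OF assms(2) a(4,6) rV s(2)] A_comp[OF assms(1,2) a(4) assms(3) a(6) assms(5)] a(8))
  qed
  have "(r \<odot>\<^bsub>msec SP U\<^esub> g) y = (\<Union>(V1, s1)\<in>germ T P y V s.
     germ T P y (U \<inter> V1) (rres A U (U \<inter> V1) r \<odot>\<^bsub>msec P (U \<inter> V1)\<^esub> mres P V1 (U \<inter> V1) s1))"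
    using y assms(3) s(3) by (auto simp: smult_sheafify)
  also have "\<dots> = (\<Union>p\<in>germ T P y V s. germ T P y V (rres A U V r \<odot>\<^bsub>msec P V\<^esub> s))"
    by (intro SUP_cong refl) (auto simp: eq)
  also have "\<dots> = germ T P y V (rres A U V r \<odot>\<^bsub>msec P V\<^esub> s)"
    using self_mem_germ[OF assms(2) y s(2)] by blast
  finally show "(r \<odot>\<^bsub>msec SP U\<^esub> g) y = germ T P y V (rres A U V r \<odot>\<^bsub>msec P V\<^esub> s)" .
qed (rule assms(2))

lemma sheafify_op_extensional [simp]:
  "\<zero>\<^bsub>msec SP U\<^esub> \<in> extensional U" "g \<oplus>\<^bsub>msec SP U\<^esub> h \<in> extensional U" "r \<odot>\<^bsub>msec SP U\<^esub> g \<in> extensional U"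
  by (simp_all add: zero_sheafify add_sheafify smult_sheafify)

lemma sheafify_zero_closed: "openin T U \<Longrightarrow> \<zero>\<^bsub>msec SP U\<^esub> \<in> carrier (msec SP U)"
  unfolding carrier_sheafify_iff using represents_zero by auto

lemma sheafify_add_closed:
  assumes "openin T U" "g \<in> carrier (msec SP U)" "h \<in> carrier (msec SP U)"
  shows "g \<oplus>\<^bsub>msec SP U\<^esub> h \<in> carrier (msec SP U)"
  unfolding carrier_sheafify_iff
proof (intro conjI ballI)
  fix x assume x: "x \<in> U"
  obtain V s t where "openin T V" "x \<in> V" "V \<subseteq> U" "V \<subseteq> U" "represents V g s" "represents V h t"
    using represented2[OF assms(1,1,2,3) x x] .
  then show "\<exists>V s. x \<in> V \<and> V \<subseteq> U \<and> represents V (g \<oplus>\<^bsub>msec SP U\<^esub> h) s"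
    using represents_add[of V U g s h t] by metis
qed simp

lemma sheafify_smult_closed:
  assumes "openin T U" "r \<in> carrier (rsec A U)" "g \<in> carrier (msec SP U)"
  shows "r \<odot>\<^bsub>msec SP U\<^esub> g \<in> carrier (msec SP U)"
  unfolding carrier_sheafify_iff
proof (intro conjI ballI)
  fix x assume x: "x \<in> U"
  obtain V s where "openin T V" "x \<in> V" "V \<subseteq> U" "represents V g s"
    using represented[OF assms(3) x] .
  then show "\<exists>V s. x \<in> V \<and> V \<subseteq> U \<and> represents V (r \<odot>\<^bsub>msec SP U\<^esub> g) s"
    using represents_smult[OF assms(1), of V g s r] assms(2) by metis
qed simp

text \<open>The local modules are the presheaf sections over open subsets of \<open>U\<close>. A
  common domain for three local representatives is the intersection of their domains.\<close>

lemma sheafify_module: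
  assumes U: "openin T U"
  shows "module (rsec A U) (msec SP U)"
proof (rule module_of_local_representatives[where I = U and J = "opens_in T U" and near = "(\<in>)"
      and S = "rsec A" and L = "msec P" and \<rho> = "rres A U" and rep = represents])
  show "\<exists>V\<in>opens_in T U. x \<in> V \<and> (\<exists>s t u. represents V g s \<and> represents V h t \<and> represents V k u)"
    if x: "x \<in> U" and g: "g \<in> carrier (msec SP U)" and h: "h \<in> carrier (msec SP U)" and k: "k \<in> carrier (msec SP U)"
    for x g h k
  proof -
    obtain V s t where V: "openin T V" "x \<in> V" "V \<subseteq> U" "V \<subseteq> U" "represents V g s" "represents V h t"
      using represented2[OF U U g h x x] .
    obtain W u where W: "openin T W" "x \<in> W" "W \<subseteq> U" "represents W k u" using represented[OF k x] .
    have "openin T (V \<inter> W)" using V W by blast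
    then show ?thesis
      using represents_res[OF V(5), of "V \<inter> W"] represents_res[OF V(6), of "V \<inter> W"]
        represents_res[OF W(4), of "V \<inter> W"] V W by (intro bexI[of _ "V \<inter> W"]) (auto simp: mem_opens_in)
  qed
  show "g = h" if "g \<in> carrier (msec SP U)" "h \<in> carrier (msec SP U)"
    "\<And>x. x \<in> U \<Longrightarrow> \<exists>V s. x \<in> V \<and> represents V g s \<and> represents V h s" for g h
    by (rule sheafify_eqI[OF sheafify_extensional[OF that(1)] sheafify_extensional[OF that(2)] that(3)])
qed (simp_all add: mem_opens_in U A_cring A_hom sec_module sheafify_zero_closed sheafify_add_closed
      sheafify_smult_closed representsD(2) represents_zero represents_add represents_smult)

lemma sheafify_restrict_closed:
  assumes "openin T U" "openin T V" "V \<subseteq> U" "g \<in> carrier (msec SP U)"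
  shows "restrict g V \<in> carrier (msec SP V)"
  unfolding carrier_sheafify_iff
proof (intro conjI ballI)
  fix x assume x: "x \<in> V"
  obtain W s where W: "openin T W" "x \<in> W" "W \<subseteq> U" "represents W g s"
    using represented[OF assms(4)] x assms(3) by blast
  have "openin T (V \<inter> W)" using W assms by auto
  then show "\<exists>W s. x \<in> W \<and> W \<subseteq> V \<and> represents W (restrict g V) s"
    using represents_restrict[OF represents_res[OF W(4), of "V \<inter> W"], of V] x W(2) by blast
qed simp

lemma presheaf_sheafify: "presheaf_of_modules T A SP"
  unfolding presheaf_of_modules_def mem_opens_in mres_sheafify
proof (intro conjI allI impI ballI; (elim conjE)?)
  fix U V g h assume U: "openin T U" and V: "openin T V" "V \<subseteq> U"
    and g: "g \<in> carrier (msec SP U)" and h: "h \<in> carrier (msec SP U)"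
  show "restrict (g \<oplus>\<^bsub>msec SP U\<^esub> h) V = restrict g V \<oplus>\<^bsub>msec SP V\<^esub> restrict h V"
  proof (rule sheafify_eqI)
    fix x assume x: "x \<in> V"
    obtain W s t where W: "openin T W" "x \<in> W" "W \<subseteq> U" "W \<subseteq> V" "represents W g s"
        "represents W (restrict h V) t"
      using represented2[OF U V(1) g sheafify_restrict_closed[OF U V h] subsetD[OF V(2) x] x] .
    note h' = W(6)[unfolded represents_restrict_iff[OF W(4)]]
    show "\<exists>W s. x \<in> W \<and> represents W (restrict (g \<oplus>\<^bsub>msec SP U\<^esub> h) V) s \<and>
       represents W (restrict g V \<oplus>\<^bsub>msec SP V\<^esub> restrict h V) s"
      using represents_restrict[OF represents_add[OF W(1,3,5) h'] W(4)]
        represents_add[OF W(1,4) represents_restrict[OF W(5,4)] W(6)] W(2) by metis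
  qed simp_all
next
  fix U V r g assume U: "openin T U" and V: "openin T V" "V \<subseteq> U"
    and r: "r \<in> carrier (rsec A U)" and g: "g \<in> carrier (msec SP U)"
  show "restrict (r \<odot>\<^bsub>msec SP U\<^esub> g) V = rres A U V r \<odot>\<^bsub>msec SP V\<^esub> restrict g V"
  proof (rule sheafify_eqI)
    fix x assume x: "x \<in> V"
    obtain W s where W: "openin T W" "x \<in> W" "W \<subseteq> V" "represents W (restrict g V) s"
      using represented[OF sheafify_restrict_closed[OF U V g] x] .
    note W' = W(4)[unfolded represents_restrict_iff[OF W(3)]]
    have "W \<subseteq> U" using W V by auto
    then show "\<exists>W s. x \<in> W \<and> represents W (restrict (r \<odot>\<^bsub>msec SP U\<^esub> g) V) s \<and>
       represents W (rres A U V r \<odot>\<^bsub>msec SP V\<^esub> restrict g V) s"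
      using represents_restrict[OF represents_smult[OF U W(1) _ W' r] W(3)]
        represents_smult[OF V(1) W(1,3,4) A_res_closed[OF U V r]]
        A_comp[OF U V(1) W(1) V(2) W(3) r] W(2) by metis
  qed simp_all
next
  fix U g assume "openin T U" "g \<in> carrier (msec SP U)"
  then show "restrict g U = g" by (intro extensional_restrict sheafify_extensional)
next
  fix U V W :: "'x set" and g :: "'x \<Rightarrow> ('x set \<times> 's) set" assume "V \<subseteq> U" "W \<subseteq> V"
  then show "restrict (restrict g V) W = restrict g W" by (simp add: restrict_restrict Int_absorb1)
qed (simp_all add: sheafify_module sheafify_restrict_closed)

abbreviation "toS \<equiv> to_sheafify T P"

lemma represents_to_sheafify:
  "openin T U \<Longrightarrow> s \<in> sec U \<Longrightarrow> represents U (toS U s) s"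
  by (simp add: represents_def to_sheafify_def)

lemma represents_imp_eq:
  "represents U g s \<Longrightarrow> g \<in> extensional U \<Longrightarrow> g = toS U s"
  by (rule extensionalityI[of _ U]) (auto simp: represents_def to_sheafify_def)

text \<open>Translates the condition on (V, s) in \<open>sheafify_lift\<close> into
  \<open>represents\<close>.\<close>

lemma restrict_eq_to_sheafify_iff:
  "openin T V \<Longrightarrow> s \<in> sec V \<Longrightarrow> restrict g V = toS V s \<longleftrightarrow> represents V g s"
  by (auto simp: represents_def to_sheafify_def fun_eq_iff restrict_def)

lemma to_sheafify_closed:
  "openin T U \<Longrightarrow> s \<in> sec U \<Longrightarrow> toS U s \<in> carrier (msec SP U)"
  unfolding carrier_sheafify_iff using represents_to_sheafify
  by (auto simp: to_sheafify_def)

lemma to_sheafify_additive: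
  assumes "openin T U"
  shows "toS U \<in> additive_maps (msec P U) (msec SP U)"
proof (rule additive_mapsI)
  fix s t assume "s \<in> sec U" "t \<in> sec U"
  then show "toS U (s \<oplus>\<^bsub>msec P U\<^esub> t) = toS U s \<oplus>\<^bsub>msec SP U\<^esub> toS U t"
    by (intro represents_imp_eq[symmetric] represents_add represents_to_sheafify assms) simp_all
qed (rule to_sheafify_closed[OF assms])

lemma to_sheafify_smult:
  assumes "openin T U" "r \<in> carrier (rsec A U)" "s \<in> sec U"
  shows "toS U (r \<odot>\<^bsub>msec P U\<^esub> s) = r \<odot>\<^bsub>msec SP U\<^esub> toS U s"
  using represents_imp_eq[OF represents_smult[OF assms(1,1) subset_refl represents_to_sheafify[OF assms(1,3)] assms(2)]]
    A_id[OF assms(1,2)] by simp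

lemma restrict_to_sheafify:
  assumes "openin T U" "openin T V" "V \<subseteq> U" "s \<in> sec U"
  shows "restrict (toS U s) V = toS V (mres P U V s)"
  using assms represents_res[OF represents_to_sheafify[OF assms(1,4)] assms(2,3)]
  by (simp add: restrict_eq_to_sheafify_iff res_closed)

end

section \<open>Sheaves of morphisms\<close>

lemma sheaf_homD:
  assumes "f \<in> sheaf_hom T A F G U" "openin T V" "V \<subseteq> U" "s \<in> carrier (msec F V)"
  shows sheaf_hom_closed: "f V s \<in> carrier (msec G V)"
    and sheaf_hom_add: "\<And>t. t \<in> carrier (msec F V) \<Longrightarrow> f V (s \<oplus>\<^bsub>msec F V\<^esub> t) = f V s \<oplus>\<^bsub>msec G V\<^esub> f V t"
    and sheaf_hom_smult: "\<And>r. r \<in> carrier (rsec A V) \<Longrightarrow> f V (r \<odot>\<^bsub>msec F V\<^esub> s) = r \<odot>\<^bsub>msec G V\<^esub> f V s"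
    and sheaf_hom_res: "\<And>W. openin T W \<Longrightarrow> W \<subseteq> V \<Longrightarrow> mres G V W (f V s) = f W (mres F V W s)"
  using assms by (auto simp: sheaf_hom_def module_hom_def mem_opens_in PiE_iff)

locale two_module_presheaves = F: module_presheaf_on T A F + G: module_presheaf_on T A G
  for T :: "'x topology" and A :: "('x, 'a) ring_presheaf"
    and F :: "('x, 'a, 's) module_presheaf" and G :: "('x, 'a, 't) module_presheaf"
begin

abbreviation "HFG \<equiv> Hom_sheaf T A F G"

lemma carrier_Hom: "carrier (msec HFG U) = sheaf_hom T A F G U"
  by (simp add: Hom_sheaf_def)

lemma sheaf_homI:
  assumes "\<And>V s. openin T V \<Longrightarrow> V \<subseteq> U \<Longrightarrow> s \<in> F.sec V \<Longrightarrow> f V s \<in> G.sec V"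
    and "\<And>V s t. openin T V \<Longrightarrow> V \<subseteq> U \<Longrightarrow> s \<in> F.sec V \<Longrightarrow> t \<in> F.sec V \<Longrightarrow>
          f V (s \<oplus>\<^bsub>msec F V\<^esub> t) = f V s \<oplus>\<^bsub>msec G V\<^esub> f V t"
    and "\<And>V r s. openin T V \<Longrightarrow> V \<subseteq> U \<Longrightarrow> r \<in> carrier (rsec A V) \<Longrightarrow> s \<in> F.sec V \<Longrightarrow>
          f V (r \<odot>\<^bsub>msec F V\<^esub> s) = r \<odot>\<^bsub>msec G V\<^esub> f V s"
    and "\<And>V W s. openin T V \<Longrightarrow> V \<subseteq> U \<Longrightarrow> openin T W \<Longrightarrow> W \<subseteq> V \<Longrightarrow> s \<in> F.sec V \<Longrightarrow>
          mres G V W (f V s) = f W (mres F V W s)"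
  shows "(\<lambda>V\<in>opens_in T U. \<lambda>s\<in>F.sec V. f V s) \<in> sheaf_hom T A F G U"
proof -
  have sub: "W \<in> opens_in T U" if "V \<in> opens_in T U" "W \<in> opens_in T V" for V W
    using that by (auto simp: mem_opens_in)
  show ?thesis
    unfolding sheaf_hom_def module_hom_def
    using assms sub F.res_closed
    by (auto simp: mem_opens_in)
qed

lemma sheaf_hom_eqI:
  assumes "f \<in> sheaf_hom T A F G U" "g \<in> sheaf_hom T A F G U"
    and "\<And>V s. openin T V \<Longrightarrow> V \<subseteq> U \<Longrightarrow> s \<in> F.sec V \<Longrightarrow> f V s = g V s"
  shows "f = g"
proof (rule PiE_ext)
  show "f \<in> (\<Pi>\<^sub>E V\<in>opens_in T U. module_hom (rsec A V) (msec F V) (msec G V))"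
    "g \<in> (\<Pi>\<^sub>E V\<in>opens_in T U. module_hom (rsec A V) (msec F V) (msec G V))"
    using assms(1,2) by (auto simp: sheaf_hom_def)
  fix V assume V: "V \<in> opens_in T U"
  show "f V = g V"
  proof (rule PiE_ext)
    show "f V \<in> F.sec V \<rightarrow>\<^sub>E G.sec V" "g V \<in> F.sec V \<rightarrow>\<^sub>E G.sec V"
      using assms(1,2) V by (auto simp: sheaf_hom_def module_hom_def)
  qed (use V assms(3) in \<open>auto simp: mem_opens_in\<close>)
qed

lemma Hom_ops:
  assumes "openin T V" "V \<subseteq> U" "s \<in> F.sec V"
  shows Hom_zero_apply: "\<zero>\<^bsub>msec HFG U\<^esub> V s = \<zero>\<^bsub>msec G V\<^esub>"
    and Hom_add_apply: "\<And>f g. (f \<oplus>\<^bsub>msec HFG U\<^esub> g) V s = f V s \<oplus>\<^bsub>msec G V\<^esub> g V s"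
    and Hom_smult_apply: "\<And>r f. (r \<odot>\<^bsub>msec HFG U\<^esub> f) V s = rres A U V r \<odot>\<^bsub>msec G V\<^esub> f V s"
    and Hom_res_apply: "\<And>f. mres HFG U' U f V s = f V s"
  using assms by (simp_all add: Hom_sheaf_def mem_opens_in)

lemma Hom_closed:
  assumes U: "openin T U"
  shows Hom_zero_closed: "\<zero>\<^bsub>msec HFG U\<^esub> \<in> sheaf_hom T A F G U"
    and Hom_add_closed: "\<And>f g. f \<in> sheaf_hom T A F G U \<Longrightarrow> g \<in> sheaf_hom T A F G U \<Longrightarrow>
          f \<oplus>\<^bsub>msec HFG U\<^esub> g \<in> sheaf_hom T A F G U"
    and Hom_smult_closed: "\<And>r f. r \<in> carrier (rsec A U) \<Longrightarrow> f \<in> sheaf_hom T A F G U \<Longrightarrow>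
          r \<odot>\<^bsub>msec HFG U\<^esub> f \<in> sheaf_hom T A F G U"
proof -
  have M: "module (rsec A V) (msec G V)" if "openin T V" for V using that by (rule G.sec_module)
  show "\<zero>\<^bsub>msec HFG U\<^esub> \<in> sheaf_hom T A F G U"
  proof -
    have "(\<lambda>V\<in>opens_in T U. \<lambda>s\<in>F.sec V. \<zero>\<^bsub>msec G V\<^esub>) \<in> sheaf_hom T A F G U"
    proof (rule sheaf_homI)
      fix V s t r assume V: "openin T V"
      interpret M: module "rsec A V" "msec G V" using M V by blast
      show "\<zero>\<^bsub>msec G V\<^esub> = \<zero>\<^bsub>msec G V\<^esub> \<oplus>\<^bsub>msec G V\<^esub> \<zero>\<^bsub>msec G V\<^esub>" by simp
      show "\<zero>\<^bsub>msec G V\<^esub> = r \<odot>\<^bsub>msec G V\<^esub> \<zero>\<^bsub>msec G V\<^esub>" if "r \<in> carrier (rsec A V)" using that by simp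
    qed (simp_all add: G.res_zero)
    then show ?thesis by (simp add: Hom_sheaf_def)
  qed
  fix f g assume f: "f \<in> sheaf_hom T A F G U"
  note fD = sheaf_homD[OF f]
  show "f \<oplus>\<^bsub>msec HFG U\<^esub> g \<in> sheaf_hom T A F G U" if g: "g \<in> sheaf_hom T A F G U"
  proof -
    note gD = sheaf_homD[OF g]
    have "(\<lambda>V\<in>opens_in T U. \<lambda>s\<in>F.sec V. f V s \<oplus>\<^bsub>msec G V\<^esub> g V s) \<in> sheaf_hom T A F G U"
    proof (rule sheaf_homI)
      fix V s t r assume V: "openin T V" "V \<subseteq> U" and s: "s \<in> F.sec V"
      interpret M: module "rsec A V" "msec G V" using M V by blast
      note cl = fD(1)[OF V s] gD(1)[OF V s]
      show "f V (s \<oplus>\<^bsub>msec F V\<^esub> t) \<oplus>\<^bsub>msec G V\<^esub> g V (s \<oplus>\<^bsub>msec F V\<^esub> t)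
          = f V s \<oplus>\<^bsub>msec G V\<^esub> g V s \<oplus>\<^bsub>msec G V\<^esub> (f V t \<oplus>\<^bsub>msec G V\<^esub> g V t)"
        if t: "t \<in> F.sec V"
        using fD(2)[OF V s t] gD(2)[OF V s t] cl fD(1)[OF V t] gD(1)[OF V t]
        by (simp add: M.a_ac)
      show "f V (r \<odot>\<^bsub>msec F V\<^esub> s) \<oplus>\<^bsub>msec G V\<^esub> g V (r \<odot>\<^bsub>msec F V\<^esub> s) = r \<odot>\<^bsub>msec G V\<^esub> (f V s \<oplus>\<^bsub>msec G V\<^esub> g V s)"
        if r: "r \<in> carrier (rsec A V)"
        using fD(3)[OF V s r] gD(3)[OF V s r] cl r by (simp add: M.smult_r_distr)
      show "mres G V W (f V s \<oplus>\<^bsub>msec G V\<^esub> g V s) = f W (mres F V W s) \<oplus>\<^bsub>msec G W\<^esub> g W (mres F V W s)"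
        if "openin T W" "W \<subseteq> V" for W
        using fD(4)[OF V s that] gD(4)[OF V s that] cl V that by (simp add: G.res_add)
    qed (use fD(1) gD(1) in simp)
    then show ?thesis by (simp add: Hom_sheaf_def)
  qed
  show "r \<odot>\<^bsub>msec HFG U\<^esub> f \<in> sheaf_hom T A F G U" if r: "r \<in> carrier (rsec A U)" for r
  proof -
    have "(\<lambda>V\<in>opens_in T U. \<lambda>s\<in>F.sec V. rres A U V r \<odot>\<^bsub>msec G V\<^esub> f V s) \<in> sheaf_hom T A F G U"
    proof (rule sheaf_homI)
      fix V s t q assume V: "openin T V" "V \<subseteq> U" and s: "s \<in> F.sec V"
      interpret M: module "rsec A V" "msec G V" using M V by blast
      note rV = F.A_res_closed[OF U V r]
      show "rres A U V r \<odot>\<^bsub>msec G V\<^esub> f V (s \<oplus>\<^bsub>msec F V\<^esub> t)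
          = rres A U V r \<odot>\<^bsub>msec G V\<^esub> f V s \<oplus>\<^bsub>msec G V\<^esub> rres A U V r \<odot>\<^bsub>msec G V\<^esub> f V t"
        if t: "t \<in> F.sec V"
        using fD(2)[OF V s t] fD(1)[OF V s] fD(1)[OF V t] rV by (simp add: M.smult_r_distr)
      show "rres A U V r \<odot>\<^bsub>msec G V\<^esub> f V (q \<odot>\<^bsub>msec F V\<^esub> s) = q \<odot>\<^bsub>msec G V\<^esub> (rres A U V r \<odot>\<^bsub>msec G V\<^esub> f V s)"
        if q: "q \<in> carrier (rsec A V)"
        \<comment> \<open>Linearity of the multiple of a morphism by a scalar uses commutativity of
          the ring, to move q past the scalar.\<close>
        using fD(3)[OF V s q] fD(1)[OF V s] rV q by (simp add: M.smult_assoc1[symmetric] M.R.m_comm)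
      show "mres G V W (rres A U V r \<odot>\<^bsub>msec G V\<^esub> f V s) = rres A U W r \<odot>\<^bsub>msec G W\<^esub> f W (mres F V W s)"
        if W: "openin T W" "W \<subseteq> V" for W
        using fD(4)[OF V s W] fD(1)[OF V s] V W rV F.A_comp[OF U V(1) W(1) V(2) W(2) r]
        by (simp add: G.res_smult)
    qed (use fD(1) F.A_res_closed[OF U _ _ r] in simp)
    then show ?thesis by (simp add: Hom_sheaf_def)
  qed
qed

text \<open>The local modules are indexed by pairs (V, s) of an open set and a section over it, and
  a morphism is represented there by its value \<open>f V s\<close>; the axioms thus hold value by
  value. Separation tests every pair, hence \<open>near\<close> is equality.\<close>

lemma Hom_module:
  assumes U: "openin T U"
  shows "module (rsec A U) (msec HFG U)"
proof (rule module_of_local_representatives[where I = "SIGMA V:opens_in T U. F.sec V"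
      and J = "SIGMA V:opens_in T U. F.sec V" and near = "(=)" and S = "\<lambda>(V, s). rsec A V"
      and L = "\<lambda>(V, s). msec G V" and \<rho> = "\<lambda>(V, s). rres A U V"
      and rep = "\<lambda>(V, s) f t. f V s = t \<and> t \<in> G.sec V"], unfold carrier_Hom)
  show "\<exists>j\<in>SIGMA V:opens_in T U. F.sec V. x = j \<and> (\<exists>s t u.
      (case j of (V, s) \<Rightarrow> \<lambda>f t. f V s = t \<and> t \<in> G.sec V) f s \<and>
      (case j of (V, s) \<Rightarrow> \<lambda>f t. f V s = t \<and> t \<in> G.sec V) g t \<and>
      (case j of (V, s) \<Rightarrow> \<lambda>f t. f V s = t \<and> t \<in> G.sec V) h u)"
    if "x \<in> (SIGMA V:opens_in T U. F.sec V)" "f \<in> sheaf_hom T A F G U" "g \<in> sheaf_hom T A F G U"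
      "h \<in> sheaf_hom T A F G U" for x f g h
    using that sheaf_hom_closed by (auto simp: mem_opens_in)
  show "f = g" if "f \<in> sheaf_hom T A F G U" "g \<in> sheaf_hom T A F G U"
    "\<And>x. x \<in> (SIGMA V:opens_in T U. F.sec V) \<Longrightarrow> \<exists>j s. x = j \<and>
      (case j of (V, s) \<Rightarrow> \<lambda>f t. f V s = t \<and> t \<in> G.sec V) f s \<and>
      (case j of (V, s) \<Rightarrow> \<lambda>f t. f V s = t \<and> t \<in> G.sec V) g s" for f g
    by (rule sheaf_hom_eqI[OF that(1,2)]) (use that(3) in \<open>fastforce simp: mem_opens_in\<close>)
qed (auto simp: mem_opens_in U F.A_cring F.A_hom F.A_res_closed G.sec_module Hom_ops Hom_closed[OF U])

lemma Hom_res: "mres HFG U V f = restrict f (opens_in T V)"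
  by (simp add: Hom_sheaf_def)

lemma Hom_res_closed:
  assumes "openin T U" "openin T V" "V \<subseteq> U" "f \<in> sheaf_hom T A F G U"
  shows "mres HFG U V f \<in> sheaf_hom T A F G V"
proof -
  have 1: "Z \<in> opens_in T V" if "W \<in> opens_in T V" "Z \<in> opens_in T W" for W Z
    using that unfolding mem_opens_in by blast
  have 2: "W \<in> opens_in T U" if "W \<in> opens_in T V" for W
    using assms(3) that unfolding mem_opens_in by blast
  show ?thesis
    using assms(4) 1 2 unfolding Hom_res sheaf_hom_def by (simp add: PiE_iff)
qed

lemma presheaf_Hom: "presheaf_of_modules T A HFG"
  unfolding presheaf_of_modules_def mem_opens_in carrier_Hom
proof (intro conjI allI impI ballI; (elim conjE)?)
  fix U V f g assume U: "openin T U" and V: "openin T V" "V \<subseteq> U"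
    and f: "f \<in> sheaf_hom T A F G U" and g: "g \<in> sheaf_hom T A F G U"
  show "mres HFG U V (f \<oplus>\<^bsub>msec HFG U\<^esub> g) = mres HFG U V f \<oplus>\<^bsub>msec HFG V\<^esub> mres HFG U V g"
  proof (rule sheaf_hom_eqI)
    fix W s assume W: "openin T W" "W \<subseteq> V" and s: "s \<in> F.sec W"
    then show "mres HFG U V (f \<oplus>\<^bsub>msec HFG U\<^esub> g) W s = (mres HFG U V f \<oplus>\<^bsub>msec HFG V\<^esub> mres HFG U V g) W s"
      using V(2) by (simp add: Hom_ops[OF W s] Hom_add_apply[OF W(1) _ s])
  qed (use U V f g in \<open>simp_all add: Hom_res_closed Hom_add_closed\<close>)
next
  fix U V r f assume U: "openin T U" and V: "openin T V" "V \<subseteq> U"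
    and f: "f \<in> sheaf_hom T A F G U" and r: "r \<in> carrier (rsec A U)"
  show "mres HFG U V (r \<odot>\<^bsub>msec HFG U\<^esub> f) = rres A U V r \<odot>\<^bsub>msec HFG V\<^esub> mres HFG U V f"
  proof (rule sheaf_hom_eqI)
    fix W s assume W: "openin T W" "W \<subseteq> V" and s: "s \<in> F.sec W"
    then show "mres HFG U V (r \<odot>\<^bsub>msec HFG U\<^esub> f) W s = (rres A U V r \<odot>\<^bsub>msec HFG V\<^esub> mres HFG U V f) W s"
      using V(2) F.A_comp[OF U V(1) W(1) V(2) W(2) r] by (simp add: Hom_ops[OF W s] Hom_smult_apply[OF W(1) _ s])
  qed (use U V f r in \<open>simp_all add: Hom_res_closed Hom_smult_closed F.A_res_closed\<close>)
next
  fix U f assume U: "openin T U" and f: "f \<in> sheaf_hom T A F G U"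
  show "mres HFG U U f = f"
    by (rule sheaf_hom_eqI[OF Hom_res_closed[OF U U subset_refl f] f Hom_res_apply])
next
  fix U V W f
  assume U: "openin T U" and V: "openin T V" "V \<subseteq> U" and W: "openin T W" "W \<subseteq> V"
    and f: "f \<in> sheaf_hom T A F G U"
  show "mres HFG V W (mres HFG U V f) = mres HFG U W f"
  proof (rule sheaf_hom_eqI)
    show "mres HFG V W (mres HFG U V f) \<in> sheaf_hom T A F G W"
      by (rule Hom_res_closed[OF V(1) W Hom_res_closed[OF U V f]])
    show "mres HFG U W f \<in> sheaf_hom T A F G W"
      by (rule Hom_res_closed[OF U W(1) subset_trans[OF W(2) V(2)] f])
    fix Z s assume Z: "openin T Z" "Z \<subseteq> W" "s \<in> F.sec Z"
    show "mres HFG V W (mres HFG U V f) Z s = mres HFG U W f Z s"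
      by (simp only: Hom_res_apply[OF Z] Hom_res_apply[OF Z(1) subset_trans[OF Z(2) W(2)] Z(3)])
  qed
qed (simp_all add: Hom_module Hom_res_closed)

end

section \<open>The tensor product presheaf\<close>

context two_module_presheaves
begin

abbreviation "TP \<equiv> tensor_presheaf A F G"
abbreviation "pureT U \<equiv> pure_tensor (rsec A U) (msec F U) (msec G U)"

lemma msec_tensor: "msec TP U = tensor_module (rsec A U) (msec F U) (msec G U)"
  by (simp add: tensor_presheaf_def)

lemma tensor_pair: "openin T U \<Longrightarrow> tensor_pair (rsec A U) (msec F U) (msec G U)"
  by (simp add: tensor_pair_def F.sec_module G.sec_module)

lemma tensor_eqI:
  assumes "openin T U" "abelian_group N" "h \<in> additive_maps (msec TP U) N" "k \<in> additive_maps (msec TP U) N"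
    and "\<And>x y. x \<in> F.sec U \<Longrightarrow> y \<in> G.sec U \<Longrightarrow> h (pureT U x y) = k (pureT U x y)"
    and "t \<in> carrier (msec TP U)"
  shows "h t = k t"
  using tensor_pair.additive_maps_tensor_eqI[OF tensor_pair[OF assms(1)] assms(2)] assms(3-6)
  unfolding msec_tensor by metis

lemma pureT_closed:
  "openin T U \<Longrightarrow> x \<in> F.sec U \<Longrightarrow> y \<in> G.sec U \<Longrightarrow> pureT U x y \<in> carrier (msec TP U)"
  unfolding msec_tensor by (rule tensor_pair.pure_closed[OF tensor_pair])

lemma res_tensor:
  assumes "openin T U" "openin T V" "V \<subseteq> U"
  shows res_tensor_additive: "mres TP U V \<in> additive_maps (msec TP U) (msec TP V)"
    and res_tensor_pure: "\<And>x y. x \<in> F.sec U \<Longrightarrow> y \<in> G.sec U \<Longrightarrow>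
          mres TP U V (pureT U x y) = pureT V (mres F U V x) (mres G U V y)"
    and res_tensor_smult: "\<And>r t. r \<in> carrier (rsec A U) \<Longrightarrow> t \<in> carrier (msec TP U) \<Longrightarrow>
          mres TP U V (r \<odot>\<^bsub>msec TP U\<^esub> t) = rres A U V r \<odot>\<^bsub>msec TP V\<^esub> mres TP U V t"
proof -
  note m = F.sec_module[OF assms(1)] G.sec_module[OF assms(1)] F.sec_module[OF assms(2)] G.sec_module[OF assms(2)]
    F.res_additive[OF assms] G.res_additive[OF assms] F.A_res_closed[OF assms] F.res_smult[OF assms] G.res_smult[OF assms]
  have res: "mres TP U V = tensor_lift (tensor_module (rsec A V) (msec F V) (msec G V))
        (\<lambda>(x, y). pure_tensor (rsec A V) (msec F V) (msec G V) (mres F U V x) (mres G U V y))"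
    by (simp add: tensor_presheaf_def)
  show "mres TP U V \<in> additive_maps (msec TP U) (msec TP V)"
    unfolding res msec_tensor by (rule tensor_map_additive[OF m])
  show "mres TP U V (pureT U x y) = pureT V (mres F U V x) (mres G U V y)"
    if "x \<in> F.sec U" "y \<in> G.sec U" for x y
    unfolding res by (rule tensor_map_pure[OF m that])
  show "mres TP U V (r \<odot>\<^bsub>msec TP U\<^esub> t) = rres A U V r \<odot>\<^bsub>msec TP V\<^esub> mres TP U V t"
    if "r \<in> carrier (rsec A U)" "t \<in> carrier (msec TP U)" for r t
    unfolding res msec_tensor
    by (rule tensor_map_smult[OF m]) (use that in \<open>simp_all add: msec_tensor\<close>)
qed

lemma presheaf_tensor: "presheaf_of_modules T A TP"
  unfolding presheaf_of_modules_def mem_opens_in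
proof (intro conjI allI impI ballI; (elim conjE)?)
  fix U assume U: "openin T U"
  show M: "module (rsec A U) (msec TP U)"
    unfolding msec_tensor by (rule tensor_pair.tensor_is_module[OF tensor_pair[OF U]])
  have id: "(\<lambda>s. s) \<in> additive_maps (msec TP U) (msec TP U)" by (simp add: additive_maps_def)
  show "mres TP U U s = s" if s: "s \<in> carrier (msec TP U)" for s
    by (rule tensor_eqI[OF U module.axioms(2)[OF M] res_tensor_additive[OF U U subset_refl] id _ s])
      (simp add: res_tensor_pure[OF U U subset_refl] F.res_id[OF U] G.res_id[OF U])
next
  fix U V W s assume U: "openin T U" and V: "openin T V" "V \<subseteq> U" and W: "openin T W" "W \<subseteq> V"
    and s: "s \<in> carrier (msec TP U)"
  have WU: "W \<subseteq> U" using V W by auto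
  have M: "abelian_group (msec TP W)"
    unfolding msec_tensor by (rule tensor_pair.tensor_abelian_group[OF tensor_pair[OF W(1)]])
  show "mres TP V W (mres TP U V s) = mres TP U W s"
    by (rule tensor_eqI[OF U M additive_maps_comp[OF res_tensor_additive[OF U V] res_tensor_additive[OF V(1) W]]
          res_tensor_additive[OF U W(1) WU] _ s])
      (simp add: res_tensor_pure[OF U V] res_tensor_pure[OF V(1) W] res_tensor_pure[OF U W(1) WU]
         F.res_closed[OF U V] G.res_closed[OF U V] F.res_res[OF U V(1) W(1) V(2) W(2)] G.res_res[OF U V(1) W(1) V(2) W(2)])
qed (auto simp: additive_maps_closed[OF res_tensor_additive] additive_maps_add[OF res_tensor_additive] res_tensor_smult)

end

section \<open>Contraction of a presheaf tensor with a section\<close>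

locale contraction_data = Om: module_presheaf_on T A \<Omega> + F: module_presheaf_on T A F
  for T :: "'x topology" and A :: "('x, 'a) ring_presheaf"
    and \<Omega> :: "('x, 'a, 'w) module_presheaf" and F :: "('x, 'a, 's) module_presheaf"
begin

sublocale FF: two_module_presheaves T A F F ..

abbreviation "H \<equiv> Hom_sheaf T A F F"

sublocale H: module_presheaf_on T A H
  by unfold_locales (rule FF.presheaf_Hom)

sublocale OF: two_module_presheaves T A \<Omega> F ..
sublocale OH: two_module_presheaves T A \<Omega> H ..

abbreviation "Q \<equiv> tensor_presheaf A \<Omega> F"
abbreviation "P \<equiv> tensor_presheaf A \<Omega> H"

sublocale Q: module_presheaf_on T A Q
  by unfold_locales (rule OF.presheaf_tensor)
sublocale P: module_presheaf_on T A P
  by unfold_locales (rule OH.presheaf_tensor)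

abbreviation "QS \<equiv> sheafify T A Q"
abbreviation "PS \<equiv> sheafify T A P"

sublocale QS: module_presheaf_on T A QS
  by unfold_locales (rule Q.presheaf_sheafify)
sublocale PS: module_presheaf_on T A PS
  by unfold_locales (rule P.presheaf_sheafify)

sublocale FQ: two_module_presheaves T A F QS ..

abbreviation "HQ \<equiv> Hom_sheaf T A F QS"

sublocale HQ: module_presheaf_on T A HQ
  by unfold_locales (rule FQ.presheaf_Hom)

lemma carrier_H: "H.sec U = sheaf_hom T A F F U"
  by (rule FF.carrier_Hom)

text \<open>The contraction evaluated at one fixed section \<open>\<sigma>\<close> over
  \<open>W\<close>, before sheafification. With \<open>\<sigma>\<close> fixed it is a map from one
  tensor module to another, to which the universal property applies.\<close>

definition contract :: "'x set \<Rightarrow> 'x set \<Rightarrow> 's \<Rightarrow>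
    ('w \<times> ('x set \<Rightarrow> 's \<Rightarrow> 's) \<Rightarrow>\<^sub>0 int) set \<Rightarrow> ('w \<times> 's \<Rightarrow>\<^sub>0 int) set" where
  "contract U W \<sigma> = tensor_lift (tensor_module (rsec A W) (msec \<Omega> W) (msec F W))
     (\<lambda>(\<alpha>, f). pure_tensor (rsec A W) (msec \<Omega> W) (msec F W) (mres \<Omega> U W \<alpha>) (f W \<sigma>))"

text \<open>The tensor product of the restriction of \<Omega> from \<open>U\<close> to
  \<open>W\<close> with the evaluation of endomorphisms at \<open>\<sigma>\<close>, both semilinear
  over the restriction of the ring.\<close>

lemma contract:
  assumes "openin T U" "openin T W" "W \<subseteq> U" "\<sigma> \<in> F.sec W"
  shows contract_additive: "contract U W \<sigma> \<in> additive_maps (msec P U) (msec Q W)"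
    and contract_pure: "\<And>\<alpha> f. \<alpha> \<in> Om.sec U \<Longrightarrow> f \<in> H.sec U \<Longrightarrow>
          contract U W \<sigma> (OH.pureT U \<alpha> f) = OF.pureT W (mres \<Omega> U W \<alpha>) (f W \<sigma>)"
    and contract_smult: "\<And>r t. r \<in> carrier (rsec A U) \<Longrightarrow> t \<in> P.sec U \<Longrightarrow>
          contract U W \<sigma> (r \<odot>\<^bsub>msec P U\<^esub> t) = rres A U W r \<odot>\<^bsub>msec Q W\<^esub> contract U W \<sigma> t"
proof -
  have ev: "(\<lambda>f. f W \<sigma>) \<in> additive_maps (msec H U) (msec F W)"
  proof (rule additive_mapsI)
    show "f W \<sigma> \<in> F.sec W" if "f \<in> H.sec U" for f
      by (rule sheaf_hom_closed[OF that[unfolded carrier_H] assms(2-4)])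
  qed (rule FF.Hom_add_apply[OF assms(2-4)])
  have evs: "(r \<odot>\<^bsub>msec H U\<^esub> f) W \<sigma> = rres A U W r \<odot>\<^bsub>msec F W\<^esub> f W \<sigma>" for r f
    by (rule FF.Hom_smult_apply[OF assms(2-4)])
  note m = Om.sec_module[OF assms(1)] H.sec_module[OF assms(1)] Om.sec_module[OF assms(2)] F.sec_module[OF assms(2)]
    Om.res_additive[OF assms(1-3)] ev Om.A_res_closed[OF assms(1-3)] Om.res_smult[OF assms(1-3)] evs
  show "contract U W \<sigma> \<in> additive_maps (msec P U) (msec Q W)"
    unfolding contract_def OF.msec_tensor OH.msec_tensor by (rule tensor_map_additive[where f = "mres \<Omega> U W" and g = "\<lambda>f. f W \<sigma>" and \<rho> = "rres A U W", OF m])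
  show "contract U W \<sigma> (OH.pureT U \<alpha> f) = OF.pureT W (mres \<Omega> U W \<alpha>) (f W \<sigma>)"
    if "\<alpha> \<in> Om.sec U" "f \<in> H.sec U" for \<alpha> f
    unfolding contract_def by (rule tensor_map_pure[where f = "mres \<Omega> U W" and g = "\<lambda>f. f W \<sigma>" and \<rho> = "rres A U W", OF m that])
  show "contract U W \<sigma> (r \<odot>\<^bsub>msec P U\<^esub> t) = rres A U W r \<odot>\<^bsub>msec Q W\<^esub> contract U W \<sigma> t"
    if "r \<in> carrier (rsec A U)" "t \<in> P.sec U" for r t
    unfolding contract_def OF.msec_tensor OH.msec_tensor
    by (rule tensor_map_smult[where f = "mres \<Omega> U W" and g = "\<lambda>f. f W \<sigma>" and \<rho> = "rres A U W", OF m]) (use that in \<open>simp_all add: OH.msec_tensor\<close>)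
qed

lemmas contract_closed = additive_maps_closed[OF contract_additive]
lemmas contract_add = additive_maps_add[OF contract_additive]

text \<open>Contraction with a section over \<open>W\<close> sees only the restriction of the tensor
  to \<open>W\<close>. This is how representatives over different sets are compared.\<close>

lemma contract_res_left:
  assumes U: "openin T U" and V: "openin T V" "V \<subseteq> U" and W: "openin T W" "W \<subseteq> V"
    and \<sigma>: "\<sigma> \<in> F.sec W" and s: "s \<in> P.sec U"
  shows "contract V W \<sigma> (mres P U V s) = contract U W \<sigma> s"
proof -
  have WU: "W \<subseteq> U" using V W by auto
  show ?thesis
    by (rule OH.tensor_eqI[OF U Q.sec_abelian_group[OF W(1)]
        additive_maps_comp[OF P.res_additive[OF U V] contract_additive[OF V(1) W \<sigma>]]
        contract_additive[OF U W(1) WU \<sigma>] _ s])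
      (simp add: OH.res_tensor_pure[OF U V] contract_pure[OF V(1) W \<sigma>] contract_pure[OF U W(1) WU \<sigma>]
        Om.res_closed[OF U V] H.res_closed[OF U V] Om.res_res[OF U V(1) W(1) V(2) W(2)] FF.Hom_res_apply[OF W \<sigma>])
qed

text \<open>Naturality in \<open>\<sigma>\<close>, from naturality of the endomorphisms in the
  second tensor factor. It makes the contracted family compatible with restriction.\<close>

lemma contract_res_right:
  assumes U: "openin T U" and W: "openin T W" "W \<subseteq> U" and Z: "openin T Z" "Z \<subseteq> W"
    and \<sigma>: "\<sigma> \<in> F.sec W" and s: "s \<in> P.sec U"
  shows "mres Q W Z (contract U W \<sigma> s) = contract U Z (mres F W Z \<sigma>) s"
proof -
  have ZU: "Z \<subseteq> U" using W Z by auto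
  note \<sigma>Z = F.res_closed[OF W(1) Z \<sigma>]
  show ?thesis
  proof (rule OH.tensor_eqI[OF U Q.sec_abelian_group[OF Z(1)]
        additive_maps_comp[OF contract_additive[OF U W \<sigma>] Q.res_additive[OF W(1) Z]]
        contract_additive[OF U Z(1) ZU \<sigma>Z] _ s])
    fix \<alpha> f assume \<alpha>: "\<alpha> \<in> Om.sec U" and f: "f \<in> H.sec U"
    note f' = f[unfolded carrier_H]
    show "mres Q W Z (contract U W \<sigma> (OH.pureT U \<alpha> f)) = contract U Z (mres F W Z \<sigma>) (OH.pureT U \<alpha> f)"
      by (simp add: contract_pure[OF U W \<sigma> \<alpha> f] contract_pure[OF U Z(1) ZU \<sigma>Z \<alpha> f]
          OF.res_tensor_pure[OF W(1) Z Om.res_closed[OF U W \<alpha>] sheaf_hom_closed[OF f' W \<sigma>]]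
          Om.res_res[OF U W(1) Z(1) W(2) Z(2) \<alpha>] sheaf_hom_res[OF f' W \<sigma> Z])
  qed
qed

text \<open>Here \<open>\<sigma>\<close> varies, so this is not additivity of a fixed
  \<open>contract\<close>. Both sides are additive in the tensor, and on
  \<open>\<alpha> \<otimes> f\<close> the claim is additivity of f together with that of the second
  tensor factor.\<close>

lemma contract_add_section:
  assumes U: "openin T U" and W: "openin T W" "W \<subseteq> U"
    and \<sigma>: "\<sigma> \<in> F.sec W" and \<tau>: "\<tau> \<in> F.sec W" and s: "s \<in> P.sec U"
  shows "contract U W (\<sigma> \<oplus>\<^bsub>msec F W\<^esub> \<tau>) s = contract U W \<sigma> s \<oplus>\<^bsub>msec Q W\<^esub> contract U W \<tau> s"
proof -
  interpret WP: tensor_pair "rsec A W" "msec \<Omega> W" "msec F W" by (rule OF.tensor_pair[OF W(1)])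
  have \<sigma>\<tau>: "\<sigma> \<oplus>\<^bsub>msec F W\<^esub> \<tau> \<in> F.sec W" using W \<sigma> \<tau> by simp
  show ?thesis
  proof (rule OH.tensor_eqI[OF U Q.sec_abelian_group[OF W(1)] contract_additive[OF U W \<sigma>\<tau>]
        additive_maps_plus[OF Q.sec_abelian_group[OF W(1)] contract_additive[OF U W \<sigma>] contract_additive[OF U W \<tau>]] _ s])
    fix \<alpha> f assume \<alpha>: "\<alpha> \<in> Om.sec U" and f: "f \<in> H.sec U"
    note f' = f[unfolded carrier_H]
    show "contract U W (\<sigma> \<oplus>\<^bsub>msec F W\<^esub> \<tau>) (OH.pureT U \<alpha> f)
        = contract U W \<sigma> (OH.pureT U \<alpha> f) \<oplus>\<^bsub>msec Q W\<^esub> contract U W \<tau> (OH.pureT U \<alpha> f)"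
      using WP.pure_add_right[OF Om.res_closed[OF U W \<alpha>] sheaf_hom_closed[OF f' W \<sigma>] sheaf_hom_closed[OF f' W \<tau>]]
      by (simp add: contract_pure[OF U W _ \<alpha> f] \<sigma> \<tau> \<sigma>\<tau> sheaf_hom_add[OF f' W \<sigma> \<tau>] OF.msec_tensor)
  qed
qed

lemma contract_smult_section:
  assumes U: "openin T U" and W: "openin T W" "W \<subseteq> U"
    and r: "r \<in> carrier (rsec A W)" and \<sigma>: "\<sigma> \<in> F.sec W" and s: "s \<in> P.sec U"
  shows "contract U W (r \<odot>\<^bsub>msec F W\<^esub> \<sigma>) s = r \<odot>\<^bsub>msec Q W\<^esub> contract U W \<sigma> s"
proof -
  interpret WP: tensor_pair "rsec A W" "msec \<Omega> W" "msec F W" by (rule OF.tensor_pair[OF W(1)])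
  have r\<sigma>: "r \<odot>\<^bsub>msec F W\<^esub> \<sigma> \<in> F.sec W" using W \<sigma> r by simp
  have sm: "(\<lambda>t. r \<odot>\<^bsub>msec Q W\<^esub> t) \<in> additive_maps (msec Q W) (msec Q W)"
    unfolding OF.msec_tensor by (rule WP.smult_tensor_additive[OF r])
  show ?thesis
  proof (rule OH.tensor_eqI[OF U Q.sec_abelian_group[OF W(1)] contract_additive[OF U W r\<sigma>]
        additive_maps_comp[OF contract_additive[OF U W \<sigma>] sm] _ s])
    fix \<alpha> f assume \<alpha>: "\<alpha> \<in> Om.sec U" and f: "f \<in> H.sec U"
    note f' = f[unfolded carrier_H]
    show "contract U W (r \<odot>\<^bsub>msec F W\<^esub> \<sigma>) (OH.pureT U \<alpha> f)
        = r \<odot>\<^bsub>msec Q W\<^esub> contract U W \<sigma> (OH.pureT U \<alpha> f)"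
      using WP.smult_pure_right[OF r Om.res_closed[OF U W \<alpha>] sheaf_hom_closed[OF f' W \<sigma>]]
      by (simp add: contract_pure[OF U W _ \<alpha> f] \<sigma> r\<sigma> sheaf_hom_smult[OF f' W \<sigma> r] OF.msec_tensor)
  qed
qed

lemma contract_sheaf_hom:
  assumes U: "openin T U" and p: "p \<in> P.sec U"
  shows "(\<lambda>V\<in>opens_in T U. \<lambda>\<sigma>\<in>F.sec V. Q.toS V (contract U V \<sigma> p)) \<in> sheaf_hom T A F QS U"
proof (rule FQ.sheaf_homI)
  fix V \<sigma> assume V: "openin T V" "V \<subseteq> U" and \<sigma>: "\<sigma> \<in> F.sec V"
  note cl = contract_closed[OF U V _ p]
  show "Q.toS V (contract U V \<sigma> p) \<in> QS.sec V"
    by (rule Q.to_sheafify_closed[OF V(1) cl[OF \<sigma>]])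
  show "Q.toS V (contract U V (\<sigma> \<oplus>\<^bsub>msec F V\<^esub> \<tau>) p)
      = Q.toS V (contract U V \<sigma> p) \<oplus>\<^bsub>msec QS V\<^esub> Q.toS V (contract U V \<tau> p)"
    if \<tau>: "\<tau> \<in> F.sec V" for \<tau>
    unfolding contract_add_section[OF U V \<sigma> \<tau> p]
    by (rule additive_maps_add[OF Q.to_sheafify_additive[OF V(1)] cl[OF \<sigma>] cl[OF \<tau>]])
  show "Q.toS V (contract U V (r \<odot>\<^bsub>msec F V\<^esub> \<sigma>) p) = r \<odot>\<^bsub>msec QS V\<^esub> Q.toS V (contract U V \<sigma> p)"
    if r: "r \<in> carrier (rsec A V)" for r
    unfolding contract_smult_section[OF U V r \<sigma> p]
    by (rule Q.to_sheafify_smult[OF V(1) r cl[OF \<sigma>]])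
  show "mres QS V W (Q.toS V (contract U V \<sigma> p)) = Q.toS W (contract U W (mres F V W \<sigma>) p)"
    if W: "openin T W" "W \<subseteq> V" for W
    unfolding Q.mres_sheafify Q.restrict_to_sheafify[OF V(1) W cl[OF \<sigma>]]
      contract_res_right[OF U V W \<sigma> p] ..
qed

text \<open>The definition lifts once into the module of morphisms, whereas \<open>contract\<close>
  lifts separately for every \<open>\<sigma>\<close>. The family of the separate lifts is additive
  in the tensor and has the prescribed values on pure tensors, so it is the single lift.\<close>

lemma contraction_presheaf_eq:
  assumes U: "openin T U" and s: "s \<in> P.sec U"
  shows "contraction_presheaf T A \<Omega> F U s =
    (\<lambda>V\<in>opens_in T U. \<lambda>\<sigma>\<in>F.sec V. Q.toS V (contract U V \<sigma> s))" (is "_ = ?c s")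
  unfolding contraction_presheaf_def tensor_sheaf_def
proof (rule tensor_pair.tensor_lift_eq[OF OH.tensor_pair[OF U] HQ.sec_abelian_group[OF U]])
  note cl = contract_sheaf_hom[OF U]
  show "?c \<in> additive_maps (tensor_module (rsec A U) (msec \<Omega> U) (msec H U)) (msec HQ U)"
    unfolding OH.msec_tensor[symmetric]
  proof (rule additive_mapsI)
    show "?c s \<in> carrier (msec HQ U)" if "s \<in> P.sec U" for s
      unfolding FQ.carrier_Hom by (rule cl[OF that])
    fix s t assume s: "s \<in> P.sec U" and t: "t \<in> P.sec U"
    show "?c (s \<oplus>\<^bsub>msec P U\<^esub> t) = ?c s \<oplus>\<^bsub>msec HQ U\<^esub> ?c t"
    proof (rule FQ.sheaf_hom_eqI[OF cl[OF P.sec_closed(2)[OF U s t]] FQ.Hom_add_closed[OF U cl[OF s] cl[OF t]]])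
      fix V \<sigma> assume V: "openin T V" "V \<subseteq> U" "\<sigma> \<in> F.sec V"
      show "?c (s \<oplus>\<^bsub>msec P U\<^esub> t) V \<sigma> = (?c s \<oplus>\<^bsub>msec HQ U\<^esub> ?c t) V \<sigma>"
        unfolding FQ.Hom_add_apply[OF V] contract_add[OF U V s t]
        using V additive_maps_add[OF Q.to_sheafify_additive[OF V(1)] contract_closed[OF U V s] contract_closed[OF U V t]]
        by (simp add: mem_opens_in contract_add[OF U V s t])
    qed
  qed
  show "(case (\<alpha>, f) of (\<alpha>, f) \<Rightarrow> \<lambda>V\<in>opens_in T U. \<lambda>\<sigma>\<in>F.sec V.
      Q.toS V (OF.pureT V (mres \<Omega> U V \<alpha>) (f V \<sigma>))) = ?c (OH.pureT U \<alpha> f)"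
    if "\<alpha> \<in> Om.sec U" "f \<in> H.sec U" for \<alpha> f
    unfolding prod.case by (intro restrict_ext) (simp add: mem_opens_in contract_pure[OF U _ _ _ that])
qed (use s in \<open>simp add: OH.msec_tensor\<close>)

lemma contraction_presheaf_apply:
  "openin T U \<Longrightarrow> s \<in> P.sec U \<Longrightarrow> openin T V \<Longrightarrow> V \<subseteq> U \<Longrightarrow> \<sigma> \<in> F.sec V \<Longrightarrow>
    contraction_presheaf T A \<Omega> F U s V \<sigma> = Q.toS V (contract U V \<sigma> s)"
  by (simp add: contraction_presheaf_eq mem_opens_in)

lemma contraction_presheaf_closed:
  "openin T U \<Longrightarrow> s \<in> P.sec U \<Longrightarrow> contraction_presheaf T A \<Omega> F U s \<in> sheaf_hom T A F QS U"
  by (simp only: contraction_presheaf_eq contract_sheaf_hom)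

end

section \<open>Finite sums, dual bases and gluing of sections\<close>

lemma finsum_eqI:
  assumes "abelian_group M" "\<And>i. i \<in> I \<Longrightarrow> f i = g i" "\<And>i. i \<in> I \<Longrightarrow> g i \<in> carrier M"
  shows "finsum M f I = finsum M g I"
proof -
  interpret abelian_group M by fact
  show ?thesis using assms(2,3) by (intro finsum_cong') auto
qed

lemma finsum_in_carrier:
  assumes "abelian_group M" "\<And>i. i \<in> I \<Longrightarrow> f i \<in> carrier M"
  shows "finsum M f I \<in> carrier M"
proof -
  interpret abelian_group M by fact
  show ?thesis using assms(2) by (intro finsum_closed) auto
qed

text \<open>A factorisation of the identity through a free module: the forms
  \<open>\<epsilon>\<^sub>i\<close> give the map into it, the sections \<open>e\<^sub>i\<close> the
  map out. The forms are given over every open V \<subseteq> U because \<open>rank_one\<close>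
  applies them to sections over arbitrary smaller sets; each \<open>e\<^sub>i\<close> is one section
  over \<open>U\<close>, restricted where it is used.\<close>

locale dual_basis = module_presheaf_on T A P
  for T :: "'x topology" and A :: "('x, 'a) ring_presheaf" and P :: "('x, 'a, 's) module_presheaf" +
  fixes U :: "'x set" and r :: nat and e :: "nat \<Rightarrow> 's" and \<epsilon> :: "nat \<Rightarrow> 'x set \<Rightarrow> 's \<Rightarrow> 'a"
  assumes U: "openin T U"
    and e_closed: "\<And>i. i < r \<Longrightarrow> e i \<in> sec U"
    and \<epsilon>_additive: "\<And>i V. i < r \<Longrightarrow> openin T V \<Longrightarrow> V \<subseteq> U \<Longrightarrow> \<epsilon> i V \<in> additive_maps (msec P V) (rsec A V)"
    and \<epsilon>_smult: "\<And>i V a s. i < r \<Longrightarrow> openin T V \<Longrightarrow> V \<subseteq> U \<Longrightarrow> a \<in> carrier (rsec A V) \<Longrightarrow>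
      s \<in> sec V \<Longrightarrow> \<epsilon> i V (a \<odot>\<^bsub>msec P V\<^esub> s) = a \<otimes>\<^bsub>rsec A V\<^esub> \<epsilon> i V s"
    and \<epsilon>_res: "\<And>i V W s. i < r \<Longrightarrow> openin T V \<Longrightarrow> V \<subseteq> U \<Longrightarrow> openin T W \<Longrightarrow> W \<subseteq> V \<Longrightarrow>
      s \<in> sec V \<Longrightarrow> rres A V W (\<epsilon> i V s) = \<epsilon> i W (mres P V W s)"
    and expand: "\<And>V s. openin T V \<Longrightarrow> V \<subseteq> U \<Longrightarrow> s \<in> sec V \<Longrightarrow>
      (\<Oplus>\<^bsub>msec P V\<^esub>i\<in>{..<r}. \<epsilon> i V s \<odot>\<^bsub>msec P V\<^esub> mres P U V (e i)) = s"
begin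

lemma res_e: "i < r \<Longrightarrow> openin T W \<Longrightarrow> W \<subseteq> U \<Longrightarrow> mres P U W (e i) \<in> sec W"
  using res_closed[OF U _ _ e_closed] by blast

lemmas \<epsilon>_closed = additive_maps_closed[OF \<epsilon>_additive]

end

text \<open>A section of the sheafification is a family of germs, so compatibility means equal germs
  at common points, not equal restrictions to overlaps. The local data form a relation
  \<open>good\<close>, which may hold for many sections around a point; none has to be
  selected.\<close>

lemma (in module_presheaf_on) glue_sections:
  assumes good: "\<And>W s. good W s \<Longrightarrow> openin T W \<and> W \<subseteq> U \<and> s \<in> sec W"
    and cover: "\<And>x. x \<in> U \<Longrightarrow> \<exists>W s. x \<in> W \<and> good W s"
    and compatible: "\<And>x W s W' s'. good W s \<Longrightarrow> x \<in> W \<Longrightarrow> good W' s' \<Longrightarrow> x \<in> W' \<Longrightarrow>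
      germ T P x W s = germ T P x W' s'"
  shows "\<exists>g\<in>carrier (msec SP U). \<forall>W s. good W s \<longrightarrow> represents W g s"
proof
  \<comment> \<open>The germ at x is the value common to all good pairs around x; compatibility
    makes the description unique.\<close>
  define g where "g = (\<lambda>x\<in>U. THE \<gamma>. \<exists>W s. x \<in> W \<and> good W s \<and> \<gamma> = germ T P x W s)"
  have rep: "represents W g s" if W: "good W s" for W s
    unfolding represents_def
  proof (intro conjI ballI)
    show "openin T W" "s \<in> sec W" using good[OF W] by simp_all
    fix x assume x: "x \<in> W"
    have "(THE \<gamma>. \<exists>W s. x \<in> W \<and> good W s \<and> \<gamma> = germ T P x W s) = germ T P x W s"
    proof (rule the_equality)
      show "\<exists>W' s'. x \<in> W' \<and> good W' s' \<and> germ T P x W s = germ T P x W' s'" using W x by metis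
      show "\<gamma> = germ T P x W s" if "\<exists>W s. x \<in> W \<and> good W s \<and> \<gamma> = germ T P x W s" for \<gamma>
        using that compatible[OF _ _ W x] by metis
    qed
    then show "g x = germ T P x W s" using subsetD[OF conjunct1[OF conjunct2[OF good[OF W]]] x] by (simp add: g_def)
  qed
  then show "\<forall>W s. good W s \<longrightarrow> represents W g s" by simp
  show "g \<in> carrier (msec SP U)"
    unfolding carrier_sheafify_iff
  proof (intro conjI ballI)
    show "g \<in> extensional U" by (simp add: g_def)
    fix x assume "x \<in> U"
    then obtain W s where W: "x \<in> W" "good W s" using cover by blast
    show "\<exists>W s. x \<in> W \<and> W \<subseteq> U \<and> represents W g s"
      using W(1) rep[OF W(2)] good[OF W(2)] by (intro exI[of _ W] exI[of _ s]) simp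
  qed
qed

context contraction_data
begin

section \<open>The contraction map on global sections\<close>

text \<open>Contraction descends to germs: where the tensors agree on a smaller set, both sides
  restrict to the contraction of that common tensor with the restriction of \<open>\<sigma>\<close>.
  Hence the contractions of the local representatives of a global section are compatible.\<close>

lemma contract_germ_cong:
  assumes W: "openin T W" "x \<in> W" "s \<in> P.sec W"
    and W': "openin T W'" "x \<in> W'" "s' \<in> P.sec W'"
    and eq: "germ T P x W s = germ T P x W' s'"
    and V: "openin T V" "W \<subseteq> V" "W' \<subseteq> V" "\<sigma> \<in> F.sec V"
  shows "germ T Q x W (contract W W (mres F V W \<sigma>) s) = germ T Q x W' (contract W' W' (mres F V W' \<sigma>) s')"
proof -
  obtain O1 where O1: "openin T O1" "x \<in> O1" "O1 \<subseteq> W" "O1 \<subseteq> W'" "mres P W O1 s = mres P W' O1 s'"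
    using P.germ_eqE[OF eq W] .
  have OV: "O1 \<subseteq> V" using O1 V by auto
  note \<sigma>O = F.res_closed[OF V(1) O1(1) OV V(4)]
  note \<sigma>W = F.res_closed[OF V(1) W(1) V(2,4)] and \<sigma>W' = F.res_closed[OF V(1) W'(1) V(3,4)]
  show ?thesis
  proof (rule Q.germ_eqI[OF W(1) W'(1) _ _ O1(1-4)])
    show "contract W W (mres F V W \<sigma>) s \<in> Q.sec W"
      by (rule contract_closed[OF W(1,1) subset_refl \<sigma>W W(3)])
    show "contract W' W' (mres F V W' \<sigma>) s' \<in> Q.sec W'"
      by (rule contract_closed[OF W'(1,1) subset_refl \<sigma>W' W'(3)])
    have "mres Q W O1 (contract W W (mres F V W \<sigma>) s) = contract O1 O1 (mres F V O1 \<sigma>) (mres P W O1 s)"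
      unfolding contract_res_right[OF W(1,1) subset_refl O1(1,3) \<sigma>W W(3)]
        F.res_res[OF V(1) W(1) O1(1) V(2) O1(3) V(4)]
      by (rule contract_res_left[OF W(1) O1(1,3,1) subset_refl \<sigma>O W(3), symmetric])
    moreover have "mres Q W' O1 (contract W' W' (mres F V W' \<sigma>) s') = contract O1 O1 (mres F V O1 \<sigma>) (mres P W' O1 s')"
      unfolding contract_res_right[OF W'(1,1) subset_refl O1(1,4) \<sigma>W' W'(3)]
        F.res_res[OF V(1) W'(1) O1(1) V(3) O1(4) V(4)]
      by (rule contract_res_left[OF W'(1) O1(1,4,1) subset_refl \<sigma>O W'(3), symmetric])
    ultimately show "mres Q W O1 (contract W W (mres F V W \<sigma>) s) = mres Q W' O1 (contract W' W' (mres F V W' \<sigma>) s')"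
      using O1(5) by simp
  qed
qed

abbreviation "TT \<equiv> topspace T"

lemma represented_within:
  assumes "g \<in> PS.sec TT" "openin T V" "x \<in> V"
  obtains W s where "openin T W" "x \<in> W" "W \<subseteq> V" "P.represents W g s"
proof -
  have "x \<in> TT" using assms openin_subset by blast
  then obtain Z s where Z: "openin T Z" "x \<in> Z" "Z \<subseteq> TT" "P.represents Z g s"
    using P.represented[OF assms(1)] by metis
  have "openin T (Z \<inter> V)" using Z assms by auto
  then show thesis using that[of "Z \<inter> V"] P.represents_res[OF Z(4), of "Z \<inter> V"] Z assms(3) by simp
qed

text \<open>The contraction of a global section \<open>g\<close> with \<open>\<sigma>\<close>,
  specified by its local representatives. \<open>glue_sections\<close> gives existence, and since
  \<open>g\<close> has representatives near every point of \<open>V\<close>, the germs are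
  determined, so the choice has only one candidate.\<close>

definition glued where
  "glued g V \<sigma> = (SOME h. h \<in> QS.sec V \<and> (\<forall>W s. P.represents W g s \<longrightarrow> W \<subseteq> V \<longrightarrow>
     Q.represents W h (contract W W (mres F V W \<sigma>) s)))"

lemma glued:
  assumes g: "g \<in> PS.sec TT" and V: "openin T V" and \<sigma>: "\<sigma> \<in> F.sec V"
  shows glued_closed: "glued g V \<sigma> \<in> QS.sec V"
    and represents_glued: "\<And>W s. P.represents W g s \<Longrightarrow> W \<subseteq> V \<Longrightarrow>
      Q.represents W (glued g V \<sigma>) (contract W W (mres F V W \<sigma>) s)"
proof -
  define good where "good W q \<longleftrightarrow> (\<exists>s. P.represents W g s \<and> W \<subseteq> V \<and> q = contract W W (mres F V W \<sigma>) s)" for W q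
  have "\<exists>h\<in>QS.sec V. \<forall>W q. good W q \<longrightarrow> Q.represents W h q"
  proof (rule Q.glue_sections)
    show "openin T W \<and> W \<subseteq> V \<and> q \<in> Q.sec W" if W0: "good W q" for W q
    proof -
      obtain s where W: "P.represents W g s" "W \<subseteq> V" and q: "q = contract W W (mres F V W \<sigma>) s"
        using W0 unfolding good_def by metis
      note r = P.representsD[OF W(1)]
      show ?thesis
        using r(1) W(2) contract_closed[OF r(1,1) subset_refl F.res_closed[OF V r(1) W(2) \<sigma>] r(2)] q by simp
    qed
    show "\<exists>W q. x \<in> W \<and> good W q" if "x \<in> V" for x
      using represented_within[OF g V that] unfolding good_def by metis
    show "germ T Q x W q = germ T Q x W' q'" if W0: "good W q" "x \<in> W" "good W' q'" "x \<in> W'" for x W q W' q'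
    proof -
      obtain s where W: "P.represents W g s" "W \<subseteq> V" and q: "q = contract W W (mres F V W \<sigma>) s"
        using W0(1) unfolding good_def by metis
      obtain s' where W': "P.represents W' g s'" "W' \<subseteq> V" and q': "q' = contract W' W' (mres F V W' \<sigma>) s'"
        using W0(3) unfolding good_def by metis
      note r = P.representsD[OF W(1)] and r' = P.representsD[OF W'(1)]
      show ?thesis
        unfolding q q'
        by (rule contract_germ_cong[OF r(1) W0(2) r(2) r'(1) W0(4) r'(2) _ V W(2) W'(2) \<sigma>])
          (simp only: r(3)[OF W0(2), symmetric] r'(3)[OF W0(4)])
    qed
  qed
  then have "\<exists>h. h \<in> QS.sec V \<and> (\<forall>W s. P.represents W g s \<longrightarrow> W \<subseteq> V \<longrightarrow>
      Q.represents W h (contract W W (mres F V W \<sigma>) s))"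
    unfolding good_def by metis
  then have "glued g V \<sigma> \<in> QS.sec V \<and> (\<forall>W s. P.represents W g s \<longrightarrow> W \<subseteq> V \<longrightarrow>
      Q.represents W (glued g V \<sigma>) (contract W W (mres F V W \<sigma>) s))"
    unfolding glued_def by (rule someI_ex)
  then show "glued g V \<sigma> \<in> QS.sec V"
    "\<And>W s. P.represents W g s \<Longrightarrow> W \<subseteq> V \<Longrightarrow>
      Q.represents W (glued g V \<sigma>) (contract W W (mres F V W \<sigma>) s)" by blast+
qed

definition glued_hom where
  "glued_hom g = (\<lambda>V\<in>opens_in T TT. \<lambda>\<sigma>\<in>F.sec V. glued g V \<sigma>)"

lemma glued_hom_apply: "openin T V \<Longrightarrow> \<sigma> \<in> F.sec V \<Longrightarrow> glued_hom g V \<sigma> = glued g V \<sigma>"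
  by (simp add: glued_hom_def mem_opens_in openin_subset)

text \<open>Near each point \<open>g\<close> is represented by a tensor s, and there the claims are
  the additivity, homogeneity and naturality of the contraction of s in the section.\<close>

lemma glued_hom_closed:
  assumes g: "g \<in> PS.sec TT"
  shows "glued_hom g \<in> sheaf_hom T A F QS TT"
  unfolding glued_hom_def
proof (rule FQ.sheaf_homI)
  fix V \<sigma> assume V: "openin T V" and \<sigma>: "\<sigma> \<in> F.sec V"
  show "glued g V \<sigma> \<in> QS.sec V" by (rule glued_closed[OF g V \<sigma>])
  show "glued g V (\<sigma> \<oplus>\<^bsub>msec F V\<^esub> \<tau>) = glued g V \<sigma> \<oplus>\<^bsub>msec QS V\<^esub> glued g V \<tau>"
    if \<tau>: "\<tau> \<in> F.sec V" for \<tau>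
  proof (rule Q.sheafify_eqI)
    fix x assume x: "x \<in> V"
    obtain W s where W: "openin T W" "x \<in> W" "W \<subseteq> V" "P.represents W g s"
      using represented_within[OF g V x] .
    have \<sigma>\<tau>: "\<sigma> \<oplus>\<^bsub>msec F V\<^esub> \<tau> \<in> F.sec V" by (rule F.sec_closed(2)[OF V \<sigma> \<tau>])
    note res = F.res_closed[OF V W(1,3)]
    note s = P.representsD(2)[OF W(4)]
    have eq: "contract W W (mres F V W (\<sigma> \<oplus>\<^bsub>msec F V\<^esub> \<tau>)) s
      = contract W W (mres F V W \<sigma>) s \<oplus>\<^bsub>msec Q W\<^esub> contract W W (mres F V W \<tau>) s"
      unfolding F.res_add[OF V W(1,3) \<sigma> \<tau>]
      by (rule contract_add_section[OF W(1,1) subset_refl res[OF \<sigma>] res[OF \<tau>] s])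
    show "\<exists>W s. x \<in> W \<and> Q.represents W (glued g V (\<sigma> \<oplus>\<^bsub>msec F V\<^esub> \<tau>)) s \<and>
        Q.represents W (glued g V \<sigma> \<oplus>\<^bsub>msec QS V\<^esub> glued g V \<tau>) s"
      using represents_glued[OF g V \<sigma>\<tau> W(4,3), unfolded eq]
        Q.represents_add[OF W(1,3) represents_glued[OF g V \<sigma> W(4,3)] represents_glued[OF g V \<tau> W(4,3)]] W(2) by metis
  qed (use F.sec_closed(2)[OF V \<sigma> \<tau>] in \<open>simp_all add: Q.sheafify_extensional glued_closed[OF g V]\<close>)
  show "glued g V (r \<odot>\<^bsub>msec F V\<^esub> \<sigma>) = r \<odot>\<^bsub>msec QS V\<^esub> glued g V \<sigma>"
    if r: "r \<in> carrier (rsec A V)" for r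
  proof (rule Q.sheafify_eqI)
    fix x assume x: "x \<in> V"
    obtain W s where W: "openin T W" "x \<in> W" "W \<subseteq> V" "P.represents W g s"
      using represented_within[OF g V x] .
    have r\<sigma>: "r \<odot>\<^bsub>msec F V\<^esub> \<sigma> \<in> F.sec V" by (rule F.sec_closed(3)[OF V r \<sigma>])
    note res = F.res_closed[OF V W(1,3)]
    note s = P.representsD(2)[OF W(4)]
    have eq: "contract W W (mres F V W (r \<odot>\<^bsub>msec F V\<^esub> \<sigma>)) s
      = rres A V W r \<odot>\<^bsub>msec Q W\<^esub> contract W W (mres F V W \<sigma>) s"
      unfolding F.res_smult[OF V W(1,3) r \<sigma>]
      by (rule contract_smult_section[OF W(1,1) subset_refl Om.A_res_closed[OF V W(1,3) r] res[OF \<sigma>] s])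
    show "\<exists>W s. x \<in> W \<and> Q.represents W (glued g V (r \<odot>\<^bsub>msec F V\<^esub> \<sigma>)) s \<and>
        Q.represents W (r \<odot>\<^bsub>msec QS V\<^esub> glued g V \<sigma>) s"
      using represents_glued[OF g V r\<sigma> W(4,3), unfolded eq]
        Q.represents_smult[OF V W(1,3) represents_glued[OF g V \<sigma> W(4,3)] r] W(2) by metis
  qed (use F.sec_closed(3)[OF V r \<sigma>] in \<open>simp_all add: Q.sheafify_extensional glued_closed[OF g V]\<close>)
  show "mres QS V Z (glued g V \<sigma>) = glued g Z (mres F V Z \<sigma>)"
    if Z: "openin T Z" "Z \<subseteq> V" for Z
    unfolding Q.mres_sheafify
  proof (rule Q.sheafify_eqI)
    fix x assume x: "x \<in> Z"
    obtain W s where W: "openin T W" "x \<in> W" "W \<subseteq> Z" "P.represents W g s"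
      using represented_within[OF g Z(1) x] .
    have WV: "W \<subseteq> V" using W Z by auto
    have eq: "mres F Z W (mres F V Z \<sigma>) = mres F V W \<sigma>"
      by (rule F.res_res[OF V Z(1) W(1) Z(2) W(3) \<sigma>])
    show "\<exists>W s. x \<in> W \<and> Q.represents W (restrict (glued g V \<sigma>) Z) s \<and>
        Q.represents W (glued g Z (mres F V Z \<sigma>)) s"
      using Q.represents_restrict[OF represents_glued[OF g V \<sigma> W(4) WV] W(3)]
        represents_glued[OF g Z(1) F.res_closed[OF V Z \<sigma>] W(4,3), unfolded eq] W(2) by metis
  qed (simp_all add: Q.sheafify_extensional glued_closed[OF g Z(1) F.res_closed[OF V Z \<sigma>]])
qed

text \<open>The definite description in \<open>sheafify_lift\<close> requires existence and
  uniqueness. For existence, both sides have the same representatives wherever \<open>g\<close>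
  comes from a tensor. For uniqueness, \<open>g\<close> comes from a tensor near every point, which
  prescribes the morphism on restrictions of sections, and sections of the target are determined
  locally.\<close>

lemma contraction_eq_glued_hom:
  assumes g: "g \<in> PS.sec TT"
  shows "contraction T A \<Omega> F g = glued_hom g"
  unfolding contraction_def sheafify_lift_def tensor_sheaf_def FQ.carrier_Hom mem_opens_in
proof (rule the_equality)
  show "glued_hom g \<in> sheaf_hom T A F QS TT \<and> (\<forall>V\<in>opens_in T TT. \<forall>s\<in>P.sec V.
      restrict g V = P.toS V s \<longrightarrow> mres HQ TT V (glued_hom g) = contraction_presheaf T A \<Omega> F V s)"
  proof (intro conjI ballI impI)
    show gh: "glued_hom g \<in> sheaf_hom T A F QS TT" by (rule glued_hom_closed[OF g])
    fix V s assume "V \<in> opens_in T TT" and s: "s \<in> P.sec V" and eq: "restrict g V = P.toS V s"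
    then have V: "openin T V" "V \<subseteq> TT" by (auto simp: mem_opens_in)
    have rep: "P.represents V g s" using eq P.restrict_eq_to_sheafify_iff[OF V(1) s] by blast
    show "mres HQ TT V (glued_hom g) = contraction_presheaf T A \<Omega> F V s"
    proof (rule FQ.sheaf_hom_eqI)
      show "mres HQ TT V (glued_hom g) \<in> sheaf_hom T A F QS V"
        by (rule FQ.Hom_res_closed[OF openin_topspace V gh])
      show "contraction_presheaf T A \<Omega> F V s \<in> sheaf_hom T A F QS V"
        by (rule contraction_presheaf_closed[OF V(1) s])
      fix W \<sigma> assume W: "openin T W" "W \<subseteq> V" and \<sigma>: "\<sigma> \<in> F.sec W"
      \<comment> \<open>The representative over V is shrunk to W, the domain of
        \<open>\<sigma>\<close>, and \<open>contract_res_left\<close> removes the shrinking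
        again.\<close>
      have "Q.represents W (glued g W \<sigma>) (contract W W (mres F W W \<sigma>) (mres P V W s))"
        by (rule represents_glued[OF g W(1) \<sigma> P.represents_res[OF rep W] subset_refl])
      then have "Q.represents W (glued g W \<sigma>) (contract V W \<sigma> s)"
        unfolding F.res_id[OF W(1) \<sigma>] contract_res_left[OF V(1) W W(1) subset_refl \<sigma> s] .
      then have "glued g W \<sigma> = Q.toS W (contract V W \<sigma> s)"
        by (rule Q.represents_imp_eq) (rule Q.sheafify_extensional[OF glued_closed[OF g W(1) \<sigma>]])
      then show "mres HQ TT V (glued_hom g) W \<sigma> = contraction_presheaf T A \<Omega> F V s W \<sigma>"
        unfolding FQ.Hom_res_apply[OF W \<sigma>] contraction_presheaf_apply[OF V(1) s W \<sigma>] glued_hom_apply[OF W(1) \<sigma>] .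
    qed
  qed
next
  fix t assume t: "t \<in> sheaf_hom T A F QS TT \<and> (\<forall>V\<in>opens_in T TT. \<forall>s\<in>P.sec V.
      restrict g V = P.toS V s \<longrightarrow> mres HQ TT V t = contraction_presheaf T A \<Omega> F V s)"
  show "t = glued_hom g"
  proof (rule FQ.sheaf_hom_eqI)
    show th: "t \<in> sheaf_hom T A F QS TT" using t by blast
    show "glued_hom g \<in> sheaf_hom T A F QS TT" by (rule glued_hom_closed[OF g])
    fix V \<sigma> assume V: "openin T V" "V \<subseteq> TT" and \<sigma>: "\<sigma> \<in> F.sec V"
    show "t V \<sigma> = glued_hom g V \<sigma>"
      unfolding glued_hom_apply[OF V(1) \<sigma>]
    proof (rule Q.sheafify_eqI)
      show "t V \<sigma> \<in> extensional V"
        by (rule Q.sheafify_extensional[OF sheaf_hom_closed[OF th V \<sigma>]])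
      fix x assume x: "x \<in> V"
      obtain W s where W: "openin T W" "x \<in> W" "W \<subseteq> V" "P.represents W g s"
        using represented_within[OF g V(1) x] .
      have WX: "W \<subseteq> TT" using W V by auto
      note s = P.representsD(2)[OF W(4)]
      note \<sigma>W = F.res_closed[OF V(1) W(1,3) \<sigma>]
      have "restrict g W = P.toS W s" using P.restrict_eq_to_sheafify_iff[OF W(1) s] W(4) by blast
      \<comment> \<open>The condition in the description is applied to a pair (W, s) that represents
        \<open>g\<close> near x.\<close>
      then have "mres HQ TT W t = contraction_presheaf T A \<Omega> F W s"
        using t s W(1) WX by (simp add: mem_opens_in)
      then have "t W (mres F V W \<sigma>) = contraction_presheaf T A \<Omega> F W s W (mres F V W \<sigma>)"
        using FQ.Hom_res_apply[OF W(1) subset_refl \<sigma>W] by metis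
      then have "restrict (t V \<sigma>) W = Q.toS W (contract W W (mres F V W \<sigma>) s)"
        using sheaf_hom_res[OF th V \<sigma> W(1,3)]
        unfolding contraction_presheaf_apply[OF W(1) s W(1) subset_refl \<sigma>W] Q.mres_sheafify by simp
      then have "Q.represents W (t V \<sigma>) (contract W W (mres F V W \<sigma>) s)"
        using Q.restrict_eq_to_sheafify_iff[OF W(1) contract_closed[OF W(1,1) subset_refl \<sigma>W s]] by blast
      then show "\<exists>W s. x \<in> W \<and> Q.represents W (t V \<sigma>) s \<and> Q.represents W (glued g V \<sigma>) s"
        using represents_glued[OF g V(1) \<sigma> W(4,3)] W(2) by metis
    qed (rule Q.sheafify_extensional[OF glued_closed[OF g V(1) \<sigma>]])
  qed
qed

lemma contraction_closed: "g \<in> PS.sec TT \<Longrightarrow> contraction T A \<Omega> F g \<in> sheaf_hom T A F QS TT"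
  by (simp add: contraction_eq_glued_hom glued_hom_closed)

text \<open>Together with \<open>contraction_closed\<close> this replaces the definition of
  \<open>contraction\<close> from here on.\<close>

lemma represents_contraction:
  assumes "g \<in> PS.sec TT" "openin T V" "\<sigma> \<in> F.sec V" "P.represents W g s" "W \<subseteq> V"
  shows "Q.represents W (contraction T A \<Omega> F g V \<sigma>) (contract W W (mres F V W \<sigma>) s)"
  unfolding contraction_eq_glued_hom[OF assms(1)] glued_hom_apply[OF assms(2,3)]
  by (rule represents_glued[OF assms])

lemma contraction_eqI:
  assumes "t \<in> sheaf_hom T A F QS TT" "u \<in> sheaf_hom T A F QS TT"
    and "\<And>V \<sigma> x. openin T V \<Longrightarrow> \<sigma> \<in> F.sec V \<Longrightarrow> x \<in> V \<Longrightarrow>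
       \<exists>W s. x \<in> W \<and> Q.represents W (t V \<sigma>) s \<and> Q.represents W (u V \<sigma>) s"
  shows "t = u"
proof (rule FQ.sheaf_hom_eqI[OF assms(1,2)])
  fix V \<sigma> assume V: "openin T V" "V \<subseteq> TT" "\<sigma> \<in> F.sec V"
  show "t V \<sigma> = u V \<sigma>"
    by (rule Q.sheafify_eqI[OF Q.sheafify_extensional[OF sheaf_hom_closed[OF assms(1) V]]
          Q.sheafify_extensional[OF sheaf_hom_closed[OF assms(2) V]] assms(3)[OF V(1,3)]])
qed

lemma contraction_add:
  assumes g: "g \<in> PS.sec TT" and h: "h \<in> PS.sec TT"
  shows "contraction T A \<Omega> F (g \<oplus>\<^bsub>msec PS TT\<^esub> h)
    = contraction T A \<Omega> F g \<oplus>\<^bsub>msec HQ TT\<^esub> contraction T A \<Omega> F h" (is "?l = ?r")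
proof (rule contraction_eqI)
  have gh: "g \<oplus>\<^bsub>msec PS TT\<^esub> h \<in> PS.sec TT" by (rule PS.sec_closed(2)[OF openin_topspace g h])
  show "?l \<in> sheaf_hom T A F QS TT" by (rule contraction_closed[OF gh])
  show "?r \<in> sheaf_hom T A F QS TT"
    by (rule FQ.Hom_add_closed[OF openin_topspace contraction_closed[OF g] contraction_closed[OF h]])
  fix V \<sigma> x assume V: "openin T V" and \<sigma>: "\<sigma> \<in> F.sec V" and x: "x \<in> V"
  have VX: "V \<subseteq> TT" using V by (rule openin_subset)
  \<comment> \<open>Pairing g on the whole space with h restricted to V yields a common domain that
    also lies inside V.\<close>
  obtain W s t where W: "openin T W" "x \<in> W" "W \<subseteq> TT" "W \<subseteq> V" "P.represents W g s" "P.represents W (restrict h V) t"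
    using P.represented2[OF openin_topspace V g P.sheafify_restrict_closed[OF openin_topspace V VX h]
      subsetD[OF VX x] x] .
  note h' = W(6)[unfolded P.represents_restrict_iff[OF W(4)]]
  note \<sigma>W = F.res_closed[OF V W(1,4) \<sigma>]
  have "Q.represents W (?l V \<sigma>) (contract W W (mres F V W \<sigma>) (s \<oplus>\<^bsub>msec P W\<^esub> t))"
    by (rule represents_contraction[OF gh V \<sigma> P.represents_add[OF W(1,3,5) h'] W(4)])
  moreover have "Q.represents W (?r V \<sigma>)
      (contract W W (mres F V W \<sigma>) s \<oplus>\<^bsub>msec Q W\<^esub> contract W W (mres F V W \<sigma>) t)"
    unfolding FQ.Hom_add_apply[OF V VX \<sigma>]
    by (rule Q.represents_add[OF W(1,4) represents_contraction[OF g V \<sigma> W(5,4)] represents_contraction[OF h V \<sigma> h' W(4)]])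
  ultimately show "\<exists>W s. x \<in> W \<and> Q.represents W (?l V \<sigma>) s \<and> Q.represents W (?r V \<sigma>) s"
    using contract_add[OF W(1,1) subset_refl \<sigma>W W(5)[THEN P.representsD(2)] h'[THEN P.representsD(2)]] W(2)
    by metis
qed

lemma contraction_smult:
  assumes r: "r \<in> carrier (rsec A TT)" and g: "g \<in> PS.sec TT"
  shows "contraction T A \<Omega> F (r \<odot>\<^bsub>msec PS TT\<^esub> g) = r \<odot>\<^bsub>msec HQ TT\<^esub> contraction T A \<Omega> F g"
    (is "?l = ?r")
proof (rule contraction_eqI)
  have rg: "r \<odot>\<^bsub>msec PS TT\<^esub> g \<in> PS.sec TT" by (rule PS.sec_closed(3)[OF openin_topspace r g])
  show "?l \<in> sheaf_hom T A F QS TT" by (rule contraction_closed[OF rg])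
  show "?r \<in> sheaf_hom T A F QS TT"
    by (rule FQ.Hom_smult_closed[OF openin_topspace r contraction_closed[OF g]])
  fix V \<sigma> x assume V: "openin T V" and \<sigma>: "\<sigma> \<in> F.sec V" and x: "x \<in> V"
  have VX: "V \<subseteq> TT" using V by (rule openin_subset)
  obtain W s where W: "openin T W" "x \<in> W" "W \<subseteq> V" "P.represents W g s"
    using represented_within[OF g V x] .
  have WX: "W \<subseteq> TT" using W VX by auto
  note \<sigma>W = F.res_closed[OF V W(1,3) \<sigma>]
  note rV = Om.A_res_closed[OF openin_topspace V VX r]
  have "Q.represents W (?l V \<sigma>) (contract W W (mres F V W \<sigma>) (rres A TT W r \<odot>\<^bsub>msec P W\<^esub> s))"
    by (rule represents_contraction[OF rg V \<sigma> P.represents_smult[OF openin_topspace W(1) WX W(4) r] W(3)])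
  moreover have "Q.represents W (?r V \<sigma>) (rres A V W (rres A TT V r) \<odot>\<^bsub>msec Q W\<^esub> contract W W (mres F V W \<sigma>) s)"
    unfolding FQ.Hom_smult_apply[OF V VX \<sigma>]
    by (rule Q.represents_smult[OF V W(1,3) represents_contraction[OF g V \<sigma> W(4,3)] rV])
  \<comment> \<open>On the left the scalar is restricted to W directly, on the right by way of V;
    \<open>A_comp\<close> identifies the two. The further restriction from W to itself left by
    \<open>contract_smult\<close> is removed by \<open>A_id\<close>.\<close>
  moreover have "contract W W (mres F V W \<sigma>) (rres A TT W r \<odot>\<^bsub>msec P W\<^esub> s)
      = rres A V W (rres A TT V r) \<odot>\<^bsub>msec Q W\<^esub> contract W W (mres F V W \<sigma>) s"
    unfolding contract_smult[OF W(1,1) subset_refl \<sigma>W Om.A_res_closed[OF openin_topspace W(1) WX r] P.representsD(2)[OF W(4)]]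
      Om.A_comp[OF openin_topspace V W(1) VX W(3) r]
      Om.A_id[OF W(1) Om.A_res_closed[OF openin_topspace W(1) WX r]] ..
  ultimately show "\<exists>W s. x \<in> W \<and> Q.represents W (?l V \<sigma>) s \<and> Q.represents W (?r V \<sigma>) s"
    using W(2) by metis
qed

end

context contraction_data
begin

section \<open>The local inverse given by a dual basis\<close>

context
  fixes U :: "'x set" and r :: nat and e :: "nat \<Rightarrow> 's" and \<epsilon> :: "nat \<Rightarrow> 'x set \<Rightarrow> 's \<Rightarrow> 'a"
  assumes db: "dual_basis T A F U r e \<epsilon>"
begin

interpretation db: dual_basis T A F U r e \<epsilon> by (rule db)

definition rank_one :: "nat \<Rightarrow> 'x set \<Rightarrow> 's \<Rightarrow> 'x set \<Rightarrow> 's \<Rightarrow> 's" where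
  "rank_one i W y = (\<lambda>V\<in>opens_in T W. \<lambda>\<sigma>\<in>F.sec V. \<epsilon> i V \<sigma> \<odot>\<^bsub>msec F V\<^esub> mres F W V y)"

private lemma rank_one_apply:
  "openin T V \<Longrightarrow> V \<subseteq> W \<Longrightarrow> \<sigma> \<in> F.sec V \<Longrightarrow> rank_one i W y V \<sigma> = \<epsilon> i V \<sigma> \<odot>\<^bsub>msec F V\<^esub> mres F W V y"
  by (simp add: rank_one_def mem_opens_in)

private lemma rank_one_closed:
  assumes i: "i < r" and W: "openin T W" "W \<subseteq> U" and y: "y \<in> F.sec W"
  shows "rank_one i W y \<in> H.sec W"
  unfolding carrier_H rank_one_def
proof (rule FF.sheaf_homI)
  fix V \<sigma> assume V: "openin T V" "V \<subseteq> W" and \<sigma>: "\<sigma> \<in> F.sec V"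
  have VU: "V \<subseteq> U" using V W by auto
  interpret M: module "rsec A V" "msec F V" by (rule F.sec_module[OF V(1)])
  note cl = db.\<epsilon>_closed[OF i V(1) VU]
  note yV = F.res_closed[OF W(1) V y]
  show "\<epsilon> i V \<sigma> \<odot>\<^bsub>msec F V\<^esub> mres F W V y \<in> F.sec V" using cl[OF \<sigma>] yV by simp
  show "\<epsilon> i V (\<sigma> \<oplus>\<^bsub>msec F V\<^esub> \<tau>) \<odot>\<^bsub>msec F V\<^esub> mres F W V y =
      \<epsilon> i V \<sigma> \<odot>\<^bsub>msec F V\<^esub> mres F W V y \<oplus>\<^bsub>msec F V\<^esub> \<epsilon> i V \<tau> \<odot>\<^bsub>msec F V\<^esub> mres F W V y"
    if \<tau>: "\<tau> \<in> F.sec V" for \<tau>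
    unfolding additive_maps_add[OF db.\<epsilon>_additive[OF i V(1) VU] \<sigma> \<tau>]
    by (rule M.smult_l_distr[OF cl[OF \<sigma>] cl[OF \<tau>] yV])
  show "\<epsilon> i V (a \<odot>\<^bsub>msec F V\<^esub> \<sigma>) \<odot>\<^bsub>msec F V\<^esub> mres F W V y = a \<odot>\<^bsub>msec F V\<^esub> (\<epsilon> i V \<sigma> \<odot>\<^bsub>msec F V\<^esub> mres F W V y)"
    if a: "a \<in> carrier (rsec A V)" for a
    unfolding db.\<epsilon>_smult[OF i V(1) VU a \<sigma>] by (rule M.smult_assoc1[OF a cl[OF \<sigma>] yV])
  show "mres F V Z (\<epsilon> i V \<sigma> \<odot>\<^bsub>msec F V\<^esub> mres F W V y) =
      \<epsilon> i Z (mres F V Z \<sigma>) \<odot>\<^bsub>msec F Z\<^esub> mres F W Z y"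
    if Z: "openin T Z" "Z \<subseteq> V" for Z
    unfolding F.res_smult[OF V(1) Z cl[OF \<sigma>] yV] db.\<epsilon>_res[OF i V(1) VU Z \<sigma>]
      F.res_res[OF W(1) V(1) Z(1) V(2) Z(2) y] ..
qed

private lemma rank_one_additive:
  assumes i: "i < r" and W: "openin T W" "W \<subseteq> U"
  shows "rank_one i W \<in> additive_maps (msec F W) (msec H W)"
proof (rule additive_mapsI)
  show cl: "rank_one i W y \<in> H.sec W" if "y \<in> F.sec W" for y
    by (rule rank_one_closed[OF i W that])
  fix y z assume y: "y \<in> F.sec W" and z: "z \<in> F.sec W"
  have yz: "y \<oplus>\<^bsub>msec F W\<^esub> z \<in> F.sec W" by (rule F.sec_closed(2)[OF W(1) y z])
  show "rank_one i W (y \<oplus>\<^bsub>msec F W\<^esub> z) = rank_one i W y \<oplus>\<^bsub>msec H W\<^esub> rank_one i W z"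
  proof (rule FF.sheaf_hom_eqI)
    show "rank_one i W (y \<oplus>\<^bsub>msec F W\<^esub> z) \<in> sheaf_hom T A F F W" using cl[OF yz] by (simp add: carrier_H)
    show "rank_one i W y \<oplus>\<^bsub>msec H W\<^esub> rank_one i W z \<in> sheaf_hom T A F F W"
      using H.sec_closed(2)[OF W(1) cl[OF y] cl[OF z]] by (simp add: carrier_H)
    fix V \<sigma> assume V: "openin T V" "V \<subseteq> W" and \<sigma>: "\<sigma> \<in> F.sec V"
    have VU: "V \<subseteq> U" using V W by auto
    interpret M: module "rsec A V" "msec F V" by (rule F.sec_module[OF V(1)])
    show "rank_one i W (y \<oplus>\<^bsub>msec F W\<^esub> z) V \<sigma> = (rank_one i W y \<oplus>\<^bsub>msec H W\<^esub> rank_one i W z) V \<sigma>"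
      unfolding FF.Hom_add_apply[OF V \<sigma>] rank_one_apply[OF V \<sigma>] F.res_add[OF W(1) V y z]
      by (rule M.smult_r_distr[OF db.\<epsilon>_closed[OF i V(1) VU \<sigma>] F.res_closed[OF W(1) V y] F.res_closed[OF W(1) V z]])
  qed
qed

private lemma rank_one_smult:
  assumes i: "i < r" and W: "openin T W" "W \<subseteq> U"
    and a: "a \<in> carrier (rsec A W)" and y: "y \<in> F.sec W"
  shows "rank_one i W (a \<odot>\<^bsub>msec F W\<^esub> y) = a \<odot>\<^bsub>msec H W\<^esub> rank_one i W y"
proof (rule FF.sheaf_hom_eqI)
  note cl = rank_one_closed[OF i W]
  show "rank_one i W (a \<odot>\<^bsub>msec F W\<^esub> y) \<in> sheaf_hom T A F F W"
    using cl[OF F.sec_closed(3)[OF W(1) a y]] by (simp add: carrier_H)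
  show "a \<odot>\<^bsub>msec H W\<^esub> rank_one i W y \<in> sheaf_hom T A F F W"
    using H.sec_closed(3)[OF W(1) a cl[OF y]] by (simp add: carrier_H)
  fix V \<sigma> assume V: "openin T V" "V \<subseteq> W" and \<sigma>: "\<sigma> \<in> F.sec V"
  have VU: "V \<subseteq> U" using V W by auto
  interpret M: module "rsec A V" "msec F V" by (rule F.sec_module[OF V(1)])
  note aV = Om.A_res_closed[OF W(1) V a] and yV = F.res_closed[OF W(1) V y] and \<epsilon>V = db.\<epsilon>_closed[OF i V(1) VU \<sigma>]
  have "rank_one i W (a \<odot>\<^bsub>msec F W\<^esub> y) V \<sigma> = (\<epsilon> i V \<sigma> \<otimes>\<^bsub>rsec A V\<^esub> rres A W V a) \<odot>\<^bsub>msec F V\<^esub> mres F W V y"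
    unfolding rank_one_apply[OF V \<sigma>] F.res_smult[OF W(1) V a y] by (rule M.smult_assoc1[OF \<epsilon>V aV yV, symmetric])
  \<comment> \<open>Commutativity exchanges the scalar with
    \<open>\<epsilon>\<^sub>i(\<sigma>)\<close>; so \<open>rank_one\<close> is linear in
    \<open>y\<close> and can be tensored with the identity of \<Omega>.\<close>
  also have "\<dots> = rres A W V a \<odot>\<^bsub>msec F V\<^esub> (\<epsilon> i V \<sigma> \<odot>\<^bsub>msec F V\<^esub> mres F W V y)"
    unfolding M.R.m_comm[OF \<epsilon>V aV] by (rule M.smult_assoc1[OF aV \<epsilon>V yV])
  finally show "rank_one i W (a \<odot>\<^bsub>msec F W\<^esub> y) V \<sigma> = (a \<odot>\<^bsub>msec H W\<^esub> rank_one i W y) V \<sigma>"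
    unfolding FF.Hom_smult_apply[OF V \<sigma>] rank_one_apply[OF V \<sigma>] .
qed

text \<open>The map \<open>\<lambda>\<^sub>i\<close> of the overview, over \<open>W\<close>; the
  corresponding \<open>\<kappa>\<^sub>i\<close> is \<open>contract W W\<close> at the restriction of
  \<open>e i\<close>.\<close>

definition tensor_rank_one ::
  "nat \<Rightarrow> 'x set \<Rightarrow> ('w \<times> 's \<Rightarrow>\<^sub>0 int) set \<Rightarrow> ('w \<times> ('x set \<Rightarrow> 's \<Rightarrow> 's) \<Rightarrow>\<^sub>0 int) set" where
  "tensor_rank_one i W = tensor_lift (tensor_module (rsec A W) (msec \<Omega> W) (msec H W))
     (\<lambda>(\<alpha>, y). pure_tensor (rsec A W) (msec \<Omega> W) (msec H W) \<alpha> (rank_one i W y))"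

private lemma tensor_rank_one:
  assumes i: "i < r" and W: "openin T W" "W \<subseteq> U"
  shows tensor_rank_one_additive: "tensor_rank_one i W \<in> additive_maps (msec Q W) (msec P W)"
    and tensor_rank_one_pure: "\<And>\<alpha> y. \<alpha> \<in> Om.sec W \<Longrightarrow> y \<in> F.sec W \<Longrightarrow>
          tensor_rank_one i W (OF.pureT W \<alpha> y) = OH.pureT W \<alpha> (rank_one i W y)"
proof -
  have id: "(\<lambda>\<alpha>. \<alpha>) \<in> additive_maps (msec \<Omega> W) (msec \<Omega> W)" by (simp add: additive_maps_def)
  note m = Om.sec_module[OF W(1)] F.sec_module[OF W(1)] Om.sec_module[OF W(1)] H.sec_module[OF W(1)]
    id rank_one_additive[OF i W] _ refl rank_one_smult[OF i W]
  show "tensor_rank_one i W \<in> additive_maps (msec Q W) (msec P W)"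
    unfolding tensor_rank_one_def OF.msec_tensor OH.msec_tensor
    by (rule tensor_map_additive[where f = "\<lambda>\<alpha>. \<alpha>" and g = "rank_one i W" and \<rho> = "\<lambda>a. a", OF m])
  show "tensor_rank_one i W (OF.pureT W \<alpha> y) = OH.pureT W \<alpha> (rank_one i W y)"
    if "\<alpha> \<in> Om.sec W" "y \<in> F.sec W" for \<alpha> y
    unfolding tensor_rank_one_def
    by (rule tensor_map_pure[where f = "\<lambda>\<alpha>. \<alpha>" and g = "rank_one i W" and \<rho> = "\<lambda>a. a", OF m that])
qed

text \<open>On \<open>\<alpha> \<otimes> y\<close> the left side is
  \<open>\<alpha> \<otimes> \<epsilon>\<^sub>i(\<sigma>)y\<close>, and the scalar can be pulled out
  of the second factor. This computes the contraction of a proposed preimage.\<close>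

private lemma contract_tensor_rank_one:
  assumes i: "i < r" and W: "openin T W" "W \<subseteq> U" and V: "openin T V" "V \<subseteq> W"
    and \<sigma>: "\<sigma> \<in> F.sec V" and q: "q \<in> Q.sec W"
  shows "contract W V \<sigma> (tensor_rank_one i W q) = \<epsilon> i V \<sigma> \<odot>\<^bsub>msec Q V\<^esub> mres Q W V q"
proof -
  have VU: "V \<subseteq> U" using V W by auto
  note \<epsilon>V = db.\<epsilon>_closed[OF i V(1) VU \<sigma>]
  interpret VP: tensor_pair "rsec A V" "msec \<Omega> V" "msec F V" by (rule OF.tensor_pair[OF V(1)])
  have sm: "(\<lambda>t. \<epsilon> i V \<sigma> \<odot>\<^bsub>msec Q V\<^esub> t) \<in> additive_maps (msec Q V) (msec Q V)"
    unfolding OF.msec_tensor by (rule VP.smult_tensor_additive[OF \<epsilon>V])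
  show ?thesis
  proof (rule OF.tensor_eqI[OF W(1) Q.sec_abelian_group[OF V(1)]
        additive_maps_comp[OF tensor_rank_one_additive[OF i W] contract_additive[OF W(1) V \<sigma>]]
        additive_maps_comp[OF Q.res_additive[OF W(1) V] sm] _ q])
    fix \<alpha> y assume \<alpha>: "\<alpha> \<in> Om.sec W" and y: "y \<in> F.sec W"
    show "contract W V \<sigma> (tensor_rank_one i W (OF.pureT W \<alpha> y)) = \<epsilon> i V \<sigma> \<odot>\<^bsub>msec Q V\<^esub> mres Q W V (OF.pureT W \<alpha> y)"
      unfolding tensor_rank_one_pure[OF i W \<alpha> y] contract_pure[OF W(1) V \<sigma> \<alpha> rank_one_closed[OF i W y]]
        OF.res_tensor_pure[OF W(1) V \<alpha> y] rank_one_apply[OF V \<sigma>]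
      unfolding OF.msec_tensor
      by (rule VP.smult_pure_right[OF \<epsilon>V Om.res_closed[OF W(1) V \<alpha>] F.res_closed[OF W(1) V y], symmetric])
  qed
qed

text \<open>Applying f to the expansion of \<open>\<sigma>\<close> gives \<open>f(\<sigma>) =
  \<Sum>\<^sub>i \<epsilon>\<^sub>i(\<sigma>) f(e\<^sub>i)\<close>. The sum is formed in the module
  of endomorphisms, so evaluation at \<open>\<sigma>\<close> is moved through it as an additive
  map.\<close>

private lemma rank_one_expand:
  assumes W: "openin T W" "W \<subseteq> U" and f: "f \<in> H.sec W"
  shows "(\<Oplus>\<^bsub>msec H W\<^esub>i\<in>{..<r}. rank_one i W (f W (mres F U W (e i)))) = f"
proof -
  note f' = f[unfolded carrier_H]
  have fe: "f W (mres F U W (e i)) \<in> F.sec W" if "i < r" for i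
    by (rule sheaf_hom_closed[OF f' W(1) subset_refl db.res_e[OF that W]])
  have cl: "rank_one i W (f W (mres F U W (e i))) \<in> H.sec W" if "i \<in> {..<r}" for i
    using rank_one_closed[OF _ W fe] that by simp
  note HW = H.sec_abelian_group[OF W(1)]
  show ?thesis
  proof (rule FF.sheaf_hom_eqI[OF _ f'])
    show "(\<Oplus>\<^bsub>msec H W\<^esub>i\<in>{..<r}. rank_one i W (f W (mres F U W (e i)))) \<in> sheaf_hom T A F F W"
      using finsum_in_carrier[OF HW cl] by (simp only: carrier_H)
    fix V \<sigma> assume V: "openin T V" "V \<subseteq> W" and \<sigma>: "\<sigma> \<in> F.sec V"
    have VU: "V \<subseteq> U" using V W by auto
    note FV = F.sec_abelian_group[OF V(1)]
    have ev: "(\<lambda>h. h V \<sigma>) \<in> additive_maps (msec H W) (msec F V)"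
    proof (rule additive_mapsI)
      show "h V \<sigma> \<in> F.sec V" if "h \<in> H.sec W" for h
        by (rule sheaf_hom_closed[OF that[unfolded carrier_H] V \<sigma>])
    qed (rule FF.Hom_add_apply[OF V \<sigma>])
    have fV: "f V \<in> additive_maps (msec F V) (msec F V)"
    proof (rule additive_mapsI)
      show "f V s \<in> F.sec V" if "s \<in> F.sec V" for s
        by (rule sheaf_hom_closed[OF f' V that])
      show "f V (s \<oplus>\<^bsub>msec F V\<^esub> t) = f V s \<oplus>\<^bsub>msec F V\<^esub> f V t"
        if "s \<in> F.sec V" "t \<in> F.sec V" for s t
        by (rule sheaf_hom_add[OF f' V that])
    qed
    have term_cl: "\<epsilon> i V \<sigma> \<odot>\<^bsub>msec F V\<^esub> mres F U V (e i) \<in> F.sec V" if "i \<in> {..<r}" for i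
      using F.sec_closed(3)[OF V(1) db.\<epsilon>_closed[OF _ V(1) VU \<sigma>] db.res_e[OF _ V(1) VU]] that by simp
    have "(\<Oplus>\<^bsub>msec H W\<^esub>i\<in>{..<r}. rank_one i W (f W (mres F U W (e i)))) V \<sigma>
        = (\<Oplus>\<^bsub>msec F V\<^esub>i\<in>{..<r}. rank_one i W (f W (mres F U W (e i))) V \<sigma>)"
      by (rule additive_maps_finsum[OF HW FV ev finite_lessThan cl])
    also have "\<dots> = (\<Oplus>\<^bsub>msec F V\<^esub>i\<in>{..<r}. f V (\<epsilon> i V \<sigma> \<odot>\<^bsub>msec F V\<^esub> mres F U V (e i)))"
    proof (rule finsum_eqI[OF FV])
      fix i assume "i \<in> {..<r}"
      then have i: "i < r" by simp
      show "rank_one i W (f W (mres F U W (e i))) V \<sigma> = f V (\<epsilon> i V \<sigma> \<odot>\<^bsub>msec F V\<^esub> mres F U V (e i))"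
        unfolding rank_one_apply[OF V \<sigma>] sheaf_hom_res[OF f' W(1) subset_refl db.res_e[OF i W] V]
          F.res_res[OF db.U W(1) V(1) W(2) V(2) db.e_closed[OF i]]
          sheaf_hom_smult[OF f' V db.res_e[OF i V(1) VU] db.\<epsilon>_closed[OF i V(1) VU \<sigma>]] ..
    qed (rule additive_maps_closed[OF fV term_cl])
    also have "\<dots> = f V (\<Oplus>\<^bsub>msec F V\<^esub>i\<in>{..<r}. \<epsilon> i V \<sigma> \<odot>\<^bsub>msec F V\<^esub> mres F U V (e i))"
      by (rule additive_maps_finsum[OF FV FV fV finite_lessThan term_cl, symmetric])
    also have "\<dots> = f V \<sigma>" unfolding db.expand[OF V(1) VU \<sigma>] ..
    finally show "(\<Oplus>\<^bsub>msec H W\<^esub>i\<in>{..<r}. rank_one i W (f W (mres F U W (e i)))) V \<sigma> = f V \<sigma>" .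
  qed
qed

text \<open>On a pure tensor \<open>\<alpha> \<otimes> f\<close> the sum becomes \<open>\<alpha>
  \<otimes> \<Sum>\<^sub>i \<epsilon>\<^sub>i(-) f(e\<^sub>i)\<close>, and
  \<open>rank_one_expand\<close> turns the second factor into f.\<close>

private lemma tensor_rank_one_expand:
  assumes W: "openin T W" "W \<subseteq> U" and s: "s \<in> P.sec W"
  shows "(\<Oplus>\<^bsub>msec P W\<^esub>i\<in>{..<r}. tensor_rank_one i W (contract W W (mres F U W (e i)) s)) = s"
proof -
  interpret WP: tensor_pair "rsec A W" "msec \<Omega> W" "msec H W" by (rule OH.tensor_pair[OF W(1)])
  note PW = P.sec_abelian_group[OF W(1)] and HW = H.sec_abelian_group[OF W(1)]
  have add: "(\<lambda>s. tensor_rank_one i W (contract W W (mres F U W (e i)) s)) \<in> additive_maps (msec P W) (msec P W)"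
    if "i \<in> {..<r}" for i
    using additive_maps_comp[OF contract_additive[OF W(1,1) subset_refl db.res_e[OF _ W]] tensor_rank_one_additive[OF _ W]]
      that by simp
  have id: "(\<lambda>s. s) \<in> additive_maps (msec P W) (msec P W)" by (simp add: additive_maps_def)
  show ?thesis
  proof (rule OH.tensor_eqI[OF W(1) PW additive_maps_finsum_fun[OF PW finite_lessThan add] id _ s])
    fix \<alpha> f assume \<alpha>: "\<alpha> \<in> Om.sec W" and f: "f \<in> H.sec W"
    note f' = f[unfolded carrier_H]
    have fe: "f W (mres F U W (e i)) \<in> F.sec W" if "i < r" for i
      by (rule sheaf_hom_closed[OF f' W(1) subset_refl db.res_e[OF that W]])
    have cl: "rank_one i W (f W (mres F U W (e i))) \<in> H.sec W" if "i \<in> {..<r}" for i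
      using rank_one_closed[OF _ W fe] that by simp
    have pure: "OH.pureT W \<alpha> \<in> additive_maps (msec H W) (msec P W)"
      unfolding OH.msec_tensor
      by (rule additive_mapsI) (simp_all only: WP.pure_closed[OF \<alpha>] WP.pure_add_right[OF \<alpha>])
    have "(\<Oplus>\<^bsub>msec P W\<^esub>i\<in>{..<r}. tensor_rank_one i W (contract W W (mres F U W (e i)) (OH.pureT W \<alpha> f)))
        = (\<Oplus>\<^bsub>msec P W\<^esub>i\<in>{..<r}. OH.pureT W \<alpha> (rank_one i W (f W (mres F U W (e i)))))"
    proof (rule finsum_eqI[OF PW])
      fix i assume "i \<in> {..<r}"
      then have i: "i < r" by simp
      show "tensor_rank_one i W (contract W W (mres F U W (e i)) (OH.pureT W \<alpha> f))
          = OH.pureT W \<alpha> (rank_one i W (f W (mres F U W (e i))))"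
        unfolding contract_pure[OF W(1,1) subset_refl db.res_e[OF i W] \<alpha> f] Om.res_id[OF W(1) \<alpha>]
          tensor_rank_one_pure[OF i W \<alpha> fe[OF i]] ..
    qed (rule OH.pureT_closed[OF W(1) \<alpha> cl])
    also have "\<dots> = OH.pureT W \<alpha> (\<Oplus>\<^bsub>msec H W\<^esub>i\<in>{..<r}. rank_one i W (f W (mres F U W (e i))))"
      by (rule additive_maps_finsum[OF HW PW pure finite_lessThan cl, symmetric])
    also have "\<dots> = OH.pureT W \<alpha> f" unfolding rank_one_expand[OF W f] ..
    finally show "(\<Oplus>\<^bsub>msec P W\<^esub>i\<in>{..<r}. tensor_rank_one i W (contract W W (mres F U W (e i)) (OH.pureT W \<alpha> f)))
        = OH.pureT W \<alpha> f" .
  qed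
qed

text \<open>Each index gives a neighbourhood of x on which the two contractions agree. On their
  finite intersection the tensors have equal contractions with all \<open>e\<^sub>i\<close>, and the
  expansion recovers each tensor from these.\<close>

lemma germ_eq_of_contractions:
  assumes W: "openin T W" "W \<subseteq> U" "x \<in> W" and s: "s \<in> P.sec W" and s': "s' \<in> P.sec W"
    and eq: "\<And>i. i < r \<Longrightarrow> germ T Q x W (contract W W (mres F U W (e i)) s)
      = germ T Q x W (contract W W (mres F U W (e i)) s')"
  shows "germ T P x W s = germ T P x W s'"
proof -
  let ?c = "\<lambda>i s. contract W W (mres F U W (e i)) s"
  have ex: "\<exists>O1. openin T O1 \<and> x \<in> O1 \<and> O1 \<subseteq> W \<and> mres Q W O1 (?c i s) = mres Q W O1 (?c i s')" if i: "i < r" for i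
  proof -
    note cl = contract_closed[OF W(1,1) subset_refl db.res_e[OF i W(1,2)] s]
    obtain O1 where "openin T O1" "x \<in> O1" "O1 \<subseteq> W" "O1 \<subseteq> W" "mres Q W O1 (?c i s) = mres Q W O1 (?c i s')"
      using Q.germ_eqE[OF eq[OF i] W(1,3) cl] .
    then show ?thesis by metis
  qed
  obtain N where N: "\<And>i. i < r \<Longrightarrow> openin T (N i) \<and> x \<in> N i \<and> N i \<subseteq> W \<and> mres Q W (N i) (?c i s) = mres Q W (N i) (?c i s')"
    using ex by metis
  \<comment> \<open>Intersecting with W covers rank 0, where the intersection of the empty family is
    the whole type and need not be open.\<close>
  define Z where "Z = W \<inter> (\<Inter>i\<in>{..<r}. N i)"
  have Z: "openin T Z" "Z \<subseteq> W"
  proof -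
    have "openin T (W \<inter> \<Inter>(N ` {..<r}))"
    proof (cases "r = 0")
      case False
      then show ?thesis using N W(1) by (intro openin_Int openin_Inter) auto
    qed (use W in simp)
    then show "openin T Z" by (simp add: Z_def)
  qed (simp add: Z_def)
  have xZ: "x \<in> Z" using N W(3) by (auto simp: Z_def)
  have ZU: "Z \<subseteq> U" using Z W by auto
  \<comment> \<open>The restriction of the tensor is absorbed on the left, and then the restriction
    of the section is moved to the outside on the right.\<close>
  have res: "contract Z Z (mres F U Z (e i)) (mres P W Z t) = mres Q W Z (?c i t)"
    if i: "i < r" and t: "t \<in> P.sec W" for i t
    unfolding contract_res_left[OF W(1) Z Z(1) subset_refl db.res_e[OF i Z(1) ZU] t]
      contract_res_right[OF W(1,1) subset_refl Z db.res_e[OF i W(1,2)] t]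
      F.res_res[OF db.U W(1) Z(1) W(2) Z(2) db.e_closed[OF i]] ..
  have eqZ: "mres Q W Z (?c i s) = mres Q W Z (?c i s')" if i: "i < r" for i
  proof -
    note Ni = N[OF i]
    have ZN: "Z \<subseteq> N i" using i by (auto simp: Z_def)
    have *: "mres Q W Z (?c i t) = mres Q (N i) Z (mres Q W (N i) (?c i t))" if t: "t \<in> P.sec W" for t
      using Q.res_res[OF W(1) _ Z(1) _ ZN contract_closed[OF W(1,1) subset_refl db.res_e[OF i W(1,2)] t]] Ni by metis
    show ?thesis unfolding *[OF s] *[OF s'] using Ni by metis
  qed
  note sZ = P.res_closed[OF W(1) Z s] and sZ' = P.res_closed[OF W(1) Z s']
  have "mres P W Z s = (\<Oplus>\<^bsub>msec P Z\<^esub>i\<in>{..<r}. tensor_rank_one i Z (contract Z Z (mres F U Z (e i)) (mres P W Z s)))"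
    by (rule tensor_rank_one_expand[OF Z(1) ZU sZ, symmetric])
  also have "\<dots> = (\<Oplus>\<^bsub>msec P Z\<^esub>i\<in>{..<r}. tensor_rank_one i Z (contract Z Z (mres F U Z (e i)) (mres P W Z s')))"
  proof (rule finsum_eqI[OF P.sec_abelian_group[OF Z(1)]])
    fix i assume "i \<in> {..<r}"
    then have i: "i < r" by simp
    show "tensor_rank_one i Z (contract Z Z (mres F U Z (e i)) (mres P W Z s))
        = tensor_rank_one i Z (contract Z Z (mres F U Z (e i)) (mres P W Z s'))"
      unfolding res[OF i s] res[OF i s'] eqZ[OF i] ..
    show "tensor_rank_one i Z (contract Z Z (mres F U Z (e i)) (mres P W Z s')) \<in> P.sec Z"
      by (rule additive_maps_closed[OF tensor_rank_one_additive[OF i Z(1) ZU]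
          contract_closed[OF Z(1,1) subset_refl db.res_e[OF i Z(1) ZU] sZ']])
  qed
  also have "\<dots> = mres P W Z s'" by (rule tensor_rank_one_expand[OF Z(1) ZU sZ'])
  finally show ?thesis
    using P.germ_eqI[OF W(1,1) s s' Z(1) xZ Z(2,2)] by blast
qed

text \<open>The preimage is \<open>\<Sum>\<^sub>i \<lambda>\<^sub>i(q\<^sub>i)\<close>. Its
  contraction with \<open>\<sigma>\<close> is
  \<open>\<Sum>\<^sub>i \<epsilon>\<^sub>i(\<sigma>) q\<^sub>i\<close>, which maps to
  \<open>\<Sum>\<^sub>i \<epsilon>\<^sub>i(\<sigma>) t(e\<^sub>i) = t(\<sigma>)\<close>. The
  conclusion covers all V \<subseteq> W because local preimages are later compared and evaluated on
  smaller sets.\<close>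

lemma local_preimage:
  assumes t: "t \<in> sheaf_hom T A F QS W" and W: "openin T W" "W \<subseteq> U"
    and q: "\<And>i. i < r \<Longrightarrow> Q.represents W (t W (mres F U W (e i))) (q i)"
  shows "\<exists>s\<in>P.sec W. \<forall>V \<sigma>. openin T V \<and> V \<subseteq> W \<and> \<sigma> \<in> F.sec V \<longrightarrow>
      Q.represents V (t V \<sigma>) (contract W V \<sigma> s)"
proof (intro bexI allI impI; (elim conjE)?)
  let ?s = "\<Oplus>\<^bsub>msec P W\<^esub>i\<in>{..<r}. tensor_rank_one i W (q i)"
  note PW = P.sec_abelian_group[OF W(1)]
  have qc: "q i \<in> Q.sec W" if "i < r" for i by (rule Q.representsD(2)[OF q[OF that]])
  have cl: "tensor_rank_one i W (q i) \<in> P.sec W" if "i \<in> {..<r}" for i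
    using additive_maps_closed[OF tensor_rank_one_additive[OF _ W] qc] that by simp
  show "?s \<in> P.sec W" by (rule finsum_in_carrier[OF PW cl])
  fix V \<sigma> assume V: "openin T V" "V \<subseteq> W" and \<sigma>: "\<sigma> \<in> F.sec V"
  have VU: "V \<subseteq> U" using V W by auto
  note FV = F.sec_abelian_group[OF V(1)] and QV = Q.sec_abelian_group[OF V(1)] and QSV = QS.sec_abelian_group[OF V(1)]
  note ct = contract_additive[OF W(1) V \<sigma>]
  \<comment> \<open>As \<open>q i\<close> represents the value over all of W, the value is the image
    of \<open>q i\<close> there; naturality of t carries this to V.\<close>
  have ti: "t V (mres F U V (e i)) = Q.toS V (mres Q W V (q i))" if i: "i < r" for i
  proof -
    have "t W (mres F U W (e i)) = Q.toS W (q i)"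
      by (rule Q.represents_imp_eq[OF q[OF i] Q.sheafify_extensional[OF sheaf_hom_closed[OF t W(1) subset_refl db.res_e[OF i W]]]])
    then have "mres QS W V (t W (mres F U W (e i))) = Q.toS V (mres Q W V (q i))"
      unfolding Q.mres_sheafify by (simp only: Q.restrict_to_sheafify[OF W(1) V qc[OF i]])
    then show ?thesis
      unfolding sheaf_hom_res[OF t W(1) subset_refl db.res_e[OF i W] V]
        F.res_res[OF db.U W(1) V(1) W(2) V(2) db.e_closed[OF i]] .
  qed
  have c2: "mres Q W V (q i) \<in> Q.sec V" if "i < r" for i
    by (rule Q.res_closed[OF W(1) V qc[OF that]])
  have c1: "\<epsilon> i V \<sigma> \<odot>\<^bsub>msec Q V\<^esub> mres Q W V (q i) \<in> Q.sec V" if "i \<in> {..<r}" for i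
    using Q.sec_closed(3)[OF V(1) db.\<epsilon>_closed[OF _ V(1) VU \<sigma>] c2] that by simp
  have c3: "\<epsilon> i V \<sigma> \<odot>\<^bsub>msec F V\<^esub> mres F U V (e i) \<in> F.sec V" if "i \<in> {..<r}" for i
    using F.sec_closed(3)[OF V(1) db.\<epsilon>_closed[OF _ V(1) VU \<sigma>] db.res_e[OF _ V(1) VU]] that by simp
  have tV: "t V \<in> additive_maps (msec F V) (msec QS V)"
  proof (rule additive_mapsI)
    show "t V s \<in> QS.sec V" if "s \<in> F.sec V" for s
      by (rule sheaf_hom_closed[OF t V that])
    show "t V (s \<oplus>\<^bsub>msec F V\<^esub> u) = t V s \<oplus>\<^bsub>msec QS V\<^esub> t V u"
      if "s \<in> F.sec V" "u \<in> F.sec V" for s u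
      by (rule sheaf_hom_add[OF t V that])
  qed
  have "contract W V \<sigma> ?s = (\<Oplus>\<^bsub>msec Q V\<^esub>i\<in>{..<r}. contract W V \<sigma> (tensor_rank_one i W (q i)))"
    by (rule additive_maps_finsum[OF PW QV ct finite_lessThan cl])
  also have "\<dots> = (\<Oplus>\<^bsub>msec Q V\<^esub>i\<in>{..<r}. \<epsilon> i V \<sigma> \<odot>\<^bsub>msec Q V\<^esub> mres Q W V (q i))"
    by (rule finsum_eqI[OF QV _ c1]) (simp add: contract_tensor_rank_one[OF _ W V \<sigma> qc])
  finally have "Q.toS V (contract W V \<sigma> ?s)
      = Q.toS V (\<Oplus>\<^bsub>msec Q V\<^esub>i\<in>{..<r}. \<epsilon> i V \<sigma> \<odot>\<^bsub>msec Q V\<^esub> mres Q W V (q i))" by (rule arg_cong)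
  also have "\<dots> = (\<Oplus>\<^bsub>msec QS V\<^esub>i\<in>{..<r}. Q.toS V (\<epsilon> i V \<sigma> \<odot>\<^bsub>msec Q V\<^esub> mres Q W V (q i)))"
    by (rule additive_maps_finsum[OF QV QSV Q.to_sheafify_additive[OF V(1)] finite_lessThan c1])
  also have "\<dots> = (\<Oplus>\<^bsub>msec QS V\<^esub>i\<in>{..<r}. t V (\<epsilon> i V \<sigma> \<odot>\<^bsub>msec F V\<^esub> mres F U V (e i)))"
  proof (rule finsum_eqI[OF QSV])
    fix i assume "i \<in> {..<r}"
    then have i: "i < r" by simp
    note \<epsilon>V = db.\<epsilon>_closed[OF i V(1) VU \<sigma>]
    show "Q.toS V (\<epsilon> i V \<sigma> \<odot>\<^bsub>msec Q V\<^esub> mres Q W V (q i)) = t V (\<epsilon> i V \<sigma> \<odot>\<^bsub>msec F V\<^esub> mres F U V (e i))"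
      unfolding Q.to_sheafify_smult[OF V(1) \<epsilon>V c2[OF i]] sheaf_hom_smult[OF t V db.res_e[OF i V(1) VU] \<epsilon>V] ti[OF i] ..
  qed (rule additive_maps_closed[OF tV c3])
  also have "\<dots> = t V (\<Oplus>\<^bsub>msec F V\<^esub>i\<in>{..<r}. \<epsilon> i V \<sigma> \<odot>\<^bsub>msec F V\<^esub> mres F U V (e i))"
    by (rule additive_maps_finsum[OF FV QSV tV finite_lessThan c3, symmetric])
  also have "\<dots> = t V \<sigma>" unfolding db.expand[OF V(1) VU \<sigma>] ..
  finally have eq: "Q.toS V (contract W V \<sigma> ?s) = t V \<sigma>" .
  show "Q.represents V (t V \<sigma>) (contract W V \<sigma> ?s)"
    unfolding eq[symmetric]
    by (rule Q.represents_to_sheafify[OF V(1) additive_maps_closed[OF ct finsum_in_carrier[OF PW cl]]])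
qed

end

end

section \<open>From local freeness to a dual basis\<close>

context module_presheaf_on
begin

text \<open>A trivialisation f over \<open>U\<close> sends the standard basis sections to the
  \<open>e\<^sub>i\<close>; the form \<open>\<epsilon>\<^sub>i\<close> is the i-th coordinate of the
  inverse of f. Linearity and naturality of the forms are transported along the bijections
  \<open>f V\<close>.\<close>

lemma locally_free_imp_dual_basis:
  assumes lf: "locally_free T A P" and x: "x \<in> topspace T"
  shows "\<exists>U r e \<epsilon>. x \<in> U \<and> dual_basis T A P U r e \<epsilon>"
proof -
  obtain U r f where U: "openin T U" "x \<in> U" and f: "f \<in> sheaf_hom T A (free_sheaf A r) P U"
    and bij: "\<And>V. V \<in> opens_in T U \<Longrightarrow> bij_betw (f V) (carrier (msec (free_sheaf A r) V)) (sec V)"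
    using lf x unfolding locally_free_def by metis
  let ?S = "free_sheaf A r"
  have carS: "carrier (msec ?S V) = ({..<r} \<rightarrow>\<^sub>E carrier (rsec A V))" for V by (simp add: free_sheaf_def)
  have addS: "s \<oplus>\<^bsub>msec ?S V\<^esub> t = (\<lambda>i\<in>{..<r}. s i \<oplus>\<^bsub>rsec A V\<^esub> t i)" for s t V by (simp add: free_sheaf_def)
  have smS: "a \<odot>\<^bsub>msec ?S V\<^esub> s = (\<lambda>i\<in>{..<r}. a \<otimes>\<^bsub>rsec A V\<^esub> s i)" for a s V by (simp add: free_sheaf_def)
  have resS: "mres ?S V W s = (\<lambda>i\<in>{..<r}. rres A V W (s i))" for s V W by (simp add: free_sheaf_def)
  define \<delta> where "\<delta> i V = (\<lambda>j\<in>{..<r}. if j = i then \<one>\<^bsub>rsec A V\<^esub> else \<zero>\<^bsub>rsec A V\<^esub>)" for i :: nat and V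
  define e where "e i = f U (\<delta> i U)" for i
  define \<epsilon> where "\<epsilon> i V s = inv_into (carrier (msec ?S V)) (f V) s i" for i :: nat and V s
  have coord: "\<exists>c\<in>carrier (msec ?S V). s = f V c" if "openin T V" "V \<subseteq> U" "s \<in> sec V" for V s
    using bij[of V] that by (auto simp: mem_opens_in bij_betw_def)
  have \<epsilon>: "\<epsilon> i V (f V c) = c i" if "openin T V" "V \<subseteq> U" "c \<in> carrier (msec ?S V)" for i V c
    unfolding \<epsilon>_def using bij[of V] that by (simp add: mem_opens_in bij_betw_def)
  note fD = sheaf_homD[OF f]
  have \<delta>: "\<delta> i V \<in> carrier (msec ?S V)" if "openin T V" for i V
  proof -
    interpret A: cring "rsec A V" by (rule A_cring[OF that])
    show ?thesis unfolding carS \<delta>_def by auto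
  qed
  have e_res: "mres P U V (e i) = f V (\<delta> i V)" if V: "openin T V" "V \<subseteq> U" for i V
  proof -
    have "mres ?S U V (\<delta> i U) = \<delta> i V"
      unfolding resS \<delta>_def by (rule restrict_ext) (simp add: A_res_one[OF U(1) V] A_res_zero[OF U(1) V])
    then show ?thesis unfolding e_def using fD(4)[OF U(1) subset_refl \<delta>[OF U(1)] V] by metis
  qed
  have S_closed: "s \<oplus>\<^bsub>msec ?S V\<^esub> t \<in> carrier (msec ?S V)" "a \<odot>\<^bsub>msec ?S V\<^esub> s \<in> carrier (msec ?S V)"
    if "openin T V" "s \<in> carrier (msec ?S V)" "t \<in> carrier (msec ?S V)" "a \<in> carrier (rsec A V)" for V s t a
  proof -
    interpret A: cring "rsec A V" by (rule A_cring[OF that(1)])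
    show "s \<oplus>\<^bsub>msec ?S V\<^esub> t \<in> carrier (msec ?S V)" "a \<odot>\<^bsub>msec ?S V\<^esub> s \<in> carrier (msec ?S V)"
      using that(2-4) unfolding carS addS smS by (auto simp: PiE_iff)
  qed
  have "dual_basis T A P U r e \<epsilon>"
  proof (intro dual_basis.intro module_presheaf_on_axioms dual_basis_axioms.intro)
    show "openin T U" by (rule U)
    show "e i \<in> sec U" for i
      unfolding e_def by (rule fD(1)[OF U(1) subset_refl \<delta>[OF U(1)]])
  next
    fix i V assume i: "i < r" and V: "openin T V" "V \<subseteq> U"
    interpret A: cring "rsec A V" by (rule A_cring[OF V(1)])
    show "\<epsilon> i V \<in> additive_maps (msec P V) (rsec A V)"
    proof (rule additive_mapsI)
      fix s assume "s \<in> sec V"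
      then obtain c where c: "c \<in> carrier (msec ?S V)" "s = f V c" using coord[OF V] by blast
      show "\<epsilon> i V s \<in> carrier (rsec A V)"
        using c(1) i unfolding c(2) \<epsilon>[OF V c(1)] carS by auto
      fix t assume "t \<in> sec V"
      then obtain d where d: "d \<in> carrier (msec ?S V)" "t = f V d" using coord[OF V] by blast
      have "f V c \<oplus>\<^bsub>msec P V\<^esub> f V d = f V (c \<oplus>\<^bsub>msec ?S V\<^esub> d)"
        by (rule fD(2)[OF V c(1) d(1), symmetric])
      then show "\<epsilon> i V (s \<oplus>\<^bsub>msec P V\<^esub> t) = \<epsilon> i V s \<oplus>\<^bsub>rsec A V\<^esub> \<epsilon> i V t"
        unfolding c(2) d(2) \<epsilon>[OF V c(1)] \<epsilon>[OF V d(1)]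
        using \<epsilon>[OF V S_closed(1)[OF V(1) c(1) d(1) A.one_closed]] i by (simp add: addS)
    qed
    fix s assume s: "s \<in> sec V"
    then obtain c where c: "c \<in> carrier (msec ?S V)" "s = f V c" using coord[OF V] by blast
    show "\<epsilon> i V (a \<odot>\<^bsub>msec P V\<^esub> s) = a \<otimes>\<^bsub>rsec A V\<^esub> \<epsilon> i V s" if a: "a \<in> carrier (rsec A V)" for a
      unfolding c(2) \<epsilon>[OF V c(1)] fD(3)[OF V c(1) a, symmetric]
      using \<epsilon>[OF V S_closed(2)[OF V(1) c(1) c(1) a]] i by (simp add: smS)
    show "rres A V W (\<epsilon> i V s) = \<epsilon> i W (mres P V W s)" if W: "openin T W" "W \<subseteq> V" for W
    proof -
      have WU: "W \<subseteq> U" using W V by auto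
      have "mres ?S V W c \<in> carrier (msec ?S W)"
        using c(1) A_res_closed[OF V(1) W] unfolding carS resS by (auto simp: PiE_iff)
      then show ?thesis
        unfolding c(2) \<epsilon>[OF V c(1)] fD(4)[OF V c(1) W] using \<epsilon>[OF W(1) WU] i by (simp add: resS)
    qed
  next
    fix V s assume V: "openin T V" "V \<subseteq> U" and "s \<in> sec V"
    then obtain c where c: "c \<in> carrier (msec ?S V)" "s = f V c" using coord[OF V] by blast
    interpret A: cring "rsec A V" by (rule A_cring[OF V(1)])
    interpret M: module "rsec A V" "msec P V" by (rule sec_module[OF V(1)])
    have ci: "c i \<in> carrier (rsec A V)" if "i < r" for i using c(1) that unfolding carS by auto
    \<comment> \<open>Truncations of the coordinate vector c: the induction on k adds one basis term
      at a time, and so needs only additivity and homogeneity of \<open>f V\<close>, without a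
      finite sum inside the free sheaf.\<close>
    define tr where "tr k = (\<lambda>i\<in>{..<r}. if i < k then c i else \<zero>\<^bsub>rsec A V\<^esub>)" for k
    have tr: "tr k \<in> carrier (msec ?S V)" for k unfolding carS tr_def using ci by auto
    have f\<delta>: "f V (\<delta> i V) \<in> sec V" for i by (rule fD(1)[OF V \<delta>[OF V(1)]])
    have "k \<le> r \<Longrightarrow> f V (tr k) = (\<Oplus>\<^bsub>msec P V\<^esub>i\<in>{..<k}. c i \<odot>\<^bsub>msec P V\<^esub> f V (\<delta> i V))" for k
    proof (induction k)
      case 0
      \<comment> \<open>The zero vector is idempotent under addition, which forces its image to be
        zero.\<close>
      have "tr 0 \<oplus>\<^bsub>msec ?S V\<^esub> tr 0 = tr 0" unfolding addS tr_def by (rule restrict_ext) simp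
      then have "f V (tr 0) \<oplus>\<^bsub>msec P V\<^esub> f V (tr 0) = f V (tr 0)" using fD(2)[OF V tr tr, of 0 0] by simp
      then have "f V (tr 0) = \<zero>\<^bsub>msec P V\<^esub>" by (rule M.idem_add_zero[OF fD(1)[OF V tr]])
      then show ?case by simp
    next
      case (Suc k)
      then have k: "k < r" by simp
      have "tr (Suc k) = (c k \<odot>\<^bsub>msec ?S V\<^esub> \<delta> k V) \<oplus>\<^bsub>msec ?S V\<^esub> tr k"
        unfolding addS smS tr_def \<delta>_def
        by (rule restrict_ext) (use ci ci[OF k] in \<open>auto simp: less_Suc_eq\<close>)
      then have "f V (tr (Suc k)) = c k \<odot>\<^bsub>msec P V\<^esub> f V (\<delta> k V) \<oplus>\<^bsub>msec P V\<^esub> f V (tr k)"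
        using fD(2)[OF V S_closed(2)[OF V(1) \<delta>[OF V(1)] tr ci[OF k]] tr] fD(3)[OF V \<delta>[OF V(1)] ci[OF k]] by metis
      also have "f V (tr k) = (\<Oplus>\<^bsub>msec P V\<^esub>i\<in>{..<k}. c i \<odot>\<^bsub>msec P V\<^esub> f V (\<delta> i V))" using Suc by simp
      finally show ?case
        using k ci f\<delta> by (simp add: lessThan_Suc M.finsum_insert Pi_iff)
    qed
    from this[of r] have "f V (tr r) = (\<Oplus>\<^bsub>msec P V\<^esub>i\<in>{..<r}. c i \<odot>\<^bsub>msec P V\<^esub> f V (\<delta> i V))" by simp
    moreover have "tr r = c"
      using c(1) unfolding carS tr_def by (intro extensionalityI[of _ "{..<r}"]) (auto simp: PiE_iff)
    ultimately show "(\<Oplus>\<^bsub>msec P V\<^esub>i\<in>{..<r}. \<epsilon> i V s \<odot>\<^bsub>msec P V\<^esub> mres P U V (e i)) = s"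
      unfolding c(2) e_res[OF V] \<epsilon>[OF V c(1)] by simp
  qed
  then show ?thesis using U(2) by metis
qed

end

section \<open>Bijectivity of the contraction for a locally free module\<close>

context contraction_data
begin

text \<open>Around x both sections have representatives over one set W inside a trivialising set.
  Equal contractions, evaluated at the restricted \<open>e\<^sub>i\<close>, have equal germs at x,
  so \<open>germ_eq_of_contractions\<close> applies.\<close>

lemma contraction_inj:
  assumes lf: "locally_free T A F"
    and g: "g \<in> PS.sec TT" and h: "h \<in> PS.sec TT"
    and eq: "contraction T A \<Omega> F g = contraction T A \<Omega> F h"
  shows "g = h"
proof (rule extensionalityI)
  show "g \<in> extensional TT" "h \<in> extensional TT" using g h by (simp_all add: P.carrier_sheafify_iff)
  fix x assume x: "x \<in> TT"
  obtain U r e \<epsilon> where U: "x \<in> U" and db: "dual_basis T A F U r e \<epsilon>"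
    using F.locally_free_imp_dual_basis[OF lf x] by metis
  note Uo = dual_basis.U[OF db]
  obtain V s where V: "openin T V" "x \<in> V" "V \<subseteq> U" "P.represents V g s"
    using represented_within[OF g Uo U] .
  obtain W s' where W: "openin T W" "x \<in> W" "W \<subseteq> V" "P.represents W h s'"
    using represented_within[OF h V(1,2)] .
  have WU: "W \<subseteq> U" using V W by auto
  have g': "P.represents W g (mres P V W s)" by (rule P.represents_res[OF V(4) W(1,3)])
  have "germ T P x W (mres P V W s) = germ T P x W s'"
  proof (rule germ_eq_of_contractions[OF db W(1) WU W(2)])
    show "mres P V W s \<in> P.sec W" "s' \<in> P.sec W"
      using P.representsD(2) g' W(4) by auto
    fix i assume i: "i < r"
    have e: "mres F U W (e i) \<in> F.sec W"
      by (rule F.res_closed[OF Uo W(1) WU dual_basis.e_closed[OF db i]])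
    show "germ T Q x W (contract W W (mres F U W (e i)) (mres P V W s))
        = germ T Q x W (contract W W (mres F U W (e i)) s')"
      using Q.representsD(3)[OF represents_contraction[OF g W(1) e g' subset_refl] W(2)]
        Q.representsD(3)[OF represents_contraction[OF h W(1) e W(4) subset_refl] W(2)]
      unfolding F.res_id[OF W(1) e] eq by simp
  qed
  then show "g x = h x" using P.representsD(3)[OF g' W(2)] P.representsD(3)[OF W(4,2)] by simp
qed

text \<open>Good pairs exist around every point by \<open>local_preimage\<close>. Two of them around
  x have the same contractions with a dual basis near x, namely the values of \<open>t\<close>, and
  therefore the same germ.\<close>

lemma contraction_surj:
  assumes lf: "locally_free T A F" and t: "t \<in> sheaf_hom T A F QS TT"
  shows "\<exists>g\<in>PS.sec TT. contraction T A \<Omega> F g = t"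
proof -
  \<comment> \<open>All tensors that contract to \<open>t\<close> over their whole domain, including
    its open subsets.\<close>
  define good where "good W s \<longleftrightarrow> openin T W \<and> s \<in> P.sec W \<and>
     (\<forall>V \<sigma>. openin T V \<and> V \<subseteq> W \<and> \<sigma> \<in> F.sec V \<longrightarrow> Q.represents V (t V \<sigma>) (contract W V \<sigma> s))" for W s
  have goodD: "openin T W" "s \<in> P.sec W"
    "\<And>V \<sigma>. openin T V \<Longrightarrow> V \<subseteq> W \<Longrightarrow> \<sigma> \<in> F.sec V \<Longrightarrow> Q.represents V (t V \<sigma>) (contract W V \<sigma> s)"
    if "good W s" for W s
    using that unfolding good_def by simp_all
  have ex: "\<exists>W s. x \<in> W \<and> good W s" if x: "x \<in> TT" for x
  proof -
    obtain U r e \<epsilon> where U: "x \<in> U" and db: "dual_basis T A F U r e \<epsilon>"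
      using F.locally_free_imp_dual_basis[OF lf x] by metis
    note Uo = dual_basis.U[OF db] and e = dual_basis.e_closed[OF db]
    note UT = openin_subset[OF Uo]
    have "\<exists>N q. openin T N \<and> x \<in> N \<and> Q.represents N (t U (e i)) q" if i: "i < r" for i
      using Q.represented[OF sheaf_hom_closed[OF t Uo UT e[OF i]] U] by metis
    then obtain N q where N: "\<And>i. i < r \<Longrightarrow> openin T (N i) \<and> x \<in> N i \<and> Q.represents (N i) (t U (e i)) (q i)"
      by metis
    \<comment> \<open>On the intersection all the finitely many values \<open>t(e\<^sub>i)\<close>
      come from tensors at once; the factor U keeps the set inside the frame, also in rank
      0.\<close>
    define Z where "Z = U \<inter> (\<Inter>i\<in>{..<r}. N i)"
    have Z: "openin T Z"
    proof (cases "r = 0")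
      case False
      then have "openin T (\<Inter>(N ` {..<r}))" using N by (intro openin_Inter) auto
      then show ?thesis unfolding Z_def by (intro openin_Int Uo)
    qed (use Uo in \<open>simp add: Z_def\<close>)
    have ZU: "Z \<subseteq> U" and xZ: "x \<in> Z" using N U by (auto simp: Z_def)
    have ZT: "Z \<subseteq> TT" using ZU UT by auto
    let ?t = "mres HQ TT Z t"
    have "\<exists>s\<in>P.sec Z. \<forall>V \<sigma>. openin T V \<and> V \<subseteq> Z \<and> \<sigma> \<in> F.sec V \<longrightarrow>
        Q.represents V (?t V \<sigma>) (contract Z V \<sigma> s)"
    proof (rule local_preimage[OF db FQ.Hom_res_closed[OF openin_topspace Z ZT t] Z ZU])
      fix i assume i: "i < r"
      note Ni = N[OF i]
      have ZN: "Z \<subseteq> N i" using i by (auto simp: Z_def)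
      have eZ: "mres F U Z (e i) \<in> F.sec Z" by (rule F.res_closed[OF Uo Z ZU e[OF i]])
      have "Q.represents Z (restrict (t U (e i)) Z) (mres Q (N i) Z (q i))"
        unfolding Q.represents_restrict_iff[OF subset_refl]
        using Q.represents_res[OF _ Z ZN] Ni by metis
      moreover have "restrict (t U (e i)) Z = t Z (mres F U Z (e i))"
        using sheaf_hom_res[OF t Uo UT e[OF i] Z ZU] unfolding Q.mres_sheafify .
      ultimately show "Q.represents Z (?t Z (mres F U Z (e i))) (mres Q (N i) Z (q i))"
        unfolding FQ.Hom_res_apply[OF Z subset_refl eZ] by simp
    qed
    then obtain s where s: "s \<in> P.sec Z"
      and rep: "\<And>V \<sigma>. openin T V \<Longrightarrow> V \<subseteq> Z \<Longrightarrow> \<sigma> \<in> F.sec V \<Longrightarrow>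
        Q.represents V (?t V \<sigma>) (contract Z V \<sigma> s)" by metis
    have "Q.represents V (t V \<sigma>) (contract Z V \<sigma> s)"
      if V: "openin T V" "V \<subseteq> Z" "\<sigma> \<in> F.sec V" for V \<sigma>
      using rep[OF V] unfolding FQ.Hom_res_apply[OF V] .
    then have "good Z s" unfolding good_def using Z s by simp
    then show ?thesis using xZ by metis
  qed
  have unique: "germ T P x W s = germ T P x W' s'"
    if W: "good W s" "x \<in> W" and W': "good W' s'" "x \<in> W'" for x W s W' s'
  proof -
    note D = goodD[OF W(1)] and D' = goodD[OF W'(1)]
    have x: "x \<in> TT" using openin_subset[OF D(1)] W(2) by auto
    obtain U r e \<epsilon> where U: "x \<in> U" and db: "dual_basis T A F U r e \<epsilon>"
      using F.locally_free_imp_dual_basis[OF lf x] by metis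
    note Uo = dual_basis.U[OF db] and e = dual_basis.e_closed[OF db]
    define Z where "Z = U \<inter> (W \<inter> W')"
    have Z: "openin T Z" unfolding Z_def by (intro openin_Int Uo D(1) D'(1))
    have sub: "Z \<subseteq> U" "Z \<subseteq> W" "Z \<subseteq> W'" "x \<in> Z" using U W(2) W'(2) by (auto simp: Z_def)
    have "germ T P x Z (mres P W Z s) = germ T P x Z (mres P W' Z s')"
    proof (rule germ_eq_of_contractions[OF db Z sub(1,4) P.res_closed[OF D(1) Z sub(2) D(2)]
          P.res_closed[OF D'(1) Z sub(3) D'(2)]])
      fix i assume i: "i < r"
      have eZ: "mres F U Z (e i) \<in> F.sec Z" by (rule F.res_closed[OF Uo Z sub(1) e[OF i]])
      show "germ T Q x Z (contract Z Z (mres F U Z (e i)) (mres P W Z s))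
          = germ T Q x Z (contract Z Z (mres F U Z (e i)) (mres P W' Z s'))"
        unfolding contract_res_left[OF D(1) Z sub(2) Z subset_refl eZ D(2)]
          contract_res_left[OF D'(1) Z sub(3) Z subset_refl eZ D'(2)]
        using Q.representsD(3)[OF D(3)[OF Z sub(2) eZ] sub(4)] Q.representsD(3)[OF D'(3)[OF Z sub(3) eZ] sub(4)]
        by simp
    qed
    then show ?thesis
      unfolding P.germ_res[OF D(1) Z sub(2,4) D(2)] P.germ_res[OF D'(1) Z sub(3,4) D'(2)] .
  qed
  have "\<exists>g\<in>PS.sec TT. \<forall>W s. good W s \<longrightarrow> P.represents W g s"
  proof (rule P.glue_sections[OF _ ex unique])
    show "openin T W \<and> W \<subseteq> TT \<and> s \<in> P.sec W" if "good W s" for W s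
      using goodD(1,2)[OF that] openin_subset by simp
  qed
  then obtain g where g: "g \<in> PS.sec TT" and rep: "\<And>W s. good W s \<Longrightarrow> P.represents W g s"
    by metis
  have "contraction T A \<Omega> F g = t"
  proof (rule contraction_eqI[OF contraction_closed[OF g] t])
    fix V \<sigma> x assume V: "openin T V" and \<sigma>: "\<sigma> \<in> F.sec V" and x: "x \<in> V"
    have VT: "V \<subseteq> TT" by (rule openin_subset[OF V])
    obtain W s where W: "x \<in> W" "good W s" using ex x VT by (metis subsetD)
    note D = goodD[OF W(2)]
    have Z: "openin T (V \<inter> W)" by (rule openin_Int[OF V D(1)])
    note \<sigma>Z = F.res_closed[OF V Z Int_lower1 \<sigma>]
    \<comment> \<open>V and W need not be nested, so \<open>\<sigma>\<close> is first restricted to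
      the intersection, where (W, s) applies; naturality of \<open>t\<close> leads back to
      \<open>\<sigma>\<close> itself.\<close>
    have "Q.represents (V \<inter> W) (t (V \<inter> W) (mres F V (V \<inter> W) \<sigma>)) (contract W (V \<inter> W) (mres F V (V \<inter> W) \<sigma>) s)"
      by (rule D(3)[OF Z Int_lower2 \<sigma>Z])
    then have "Q.represents (V \<inter> W) (t V \<sigma>) (contract W (V \<inter> W) (mres F V (V \<inter> W) \<sigma>) s)"
      unfolding sheaf_hom_res[OF t V VT \<sigma> Z Int_lower1, symmetric] Q.mres_sheafify
        Q.represents_restrict_iff[OF subset_refl] .
    moreover have "Q.represents (V \<inter> W) (contraction T A \<Omega> F g V \<sigma>) (contract W (V \<inter> W) (mres F V (V \<inter> W) \<sigma>) s)"
      using represents_contraction[OF g V \<sigma> P.represents_res[OF rep[OF W(2)] Z Int_lower2] Int_lower1]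
      unfolding contract_res_left[OF D(1) Z Int_lower2 Z subset_refl \<sigma>Z D(2)] .
    ultimately show "\<exists>W s. x \<in> W \<and> Q.represents W (contraction T A \<Omega> F g V \<sigma>) s \<and> Q.represents W (t V \<sigma>) s"
      using W(1) x by (metis IntI)
  qed
  then show ?thesis using g by metis
qed

lemma contraction_bij:
  assumes "locally_free T A F"
  shows "bij_betw (contraction T A \<Omega> F) (PS.sec TT) (carrier (msec HQ TT))"
  unfolding bij_betw_def FQ.carrier_Hom
proof
  show "inj_on (contraction T A \<Omega> F) (PS.sec TT)"
    using contraction_inj[OF assms] by (intro inj_onI) metis
  show "contraction T A \<Omega> F ` PS.sec TT = sheaf_hom T A F QS TT"
    using contraction_closed contraction_surj[OF assms] by (auto simp: image_iff)
qed

end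

section \<open>Smooth functions and one-forms\<close>

text \<open>The model space carries the subspace topology of the product. Changing a coordinate with
  index below n is continuous in t and keeps the coordinates from n on at 0, so the line through x
  stays in the space and the preimage of \<open>S\<close> is open.\<close>

lemma eventually_fun_upd_in_open:
  assumes S: "openin (Euclidean_space n) S" and x: "x \<in> S" and i: "i < n"
  shows "eventually (\<lambda>t. x(i := t) \<in> S) (nhds (x i))"
proof -
  have xE: "x j = 0" if "j \<ge> n" for j
    using subsetD[OF openin_subset[OF S] x] that unfolding topspace_Euclidean_space by simp
  have "continuous_map euclideanreal euclideanreal (\<lambda>t. (x(i := t)) j)" for j
    by (cases "j = i") simp_all
  then have "continuous_map euclideanreal (powertop_real UNIV) (\<lambda>t. x(i := t))"
    by (simp only: continuous_map_componentwise_UNIV) blast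
  moreover have "(\<lambda>t. x(i := t)) \<in> topspace euclideanreal \<rightarrow> {x. \<forall>i\<ge>n. x i = 0}"
    using xE i by simp
  ultimately have "continuous_map euclideanreal (Euclidean_space n) (\<lambda>t. x(i := t))"
    unfolding Euclidean_space_def continuous_map_in_subtopology by (simp add: image_subset_iff_funcset)
  from openin_continuous_map_preimage[OF this S] have "open {t. x(i := t) \<in> S}"
    by (simp only: open_openin topspace_euclidean UNIV_I simp_thms)
  moreover have "x i \<in> {t. x(i := t) \<in> S}" using x by simp
  moreover have "\<forall>t\<in>{t. x(i := t) \<in> S}. x(i := t) \<in> S" by simp
  ultimately show ?thesis unfolding eventually_nhds by (intro exI conjI)
qed

lemma fun_upd_deriv_cong:
  assumes S: "openin (Euclidean_space n) S" and x: "x \<in> S" and i: "i < n" and eq: "\<And>y. y \<in> S \<Longrightarrow> f y = g y"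
  shows "((\<lambda>t. f (x(i := t))) has_field_derivative D) (at (x i)) \<longleftrightarrow>
      ((\<lambda>t. g (x(i := t))) has_field_derivative D) (at (x i))"
    and "partial_deriv i f x = partial_deriv i g x"
proof -
  have ev: "eventually (\<lambda>t. f (x(i := t)) = g (x(i := t))) (nhds (x i))"
    using eventually_fun_upd_in_open[OF S x i] by eventually_elim (rule eq)
  show "((\<lambda>t. f (x(i := t))) has_field_derivative D) (at (x i)) \<longleftrightarrow>
      ((\<lambda>t. g (x(i := t))) has_field_derivative D) (at (x i))"
    by (rule DERIV_cong_ev[OF refl ev refl])
  show "partial_deriv i f x = partial_deriv i g x"
    unfolding partial_deriv_def by (rule deriv_cong_ev[OF ev refl])
qed

text \<open>Functions that agree on the open set \<open>S\<close> have equal partial derivatives on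
  \<open>S\<close>, which is the hypothesis for the next order; hence the induction generalises over
  both functions.\<close>

lemma Ck_on_cong:
  assumes S: "openin (Euclidean_space n) S" and "Ck_on n k S f" and "\<And>y. y \<in> S \<Longrightarrow> f y = g y"
  shows "Ck_on n k S g"
proof -
  have cont: "continuous_map (subtopology (Euclidean_space n) S) euclideanreal g"
    if "continuous_map (subtopology (Euclidean_space n) S) euclideanreal f" "\<And>y. y \<in> S \<Longrightarrow> f y = g y" for f g
    by (rule continuous_map_eq[OF that(1)]) (simp add: that(2))
  from assms(2,3) show ?thesis
  proof (induction k arbitrary: f g)
    case 0
    then show ?case using cont by simp
  next
    case (Suc k)
    note D = Suc.prems(1)[unfolded Ck_on.simps]
    have "(\<lambda>t. g (x(i := t))) differentiable (at (x i))" if i: "i < n" and x: "x \<in> S" for i x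
    proof -
      have "(\<lambda>t. f (x(i := t))) differentiable (at (x i))" using D i x by simp
      then obtain d where "((\<lambda>t. f (x(i := t))) has_field_derivative d) (at (x i))"
        unfolding real_differentiable_def ..
      then have "((\<lambda>t. g (x(i := t))) has_field_derivative d) (at (x i))"
        using fun_upd_deriv_cong(1)[OF S x i, of f g d] Suc.prems(2) by simp
      then show ?thesis unfolding real_differentiable_def ..
    qed
    moreover have "Ck_on n k S (partial_deriv i g)" if i: "i < n" for i
    proof (rule Suc.IH)
      show "Ck_on n k S (partial_deriv i f)" using D i by simp
      show "partial_deriv i f y = partial_deriv i g y" if "y \<in> S" for y
        by (rule fun_upd_deriv_cong(2)[OF S that i Suc.prems(2)])
    qed
    moreover have "continuous_map (subtopology (Euclidean_space n) S) euclideanreal g"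
      by (rule cont[OF conjunct1[OF D] Suc.prems(2)])
    ultimately show ?case by simp
  qed
qed

lemma Ck_on_subset: "Ck_on n k S f \<Longrightarrow> S' \<subseteq> S \<Longrightarrow> Ck_on n k S' f"
  by (induction k arbitrary: f) (auto intro: continuous_map_from_subtopology_mono)

lemma Ck_on_SucD: "Ck_on n (Suc k) S f \<Longrightarrow> Ck_on n k S f"
proof (induction k arbitrary: f)
  case (Suc k)
  then show ?case unfolding Ck_on.simps(2)[of n "Suc k"] Ck_on.simps(2)[of n k] by blast
qed simp

lemma Ck_on_const: "Ck_on n k S (\<lambda>_. c)"
proof (induction k arbitrary: c)
  case (Suc k)
  have "partial_deriv i (\<lambda>_. c) = (\<lambda>_. 0)" for i by (simp add: partial_deriv_def fun_eq_iff)
  then show ?case using Suc by simp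
qed simp

lemma partial_deriv_exists:
  "(\<lambda>t. f (x(i := t))) differentiable (at (x i)) \<Longrightarrow>
    ((\<lambda>t. f (x(i := t))) has_field_derivative partial_deriv i f x) (at (x i))" for f :: "(nat \<Rightarrow> real) \<Rightarrow> real"
  unfolding partial_deriv_def by (metis DERIV_deriv_iff_real_differentiable)

lemma partial_deriv_add:
  assumes "(\<lambda>t. f (x(i := t))) differentiable (at (x i))" "(\<lambda>t. g (x(i := t))) differentiable (at (x i))"
  shows "((\<lambda>t. f (x(i := t)) + g (x(i := t))) has_field_derivative partial_deriv i f x + partial_deriv i g x) (at (x i))"
    and "partial_deriv i (\<lambda>y. f y + g y) x = partial_deriv i f x + partial_deriv i g x"
proof -
  show 1: "((\<lambda>t. f (x(i := t)) + g (x(i := t))) has_field_derivative partial_deriv i f x + partial_deriv i g x) (at (x i))"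
    by (rule DERIV_add[OF assms[THEN partial_deriv_exists]])
  show "partial_deriv i (\<lambda>y. f y + g y) x = partial_deriv i f x + partial_deriv i g x"
    unfolding partial_deriv_def[of i "\<lambda>y. f y + g y"] by (rule DERIV_imp_deriv[OF 1])
qed

lemma partial_deriv_mult:
  assumes "(\<lambda>t. f (x(i := t))) differentiable (at (x i))" "(\<lambda>t. g (x(i := t))) differentiable (at (x i))"
  shows "((\<lambda>t. f (x(i := t)) * g (x(i := t))) has_field_derivative f x * partial_deriv i g x + g x * partial_deriv i f x) (at (x i))"
    and "partial_deriv i (\<lambda>y. f y * g y) x = f x * partial_deriv i g x + g x * partial_deriv i f x"
proof -
  show 1: "((\<lambda>t. f (x(i := t)) * g (x(i := t))) has_field_derivative f x * partial_deriv i g x + g x * partial_deriv i f x) (at (x i))"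
    using DERIV_mult[OF assms[THEN partial_deriv_exists]]
    by (simp only: fun_upd_triv mult.commute add.commute)
  show "partial_deriv i (\<lambda>y. f y * g y) x = f x * partial_deriv i g x + g x * partial_deriv i f x"
    unfolding partial_deriv_def[of i "\<lambda>y. f y * g y"] by (rule DERIV_imp_deriv[OF 1])
qed

text \<open>Off \<open>S\<close> the summands may fail to be differentiable, where
  \<open>deriv\<close> need not obey the sum rule. The rule is used on \<open>S\<close> only, and
  \<open>Ck_on_cong\<close> transfers it.\<close>

lemma Ck_on_add:
  assumes S: "openin (Euclidean_space n) S" and "Ck_on n k S f" "Ck_on n k S g"
  shows "Ck_on n k S (\<lambda>x. f x + g x)"
  using assms(2,3)
proof (induction k arbitrary: f g)
  case 0
  then show ?case by (simp add: continuous_map_add)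
next
  case (Suc k)
  have d: "(\<lambda>t. f (x(i := t))) differentiable (at (x i))" "(\<lambda>t. g (x(i := t))) differentiable (at (x i))"
    if "i < n" "x \<in> S" for i x using Suc.prems that by auto
  have "Ck_on n k S (partial_deriv i (\<lambda>y. f y + g y))" if i: "i < n" for i
  proof (rule Ck_on_cong[OF S Suc.IH[of "partial_deriv i f" "partial_deriv i g"]])
    show "Ck_on n k S (partial_deriv i f)" "Ck_on n k S (partial_deriv i g)" using Suc.prems i by simp_all
    show "partial_deriv i f y + partial_deriv i g y = partial_deriv i (\<lambda>y. f y + g y) y" if y: "y \<in> S" for y
      by (rule partial_deriv_add(2)[OF d(1)[OF i y] d(2)[OF i y], symmetric])
  qed
  moreover have "(\<lambda>t. f (x(i := t)) + g (x(i := t))) differentiable (at (x i))" if "i < n" "x \<in> S" for i x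
    using partial_deriv_add(1)[OF d(1)[OF that] d(2)[OF that]] unfolding real_differentiable_def by metis
  ultimately show ?case using Suc.prems by (simp add: continuous_map_add)
qed

lemma Ck_on_mult:
  assumes S: "openin (Euclidean_space n) S" and "Ck_on n k S f" "Ck_on n k S g"
  shows "Ck_on n k S (\<lambda>x. f x * g x)"
  using assms(2,3)
proof (induction k arbitrary: f g)
  case 0
  then show ?case by (simp add: continuous_map_real_mult)
next
  case (Suc k)
  have d: "(\<lambda>t. f (x(i := t))) differentiable (at (x i))" "(\<lambda>t. g (x(i := t))) differentiable (at (x i))"
    if "i < n" "x \<in> S" for i x using Suc.prems that by auto
  \<comment> \<open>The Leibniz rule multiplies derivatives of order k smoothness by f and g
    themselves, so these are lowered from order k + 1 to order k.\<close>
  have fg: "Ck_on n k S f" "Ck_on n k S g" using Suc.prems by (auto intro: Ck_on_SucD simp del: Ck_on.simps)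
  have "Ck_on n k S (partial_deriv i (\<lambda>y. f y * g y))" if i: "i < n" for i
  proof (rule Ck_on_cong[OF S Ck_on_add[OF S]])
    show "Ck_on n k S (\<lambda>x. f x * partial_deriv i g x)" "Ck_on n k S (\<lambda>x. g x * partial_deriv i f x)"
      using Suc.IH[OF fg(1), of "partial_deriv i g"] Suc.IH[OF fg(2), of "partial_deriv i f"] Suc.prems i by auto
    show "f y * partial_deriv i g y + g y * partial_deriv i f y = partial_deriv i (\<lambda>y. f y * g y) y"
      if "y \<in> S" for y using partial_deriv_mult(2)[OF d(1)[OF i that] d(2)[OF i that]] by simp
  qed
  moreover have "(\<lambda>t. f (x(i := t)) * g (x(i := t))) differentiable (at (x i))" if "i < n" "x \<in> S" for i x
    using partial_deriv_mult(1)[OF d(1)[OF that] d(2)[OF that]] unfolding real_differentiable_def by metis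
  ultimately show ?case using Suc.prems by (simp add: continuous_map_real_mult)
qed

lemma smooth_on_differentiable:
  "smooth_on n S f \<Longrightarrow> x \<in> S \<Longrightarrow> i < n \<Longrightarrow> (\<lambda>t. f (x(i := t))) differentiable (at (x i))"
  unfolding smooth_on_def by (metis Ck_on.simps(2))

section \<open>Rings of smooth functions and modules of one-forms on a manifold\<close>

locale smooth_mfd =
  fixes n :: nat and T :: "'m topology" and Atl :: "'m chart set"
  assumes mfd: "smooth_manifold n T Atl"
begin

abbreviation "A \<equiv> smooth_functions n Atl"
abbreviation "Om \<equiv> one_forms n T Atl"
abbreviation "Tan \<equiv> tangent_space n T Atl"
abbreviation "Cotan \<equiv> cotangent_space n T Atl"
abbreviation "forms U \<equiv> carrier (msec Om U)"
abbreviation "fns U \<equiv> carrier (rsec A U)"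
abbreviation "C \<equiv> carrier (rsec A (topspace T))"

lemma chart:
  assumes "(D, \<phi>) \<in> Atl"
  shows chart_domain_open: "openin T D" and chart_inj: "inj_on \<phi> D"
    and chart_image_open: "\<And>U. openin T U \<Longrightarrow> openin (Euclidean_space n) (\<phi> ` (D \<inter> U))"
proof -
  have c: "openin T D" "openin (Euclidean_space n) (\<phi> ` D)"
    "homeomorphic_map (subtopology T D) (subtopology (Euclidean_space n) (\<phi> ` D)) \<phi>"
    using mfd assms by (auto simp: smooth_manifold_def chart_on_def)
  have D: "topspace (subtopology T D) = D" using openin_subset[OF c(1)] by (auto simp: topspace_subtopology)
  show "openin T D" by (rule c)
  show "inj_on \<phi> D" using homeomorphic_imp_injective_map[OF c(3)] unfolding D .
  show "openin (Euclidean_space n) (\<phi> ` (D \<inter> U))" if U: "openin T U" for U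
  proof -
    have "openin (subtopology T D) (D \<inter> U)"
      using openin_subtopology_Int[OF U, of D] by (simp add: Int_commute)
    then have "openin (subtopology (Euclidean_space n) (\<phi> ` D)) (\<phi> ` (D \<inter> U))"
      using homeomorphic_imp_open_map[OF c(3)] by (simp add: open_map_def)
    then show ?thesis using c(2) by (rule openin_trans_full)
  qed
qed

text \<open>The chart is fixed because the coefficient functions of a form depend on it.\<close>

definition chart_smooth :: "'m set \<Rightarrow> 'm set \<Rightarrow> ('m \<Rightarrow> nat \<Rightarrow> real) \<Rightarrow> ('m \<Rightarrow> real) \<Rightarrow> bool" where
  "chart_smooth U D \<phi> h \<longleftrightarrow> smooth_on n (\<phi> ` (D \<inter> U)) (\<lambda>y. h (inv_into D \<phi> y))"

lemma chart_smooth_cong: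
  assumes "(D, \<phi>) \<in> Atl" "openin T U" "chart_smooth U D \<phi> g" "\<And>p. p \<in> D \<Longrightarrow> p \<in> U \<Longrightarrow> g p = h p"
  shows "chart_smooth U D \<phi> h"
proof -
  have "g (inv_into D \<phi> y) = h (inv_into D \<phi> y)" if "y \<in> \<phi> ` (D \<inter> U)" for y
    using that assms(4) inv_into_f_f[OF chart_inj[OF assms(1)]] by auto
  then show ?thesis
    using assms(3) Ck_on_cong[OF chart_image_open[OF assms(1,2)]]
    unfolding chart_smooth_def smooth_on_def by metis
qed

lemma chart_smooth_ops:
  assumes "(D, \<phi>) \<in> Atl" "openin T U" "chart_smooth U D \<phi> g" "chart_smooth U D \<phi> h"
  shows "chart_smooth U D \<phi> (\<lambda>p. g p + h p)" "chart_smooth U D \<phi> (\<lambda>p. g p * h p)"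
  using assms(3,4) Ck_on_add[OF chart_image_open[OF assms(1,2)]] Ck_on_mult[OF chart_image_open[OF assms(1,2)]]
  unfolding chart_smooth_def smooth_on_def by simp_all

lemma chart_smooth_const: "chart_smooth U D \<phi> (\<lambda>_. c)"
  unfolding chart_smooth_def smooth_on_def by (simp add: Ck_on_const)

lemma chart_smooth_subset: "chart_smooth U D \<phi> h \<Longrightarrow> V \<subseteq> U \<Longrightarrow> chart_smooth V D \<phi> h"
  unfolding chart_smooth_def smooth_on_def
  by (meson Ck_on_subset Int_mono image_mono order_refl)

lemma carrier_A: "fns U = {f \<in> extensional U. \<forall>(D, \<phi>)\<in>Atl. chart_smooth U D \<phi> f}"
  by (simp add: smooth_functions_def chart_smooth_def)

lemma A_ops:
  "f \<oplus>\<^bsub>rsec A U\<^esub> g = (\<lambda>x\<in>U. f x + g x)" "f \<otimes>\<^bsub>rsec A U\<^esub> g = (\<lambda>x\<in>U. f x * g x)"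
  "\<zero>\<^bsub>rsec A U\<^esub> = (\<lambda>x\<in>U. 0)" "\<one>\<^bsub>rsec A U\<^esub> = (\<lambda>x\<in>U. 1)" "rres A U V f = restrict f V"
  by (simp_all add: smooth_functions_def)

lemma A_chart_smooth: "f \<in> fns U \<Longrightarrow> (D, \<phi>) \<in> Atl \<Longrightarrow> chart_smooth U D \<phi> f"
  by (auto simp: carrier_A)

lemma A_extensional: "f \<in> fns U \<Longrightarrow> f \<in> extensional U"
  by (simp add: carrier_A)

lemma restrict_in_A:
  assumes "openin T U" "\<And>D \<phi>. (D, \<phi>) \<in> Atl \<Longrightarrow> chart_smooth U D \<phi> h"
  shows "restrict h U \<in> fns U"
  unfolding carrier_A using chart_smooth_cong[OF _ assms(1) assms(2)] by auto

lemma A_closed: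
  assumes "openin T U"
  shows A_const_closed: "(\<lambda>x\<in>U. c) \<in> fns U"
    and A_add_closed: "f \<in> fns U \<Longrightarrow> g \<in> fns U \<Longrightarrow> (\<lambda>x\<in>U. f x + g x) \<in> fns U"
    and A_mult_closed: "f \<in> fns U \<Longrightarrow> g \<in> fns U \<Longrightarrow> (\<lambda>x\<in>U. f x * g x) \<in> fns U"
proof -
  show "(\<lambda>x\<in>U. c) \<in> fns U"
    by (rule restrict_in_A[OF assms chart_smooth_const])
  show "f \<in> fns U \<Longrightarrow> g \<in> fns U \<Longrightarrow> (\<lambda>x\<in>U. f x + g x) \<in> fns U"
    by (rule restrict_in_A[OF assms chart_smooth_ops(1)[OF _ assms A_chart_smooth A_chart_smooth]])
  show "f \<in> fns U \<Longrightarrow> g \<in> fns U \<Longrightarrow> (\<lambda>x\<in>U. f x * g x) \<in> fns U"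
    by (rule restrict_in_A[OF assms chart_smooth_ops(2)[OF _ assms A_chart_smooth A_chart_smooth]])
qed

lemma A_is_cring:
  assumes U: "openin T U"
  shows "cring (rsec A U)"
proof (rule cringI)
  note ext = A_extensional
  have neg: "(\<lambda>x\<in>U. - f x) \<in> fns U" if "f \<in> fns U" for f
  proof -
    have "(\<lambda>x\<in>U. - f x) = (\<lambda>x\<in>U. (\<lambda>x\<in>U. - 1) x * f x)" by (rule restrict_ext) simp
    then show ?thesis using A_mult_closed[OF U A_const_closed[OF U, of "-1"] that] by simp
  qed
  show "abelian_group (rsec A U)"
  proof (rule abelian_groupI'[where n = "\<lambda>f. \<lambda>x\<in>U. - f x"])
    show "\<zero>\<^bsub>rsec A U\<^esub> \<oplus>\<^bsub>rsec A U\<^esub> f = f" if "f \<in> fns U" for f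
      by (rule extensionalityI[OF _ ext[OF that]]) (simp_all add: A_ops)
  qed (simp_all add: A_ops A_closed[OF U] neg algebra_simps cong: restrict_cong)
  show "Group.comm_monoid (rsec A U)"
  proof (rule comm_monoidI)
    show "\<one>\<^bsub>rsec A U\<^esub> \<otimes>\<^bsub>rsec A U\<^esub> f = f" if "f \<in> fns U" for f
      by (rule extensionalityI[OF _ ext[OF that]]) (simp_all add: A_ops)
  qed (simp_all add: A_ops A_closed[OF U] algebra_simps cong: restrict_cong)
  show "(f \<oplus>\<^bsub>rsec A U\<^esub> g) \<otimes>\<^bsub>rsec A U\<^esub> h = f \<otimes>\<^bsub>rsec A U\<^esub> h \<oplus>\<^bsub>rsec A U\<^esub> g \<otimes>\<^bsub>rsec A U\<^esub> h" for f g h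
    by (simp add: A_ops algebra_simps cong: restrict_cong)
qed

lemma ringed_topology: "ringed_topology T A"
proof (rule ringed_topology.intro)
  show "cring (rsec A U)" if "openin T U" for U by (rule A_is_cring[OF that])
  show "rres A U V \<in> ring_hom (rsec A U) (rsec A V)" if U: "openin T U" and V: "openin T V" "V \<subseteq> U" for U V
  proof (rule ring_hom_memI)
    show "rres A U V f \<in> fns V" if "f \<in> fns U" for f
      unfolding A_ops by (rule restrict_in_A[OF V(1) chart_smooth_subset[OF A_chart_smooth[OF that] V(2)]])
  qed (use V(2) in \<open>auto simp: A_ops fun_eq_iff\<close>)
  show "rres A U U f = f" if "f \<in> fns U" for U f
    unfolding A_ops by (rule extensional_restrict[OF A_extensional[OF that]])
  show "rres A V W (rres A U V f) = rres A U W f" if "W \<subseteq> V" for U V W f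
    using that by (auto simp: A_ops fun_eq_iff)
qed

lemma C_closed:
  "f \<in> C \<Longrightarrow> g \<in> C \<Longrightarrow> f \<oplus>\<^bsub>rsec A (topspace T)\<^esub> g \<in> C"
  "f \<in> C \<Longrightarrow> g \<in> C \<Longrightarrow> f \<otimes>\<^bsub>rsec A (topspace T)\<^esub> g \<in> C"
  "f \<in> C \<Longrightarrow> (\<lambda>x\<in>topspace T. c) \<otimes>\<^bsub>rsec A (topspace T)\<^esub> f \<in> C"
  unfolding A_ops(1,2)
  by (rule A_add_closed[OF openin_topspace] A_mult_closed[OF openin_topspace]
      A_mult_closed[OF openin_topspace A_const_closed[OF openin_topspace]]; assumption)+

lemma mem_Tan: "v \<in> Tan p \<longleftrightarrow> v \<in> extensional C \<and>
    (\<forall>f\<in>C. \<forall>g\<in>C. v (f \<oplus>\<^bsub>rsec A (topspace T)\<^esub> g) = v f + v g) \<and>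
    (\<forall>c. \<forall>f\<in>C. v ((\<lambda>x\<in>topspace T. c) \<otimes>\<^bsub>rsec A (topspace T)\<^esub> f) = c * v f) \<and>
    (\<forall>f\<in>C. \<forall>g\<in>C. v (f \<otimes>\<^bsub>rsec A (topspace T)\<^esub> g) = f p * v g + g p * v f)"
  by (simp add: tangent_space_def Let_def)

lemma Tan_add: "v \<in> Tan p \<Longrightarrow> w \<in> Tan p \<Longrightarrow> (\<lambda>f\<in>C. v f + w f) \<in> Tan p"
  unfolding mem_Tan by (simp add: C_closed algebra_simps)

lemma Tan_scale: "v \<in> Tan p \<Longrightarrow> (\<lambda>f\<in>C. c * v f) \<in> Tan p"
  unfolding mem_Tan by (simp add: C_closed algebra_simps)

lemma mem_Cotan: "\<alpha> \<in> Cotan p \<longleftrightarrow> \<alpha> \<in> extensional (Tan p) \<and>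
    (\<forall>v\<in>Tan p. \<forall>w\<in>Tan p. \<alpha> (\<lambda>f\<in>C. v f + w f) = \<alpha> v + \<alpha> w) \<and>
    (\<forall>c. \<forall>v\<in>Tan p. \<alpha> (\<lambda>f\<in>C. c * v f) = c * \<alpha> v)"
  by (simp add: cotangent_space_def Let_def)

lemma Cotan_closed:
  "(\<lambda>v\<in>Tan p. 0) \<in> Cotan p"
  "\<alpha> \<in> Cotan p \<Longrightarrow> \<beta> \<in> Cotan p \<Longrightarrow> (\<lambda>v\<in>Tan p. \<alpha> v + \<beta> v) \<in> Cotan p"
  "\<alpha> \<in> Cotan p \<Longrightarrow> (\<lambda>v\<in>Tan p. a * \<alpha> v) \<in> Cotan p"
  unfolding mem_Cotan by (simp_all add: Tan_add Tan_scale algebra_simps)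

text \<open>The operations on forms are restricted to tangent vectors, so their coefficients in a
  chart have the expected formulas once the coordinate vectors are known to be tangent. The
  derivation rules are those of partial derivatives in the chart.\<close>

lemma coord_vector_in_Tan:
  assumes c: "(D, \<phi>) \<in> Atl" and p: "p \<in> D" and i: "i < n"
  shows "coord_vector n T Atl (D, \<phi>) i p \<in> Tan p"
proof -
  let ?v = "coord_vector n T Atl (D, \<phi>) i p" and ?S = "\<phi> ` (D \<inter> topspace T)" and ?x = "\<phi> p"
  have v: "?v f = partial_deriv i (\<lambda>y. f (inv_into D \<phi> y)) ?x" if "f \<in> C" for f
    using that by (simp add: coord_vector_def)
  have pT: "p \<in> topspace T" using openin_subset[OF chart_domain_open[OF c]] p by auto
  have S: "openin (Euclidean_space n) ?S" by (rule chart_image_open[OF c openin_topspace])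
  have x: "?x \<in> ?S" using p pT by auto
  have inv: "inv_into D \<phi> ?x = p" by (rule inv_into_f_f[OF chart_inj[OF c] p])
  have in_T: "inv_into D \<phi> y \<in> topspace T" if "y \<in> ?S" for y
    using that inv_into_f_f[OF chart_inj[OF c]] by auto
  have d: "(\<lambda>t. f (inv_into D \<phi> (?x(i := t)))) differentiable (at (?x i))" if "f \<in> C" for f
    using smooth_on_differentiable[OF A_chart_smooth[OF that c, unfolded chart_smooth_def] x i] .
  have add: "?v (f \<oplus>\<^bsub>rsec A (topspace T)\<^esub> g) = ?v f + ?v g" if "f \<in> C" "g \<in> C" for f g
  proof -
    \<comment> \<open>The pointwise formula for the sum holds only at points of the manifold, that
      is for y in \<open>?S\<close>; as \<open>?S\<close> is open, this determines the
      derivative.\<close>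
    have "partial_deriv i (\<lambda>y. (f \<oplus>\<^bsub>rsec A (topspace T)\<^esub> g) (inv_into D \<phi> y)) ?x
       = partial_deriv i (\<lambda>y. f (inv_into D \<phi> y) + g (inv_into D \<phi> y)) ?x"
      by (rule fun_upd_deriv_cong(2)[OF S x i]) (simp add: A_ops in_T)
    then show ?thesis
      using partial_deriv_add(2)[OF d[OF that(1)] d[OF that(2)]] by (simp only: v C_closed that)
  qed
  have mult: "?v (f \<otimes>\<^bsub>rsec A (topspace T)\<^esub> g) = f p * ?v g + g p * ?v f" if "f \<in> C" "g \<in> C" for f g
  proof -
    have "partial_deriv i (\<lambda>y. (f \<otimes>\<^bsub>rsec A (topspace T)\<^esub> g) (inv_into D \<phi> y)) ?x
       = partial_deriv i (\<lambda>y. f (inv_into D \<phi> y) * g (inv_into D \<phi> y)) ?x"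
      by (rule fun_upd_deriv_cong(2)[OF S x i]) (simp add: A_ops in_T)
    then show ?thesis
      using partial_deriv_mult(2)[OF d[OF that(1)] d[OF that(2)]] by (simp only: v C_closed that inv)
  qed
  \<comment> \<open>Homogeneity follows from the Leibniz rule, since the derivative of a constant
    function vanishes.\<close>
  have scale: "?v ((\<lambda>x\<in>topspace T. c) \<otimes>\<^bsub>rsec A (topspace T)\<^esub> f) = c * ?v f" if f: "f \<in> C" for c f
  proof -
    have k: "(\<lambda>x\<in>topspace T. c) \<in> C" by (rule A_const_closed[OF openin_topspace])
    have "partial_deriv i (\<lambda>y. (\<lambda>x\<in>topspace T. c) (inv_into D \<phi> y)) ?x = partial_deriv i (\<lambda>y. c) ?x"
      by (rule fun_upd_deriv_cong(2)[OF S x i]) (simp add: in_T)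
    then have "?v (\<lambda>x\<in>topspace T. c) = 0" unfolding v[OF k] by (simp add: partial_deriv_def)
    then show ?thesis using mult[OF k f] pT by simp
  qed
  have "?v \<in> extensional C" by (simp add: coord_vector_def)
  then show ?thesis unfolding mem_Tan using add mult scale by blast
qed

lemma mem_forms: "\<omega> \<in> forms U \<longleftrightarrow> \<omega> \<in> (\<Pi>\<^sub>E p\<in>U. Cotan p) \<and>
    (\<forall>(D, \<phi>)\<in>Atl. \<forall>i<n. chart_smooth U D \<phi> (\<lambda>p. \<omega> p (coord_vector n T Atl (D, \<phi>) i p)))"
  by (simp add: one_forms_def chart_smooth_def)

lemma forms_ops:
  "\<zero>\<^bsub>msec Om U\<^esub> = (\<lambda>p\<in>U. \<lambda>v\<in>Tan p. 0)"
  "\<omega> \<oplus>\<^bsub>msec Om U\<^esub> \<eta> = (\<lambda>p\<in>U. \<lambda>v\<in>Tan p. \<omega> p v + \<eta> p v)"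
  "f \<odot>\<^bsub>msec Om U\<^esub> \<omega> = (\<lambda>p\<in>U. \<lambda>v\<in>Tan p. f p * \<omega> p v)"
  "mres Om U V \<omega> = restrict \<omega> V"
  by (simp_all add: one_forms_def)

text \<open>The coefficient of a form built with \<open>restrict\<close> agrees with its natural
  formula only on the part of the chart inside \<open>U\<close>. Smoothness is proved for the
  formula \<open>h\<close> and then transferred.\<close>

lemma formsI:
  assumes U: "openin T U" and "\<And>p. p \<in> U \<Longrightarrow> \<omega> p \<in> Cotan p" and "\<omega> \<in> extensional U"
    and sm: "\<And>D \<phi> i. (D, \<phi>) \<in> Atl \<Longrightarrow> i < n \<Longrightarrow> chart_smooth U D \<phi> (h D \<phi> i)"
    and eq: "\<And>D \<phi> i p. (D, \<phi>) \<in> Atl \<Longrightarrow> i < n \<Longrightarrow> p \<in> D \<Longrightarrow> p \<in> U \<Longrightarrow>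
      h D \<phi> i p = \<omega> p (coord_vector n T Atl (D, \<phi>) i p)"
  shows "\<omega> \<in> forms U"
  unfolding mem_forms
proof (intro conjI ballI allI impI; (clarify)?)
  show "\<omega> \<in> (\<Pi>\<^sub>E p\<in>U. Cotan p)" using assms(2,3) by (simp add: PiE_iff)
  show "chart_smooth U D \<phi> (\<lambda>p. \<omega> p (coord_vector n T Atl (D, \<phi>) i p))" if "(D, \<phi>) \<in> Atl" "i < n" for D \<phi> i
    by (rule chart_smooth_cong[OF that(1) U sm[OF that] eq[OF that]])
qed

lemma formsD:
  assumes "\<omega> \<in> forms U"
  shows "\<omega> \<in> extensional U" "\<And>p. p \<in> U \<Longrightarrow> \<omega> p \<in> Cotan p" "\<And>p. p \<in> U \<Longrightarrow> \<omega> p \<in> extensional (Tan p)"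
    "\<And>D \<phi> i. (D, \<phi>) \<in> Atl \<Longrightarrow> i < n \<Longrightarrow> chart_smooth U D \<phi> (\<lambda>p. \<omega> p (coord_vector n T Atl (D, \<phi>) i p))"
  using assms unfolding mem_forms by (auto simp: PiE_iff mem_Cotan)

lemma forms_closed:
  assumes U: "openin T U"
  shows forms_zero_closed: "\<zero>\<^bsub>msec Om U\<^esub> \<in> forms U"
    and forms_add_closed: "\<omega> \<in> forms U \<Longrightarrow> \<eta> \<in> forms U \<Longrightarrow> \<omega> \<oplus>\<^bsub>msec Om U\<^esub> \<eta> \<in> forms U"
    and forms_smult_closed: "f \<in> fns U \<Longrightarrow> \<omega> \<in> forms U \<Longrightarrow> f \<odot>\<^bsub>msec Om U\<^esub> \<omega> \<in> forms U"
proof -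
  show "\<zero>\<^bsub>msec Om U\<^esub> \<in> forms U"
    unfolding forms_ops
    by (rule formsI[OF U, where h = "\<lambda>_ _ _ _. 0"]) (simp_all add: Cotan_closed chart_smooth_const coord_vector_in_Tan)
  show "\<omega> \<oplus>\<^bsub>msec Om U\<^esub> \<eta> \<in> forms U" if \<omega>: "\<omega> \<in> forms U" and \<eta>: "\<eta> \<in> forms U"
    unfolding forms_ops
    by (rule formsI[OF U, where h = "\<lambda>D \<phi> i p. \<omega> p (coord_vector n T Atl (D, \<phi>) i p) + \<eta> p (coord_vector n T Atl (D, \<phi>) i p)"])
      (simp_all add: Cotan_closed formsD[OF \<omega>] formsD[OF \<eta>] chart_smooth_ops[OF _ U] coord_vector_in_Tan)
  show "f \<odot>\<^bsub>msec Om U\<^esub> \<omega> \<in> forms U" if f: "f \<in> fns U" and \<omega>: "\<omega> \<in> forms U"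
    unfolding forms_ops
    by (rule formsI[OF U, where h = "\<lambda>D \<phi> i p. f p * \<omega> p (coord_vector n T Atl (D, \<phi>) i p)"])
      (simp_all add: Cotan_closed formsD[OF \<omega>] A_chart_smooth[OF f] chart_smooth_ops[OF _ U] coord_vector_in_Tan)
qed

lemma forms_eqI:
  assumes "\<omega> \<in> forms U" "\<eta> \<in> forms U"
    and "\<And>p v. p \<in> U \<Longrightarrow> v \<in> Tan p \<Longrightarrow> \<omega> p v = \<eta> p v"
  shows "\<omega> = \<eta>"
proof (rule extensionalityI[OF formsD(1)[OF assms(1)] formsD(1)[OF assms(2)]])
  fix p assume p: "p \<in> U"
  show "\<omega> p = \<eta> p"
    by (rule extensionalityI[OF formsD(3)[OF assms(1) p] formsD(3)[OF assms(2) p] assms(3)[OF p]])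
qed

lemma forms_module:
  assumes U: "openin T U"
  shows "module (rsec A U) (msec Om U)"
proof (rule moduleI)
  note cl = forms_closed[OF U]
  have m1: "(\<lambda>x\<in>U. - 1) \<in> fns U" by (rule A_const_closed[OF U])
  show "cring (rsec A U)" by (rule A_is_cring[OF U])
  show "abelian_group (msec Om U)"
  proof (rule abelian_groupI'[where n = "\<lambda>\<omega>. (\<lambda>x\<in>U. - 1) \<odot>\<^bsub>msec Om U\<^esub> \<omega>"])
    show "(\<omega> \<oplus>\<^bsub>msec Om U\<^esub> \<eta>) \<oplus>\<^bsub>msec Om U\<^esub> \<theta> = \<omega> \<oplus>\<^bsub>msec Om U\<^esub> (\<eta> \<oplus>\<^bsub>msec Om U\<^esub> \<theta>)"
      if "\<omega> \<in> forms U" "\<eta> \<in> forms U" "\<theta> \<in> forms U" for \<omega> \<eta> \<theta>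
      by (rule forms_eqI[OF cl(2)[OF cl(2)[OF that(1,2)] that(3)] cl(2)[OF that(1) cl(2)[OF that(2,3)]]])
        (simp add: forms_ops)
    show "\<omega> \<oplus>\<^bsub>msec Om U\<^esub> \<eta> = \<eta> \<oplus>\<^bsub>msec Om U\<^esub> \<omega>" for \<omega> \<eta>
      unfolding forms_ops by (simp add: add.commute)
    show "\<zero>\<^bsub>msec Om U\<^esub> \<oplus>\<^bsub>msec Om U\<^esub> \<omega> = \<omega>" if "\<omega> \<in> forms U" for \<omega>
      by (rule forms_eqI[OF cl(2)[OF cl(1) that] that]) (simp add: forms_ops)
    show "(\<lambda>x\<in>U. - 1) \<odot>\<^bsub>msec Om U\<^esub> \<omega> \<oplus>\<^bsub>msec Om U\<^esub> \<omega> = \<zero>\<^bsub>msec Om U\<^esub>" if "\<omega> \<in> forms U" for \<omega>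
      by (rule forms_eqI[OF cl(2)[OF cl(3)[OF m1 that] that] cl(1)]) (simp add: forms_ops)
  qed (simp_all add: cl m1)
  interpret A: cring "rsec A U" by (rule A_is_cring[OF U])
  show "(a \<oplus>\<^bsub>rsec A U\<^esub> b) \<odot>\<^bsub>msec Om U\<^esub> \<omega> = a \<odot>\<^bsub>msec Om U\<^esub> \<omega> \<oplus>\<^bsub>msec Om U\<^esub> b \<odot>\<^bsub>msec Om U\<^esub> \<omega>"
    if a: "a \<in> fns U" and b: "b \<in> fns U" and \<omega>: "\<omega> \<in> forms U" for a b \<omega>
    by (rule forms_eqI[OF cl(3)[OF A.a_closed[OF a b] \<omega>] cl(2)[OF cl(3)[OF a \<omega>] cl(3)[OF b \<omega>]]])
      (simp add: forms_ops A_ops algebra_simps)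
  show "(a \<otimes>\<^bsub>rsec A U\<^esub> b) \<odot>\<^bsub>msec Om U\<^esub> \<omega> = a \<odot>\<^bsub>msec Om U\<^esub> (b \<odot>\<^bsub>msec Om U\<^esub> \<omega>)"
    if a: "a \<in> fns U" and b: "b \<in> fns U" and \<omega>: "\<omega> \<in> forms U" for a b \<omega>
    by (rule forms_eqI[OF cl(3)[OF A.m_closed[OF a b] \<omega>] cl(3)[OF a cl(3)[OF b \<omega>]]])
      (simp add: forms_ops A_ops algebra_simps)
  show "a \<odot>\<^bsub>msec Om U\<^esub> (\<omega> \<oplus>\<^bsub>msec Om U\<^esub> \<eta>) = a \<odot>\<^bsub>msec Om U\<^esub> \<omega> \<oplus>\<^bsub>msec Om U\<^esub> a \<odot>\<^bsub>msec Om U\<^esub> \<eta>"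
    if a: "a \<in> fns U" and \<omega>: "\<omega> \<in> forms U" and \<eta>: "\<eta> \<in> forms U" for a \<omega> \<eta>
    by (rule forms_eqI[OF cl(3)[OF a cl(2)[OF \<omega> \<eta>]] cl(2)[OF cl(3)[OF a \<omega>] cl(3)[OF a \<eta>]]])
      (simp add: forms_ops A_ops algebra_simps)
  show "\<one>\<^bsub>rsec A U\<^esub> \<odot>\<^bsub>msec Om U\<^esub> \<omega> = \<omega>"
    if \<omega>: "\<omega> \<in> forms U" for \<omega>
    by (rule forms_eqI[OF cl(3)[OF A.one_closed \<omega>] \<omega>]) (simp add: forms_ops A_ops)
  show "a \<odot>\<^bsub>msec Om U\<^esub> \<omega> \<in> forms U" if a: "a \<in> fns U" and \<omega>: "\<omega> \<in> forms U" for a \<omega>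
    by (rule cl(3)[OF a \<omega>])
qed

lemma presheaf_forms: "presheaf_of_modules T A Om"
  unfolding presheaf_of_modules_def mem_opens_in forms_ops(4)
proof (intro conjI allI impI ballI; (elim conjE)?)
  fix U V \<omega> \<eta> f assume U: "openin T U" and V: "openin T V" "V \<subseteq> U" and \<omega>: "\<omega> \<in> forms U"
  show "restrict \<omega> V \<in> forms V"
    by (rule formsI[OF V(1), where h = "\<lambda>D \<phi> i p. \<omega> p (coord_vector n T Atl (D, \<phi>) i p)"])
      (use V(2) formsD(2)[OF \<omega>] chart_smooth_subset[OF formsD(4)[OF \<omega>] V(2)] in auto)
next
  fix U \<omega> assume "\<omega> \<in> forms U"
  then show "restrict \<omega> U = \<omega>" by (intro extensional_restrict formsD(1))
qed (auto simp: forms_module forms_ops(2,3) A_ops fun_eq_iff)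

end

section \<open>Real vector spaces of global sections\<close>

text \<open>Restriction of scalars along \<open>h\<close>. The module over \<open>K\<close> is a
  separate record, so its carrier, addition, zero and scalar action are matched with those of
  \<open>M\<close> one by one.\<close>

lemma module_scalar_restriction:
  assumes M: "module R M" and K: "cring K" and h: "h \<in> ring_hom K R"
    and eq: "carrier N = carrier M" "\<And>x y. x \<oplus>\<^bsub>N\<^esub> y = x \<oplus>\<^bsub>M\<^esub> y" "\<zero>\<^bsub>N\<^esub> = \<zero>\<^bsub>M\<^esub>"
      "\<And>c x. c \<odot>\<^bsub>N\<^esub> x = h c \<odot>\<^bsub>M\<^esub> x"
  shows "module K N"
proof -
  interpret M: module R M by fact
  interpret K: cring K by fact
  have hc: "h c \<in> carrier R" if "c \<in> carrier K" for c using ring_hom_closed[OF h that] .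
  show ?thesis
  proof (rule moduleI)
    show "abelian_group N"
      by (rule abelian_groupI'[where n = "a_inv M"]) (simp_all add: eq M.a_ac M.r_neg)
  qed (simp_all add: eq K hc M.smult_l_distr M.smult_r_distr M.smult_assoc1 ring_hom_add[OF h] ring_hom_mult[OF h] ring_hom_one[OF h])
qed

text \<open>The contraction is already bijective and linear over global smooth functions. Constant
  functions embed the reals as a ring into these, and \<open>global_sections\<close> lets the reals
  act through this embedding, so restriction of scalars gives the vector spaces and their
  isomorphism.\<close>

theorem lemma1:
  fixes n :: nat and M :: "'m topology" and Atl :: "'m chart set"
    and F :: "('m, 'm \<Rightarrow> real, 's) module_presheaf"
  defines "A \<equiv> smooth_functions n Atl"
  defines "A1 \<equiv> one_forms n M Atl"
  assumes "smooth_manifold n M Atl" and "compact_space M" and "connected_space M"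
    and "sheaf_of_modules M A F" and "coherent M A F" and "locally_free M A F"
  shows "vector_space_iso (ring_of_type_algebra :: real ring)
           (global_sections M (tensor_sheaf M A A1 (Hom_sheaf M A F F)))
           (global_sections M (Hom_sheaf M A F (tensor_sheaf M A A1 F)))
           (contraction M A A1 F)"
proof -
  interpret mfd: smooth_mfd n M Atl by (rule smooth_mfd.intro) fact
  interpret ringed_topology M A unfolding A_def by (rule mfd.ringed_topology)
  interpret contraction_data M A A1 F
  proof (intro contraction_data.intro module_presheaf_on.intro module_presheaf_on_axioms.intro)
    show "presheaf_of_modules M A A1" unfolding A_def A1_def by (rule mfd.presheaf_forms)
    show "presheaf_of_modules M A F" using assms(6) by (simp add: sheaf_of_modules_def)
  qed (rule ringed_topology_axioms)+
  let ?K = "ring_of_type_algebra :: real ring"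
  let ?R = "rsec A (topspace M)" and ?c = "\<lambda>c. \<lambda>x\<in>topspace M. c :: real"
  let ?V = "global_sections M PS" and ?W = "global_sections M (Hom_sheaf M A F QS)"
  have c: "?c \<in> ring_hom ?K ?R"
    by (rule ring_hom_memI)
      (auto simp: A_def ring_of_type_algebra_def mfd.A_ops mfd.A_const_closed[OF openin_topspace] fun_eq_iff)
  have K: "field ?K" by (rule field_from_type_algebra)
  have cK: "cring ?K" by (rule cring_from_type_algebra)
  have V: "module ?K ?V"
    by (rule module_scalar_restriction[OF PS.sec_module[OF openin_topspace] cK c])
      (simp_all add: global_sections_def Let_def)
  have W: "module ?K ?W"
    by (rule module_scalar_restriction[OF HQ.sec_module[OF openin_topspace] cK c])
      (simp_all add: global_sections_def Let_def)
  have bij: "bij_betw (contraction M A A1 F) (carrier ?V) (carrier ?W)"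
    using contraction_bij[OF assms(8)] by (simp add: global_sections_def Let_def)
  have "restrict (contraction M A A1 F) (carrier ?V) \<in> module_hom ?K ?V ?W"
    unfolding module_hom_def
  proof (intro CollectI conjI ballI)
    show "restrict (contraction M A A1 F) (carrier ?V) \<in> carrier ?V \<rightarrow>\<^sub>E carrier ?W"
      using bij_betw_imp_funcset[OF bij] by auto
    fix g assume g: "g \<in> carrier ?V"
    show "restrict (contraction M A A1 F) (carrier ?V) (g \<oplus>\<^bsub>?V\<^esub> h)
        = restrict (contraction M A A1 F) (carrier ?V) g \<oplus>\<^bsub>?W\<^esub> restrict (contraction M A A1 F) (carrier ?V) h"
      if h: "h \<in> carrier ?V" for h
      using g h contraction_add[of g h] PS.sec_closed(2)[OF openin_topspace, of g h]
      by (simp add: global_sections_def Let_def)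
    show "restrict (contraction M A A1 F) (carrier ?V) (r \<odot>\<^bsub>?V\<^esub> g)
        = r \<odot>\<^bsub>?W\<^esub> restrict (contraction M A A1 F) (carrier ?V) g"
      if r: "r \<in> carrier ?K" for r
      using g ring_hom_closed[OF c r] contraction_smult[of "?c r" g] PS.sec_closed(3)[OF openin_topspace, of "?c r" g]
      by (simp add: global_sections_def Let_def)
  qed
  then show ?thesis
    using K V W bij by (simp add: vector_space_iso_def tensor_sheaf_def)
qed

end
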